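(* Let $\mathcal L$ be the operator in $L_2(\mathbb R^d)$ given by $(\mathcal L u)(x)=\int_{\mathbb R^d}a(x-y)u(y)\,dy+V(x)u(x)$, where $a$ and $V$ satisfy the standing assumptions in the context. Let $x_0$ be a point of the global minimum of $V$. Let $a\in C^\infty(Q_r(0))$ for some $r>0$, and assume that for every $\alpha>0$ there is a constant $C>0$ such that $V(x)-V(x_0)\le C|x-x_0|^{\alpha}$ for all $x$ in a small neighbourhood of $x_0$. Assume furthermore that $V_{\min}\le a_{\min}$ and that there exist constants $\gamma>0$ and $c_1,c_2>0$ and an infinite subset $\mathbb I\subseteq\mathbb Z_+^d$ such that $$(-1)^{|n|}\partial^{2n}a(0)<0\quad\text{for all } n\in\mathbb I,$$ $$\big|\partial^{2n}a(0)\big|\ge c_1\big((2n)!\big)^{\gamma}\quad\text{for all } n\in\mathbb I,$$ $$\big|\partial^{n}a(0)\big|\le c_2(n!)^{\gamma}\quad\text{for all } n\in\mathbb Z_+^d.$$ Then $\mathcal L$ has infinitely many eigenvalues below $\mu_0$.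
   Context: Let $d\ge 1$. Standing assumptions: $a\in L_1(\mathbb R^d)$ is complex-valued with $a(-x)=\overline{a(x)}$; $V=\mathcal F[\hat V]$ for some $\hat V\in L_1(\mathbb R^d)$ with $\hat V(-x)=\overline{\hat V(x)}$, where $\mathcal F[u](x):=\int_{\mathbb R^d}u(\xi)e^{-\mathrm i x\cdot\xi}\,d\xi$. Put $\hat a:=\mathcal F[a]$. Then $\hat a$ and $V$ are real-valued, bounded, continuous and tend to zero at infinity. Define $a_{\min}:=\inf_{\mathbb R^d}\hat a$, $V_{\min}:=\inf_{\mathbb R^d}V$ and $\mu_0:=\min\{a_{\min},V_{\min}\}$. The operator $\mathcal L$ is bounded and self-adjoint in $L_2(\mathbb R^d)$, and $\mu_0$ is the bottom of its essential spectrum. $Q_r(x_0)$ denotes the cube in $\mathbb R^d$ with side $r$ centered at $x_0$. $\mathbb Z_+$ is the set of nonnegative integers; for $n\in\mathbb Z_+^d$, $|n|=n_1+\dots+n_d$, $n!=n_1!\cdots n_d!$ and $\partial^n$ is the corresponding partial derivative. The numbers $\partial^{2n}a(0)$ are real because $a(-x)=\overline{a(x)}$. *)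

theory Defs
  imports "HOL-Analysis.Analysis"
begin

(* Elements of L_1 and L_2 are represented by Lebesgue measurable functions,
   and identities between such elements are meant almost everywhere. *)

definition fourier :: "(real ^ 'n \<Rightarrow> complex) \<Rightarrow> real ^ 'n \<Rightarrow> complex" where
  "fourier u x = (\<integral>\<xi>. u \<xi> * exp (- \<i> * complex_of_real (x \<bullet> \<xi>)) \<partial>lebesgue)"

definition hermitian_ae :: "(real ^ 'n \<Rightarrow> complex) \<Rightarrow> bool" where
  "hermitian_ae f \<longleftrightarrow> (AE x in lebesgue. f (- x) = cnj (f x))"

definition L2 :: "(real ^ 'n \<Rightarrow> complex) set" where
  "L2 = {u. u \<in> borel_measurable lebesgue \<and> integrable lebesgue (\<lambda>x. (cmod (u x))\<^sup>2)}"

(* For a in L_1 and u in L_2 the integral converges absolutely for almost every x. *)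
definition conv_potential_op ::
    "(real ^ 'n \<Rightarrow> complex) \<Rightarrow> (real ^ 'n \<Rightarrow> complex) \<Rightarrow>
     (real ^ 'n \<Rightarrow> complex) \<Rightarrow> real ^ 'n \<Rightarrow> complex" where
  "conv_potential_op a V u x = (\<integral>y. a (x - y) * u y \<partial>lebesgue) + V x * u x"

definition L2_eigenvalue ::
    "((real ^ 'n \<Rightarrow> complex) \<Rightarrow> real ^ 'n \<Rightarrow> complex) \<Rightarrow> complex \<Rightarrow> bool" where
  "L2_eigenvalue T z \<longleftrightarrow>
     (\<exists>u \<in> L2. \<not> (AE x in lebesgue. u x = 0) \<and> (AE x in lebesgue. T u x = z * u x))"

definition open_cube :: "real \<Rightarrow> real ^ 'n \<Rightarrow> (real ^ 'n) set" where
  "open_cube r c = {x. \<forall>i. \<bar>x $ i - c $ i\<bar> < r / 2}"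

definition partial :: "'n \<Rightarrow> (real ^ 'n \<Rightarrow> complex) \<Rightarrow> real ^ 'n \<Rightarrow> complex" where
  "partial i f x = vector_derivative (\<lambda>t. f (x + t *\<^sub>R axis i 1)) (at 0)"

definition partials :: "'n list \<Rightarrow> (real ^ 'n \<Rightarrow> complex) \<Rightarrow> real ^ 'n \<Rightarrow> complex" where
  "partials is f = foldr partial is f"

(* Intended for open sets S only: the partial derivatives at a point of S
   use values of f along full line segments around that point. *)
definition C_infinity_on :: "(real ^ 'n) set \<Rightarrow> (real ^ 'n \<Rightarrow> complex) \<Rightarrow> bool" where
  "C_infinity_on S f \<longleftrightarrow>
     (\<forall>is. continuous_on S (partials is f) \<and>
       (\<forall>x \<in> S. \<forall>i. (\<lambda>t::real. partials is f (x + t *\<^sub>R axis i 1)) differentiable (at 0)))"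

(* Some enumeration of the coordinates; it only fixes the order of
   differentiation, which is immaterial for smooth functions. *)
definition coord_list :: "'n::finite list" where
  "coord_list = (SOME is. distinct is \<and> set is = UNIV)"

definition multi_partial ::
    "('n \<Rightarrow> nat) \<Rightarrow> (real ^ 'n \<Rightarrow> complex) \<Rightarrow> real ^ 'n \<Rightarrow> complex" where
  "multi_partial n f = partials (concat (map (\<lambda>i. replicate (n i) i) coord_list)) f"

definition mi_abs :: "('n::finite \<Rightarrow> nat) \<Rightarrow> nat" where
  "mi_abs n = (\<Sum>i\<in>UNIV. n i)"

definition mi_fact :: "('n::finite \<Rightarrow> nat) \<Rightarrow> real" where
  "mi_fact n = (\<Prod>i\<in>UNIV. fact (n i))"

definition mi_double :: "('n \<Rightarrow> nat) \<Rightarrow> 'n \<Rightarrow> nat" where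
  "mi_double n = (\<lambda>i. 2 * n i)"

end

(* Write T for the operator minus the bottom mu_0 of its essential spectrum. Two facts give infinitely
   many negative eigenvalues of T.

   First, for every d > 0 the form of T is bounded below by -d on the orthogonal complement of finitely
   many vectors. Outside a large ball the potential is small and the convolution form is at least a_min;
   inside the ball the potential is at least V_min; the cross terms contain the convolution after a cutoff
   to the ball, which is compact. Hence a minimising sequence of the form on the complement of
   finitely many eigenvectors is Cauchy up to finitely many directions, and as long as the infimum is
   negative its limit is a new eigenvector; finitely many values cannot carry infinitely many
   orthogonal eigenvectors.

   Second, the form is negative on subspaces of every finite dimension. Applying difference operators of
   multi-index n and step h to a normalised bump of radius h at x_0 gives vectors whose convolution form
   has the entries (-1)^|m| Re (partial^(n+m) a)(0) in the limit h -> 0, while the potential contributes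
   nothing because V - V_min vanishes to infinite order at x_0. The growth conditions bound the
   entry (n, m) relative to the diagonal by a power of ((n+m)!)^2 / ((2n)! (2m)!), which tends to 0 as
   m -> infinity, so that on a sparse subset of I the matrix is diagonally dominant and negative
   definite. *)

theory Submission
  imports Defs "HOL-Probability.Probability"
begin

section \<open>Negative eigenvalues of bounded self-adjoint operators\<close>

text \<open>The space \<open>l2\<close> carries the real part of the complex inner product, so every
  form below is real bilinear, and counting directions over the reals leaves finiteness as it is. A
  bound of the form modulo finitely many vectors stands in for the essential spectrum, and the
  convolution form is bounded below by Gaussian summation of Fourier inversion at 0.

  The obstacle in the second fact is that \<open>a\<close> is smooth only near 0. The differences
  therefore act on the translation parameter of the bumps: the convolution form of two translates
  depends only on the difference of their parameters, so the two difference operators merge into a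
  single one that acts on \<open>a\<close> near 0. Since the radius of the bump equals the step,
  each test vector lives at distance of order h from \<open>x0\<close>; differences and
  normalisation cost a fixed negative power of h, which flatness of high enough order outweighs. The
  finite set of multi-indices is fixed before h, from the limit matrix, whose strict inequalities
  persist for small h.\<close>

lemma homogeneous_system:
  fixes g :: "'j \<Rightarrow> 'f \<Rightarrow> real"
  assumes "finite F" "finite J" "card F < card J"
  shows "\<exists>z. (\<exists>j\<in>J. z j \<noteq> 0) \<and> (\<forall>f\<in>F. (\<Sum>j\<in>J. z j * g j f) = 0)"
  using assms
proof (induction F arbitrary: J g rule: finite_induct)
  case empty
  then obtain j where "j \<in> J" by fastforce
  then show ?case by (intro exI[of _ "\<lambda>_. 1"]) auto
next
  case (insert f F)
  show ?case
  proof (cases "\<forall>j\<in>J. g j f = 0")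
    case True
    have "card F < card J" using insert by simp
    from insert.IH[OF insert.prems(1) this, of g] obtain z where
      "\<exists>j\<in>J. z j \<noteq> 0" "\<forall>f\<in>F. (\<Sum>j\<in>J. z j * g j f) = 0" by blast
    with True show ?thesis by (intro exI[of _ z]) auto
  next
    case False
    then obtain k where k: "k \<in> J" "g k f \<noteq> 0" by blast
    let ?J = "J - {k}"
    \<comment> \<open>Gaussian elimination with pivot \<open>g k f\<close>: equation
      \<open>f\<close> determines the unknown at \<open>k\<close>, and substituting it into the
      other equations gives these coefficients. The vector \<open>y\<close> below restores the
      eliminated unknown.\<close>
    let ?g = "\<lambda>j e. g j e - (g j f / g k f) * g k e"
    have "card F < card ?J" using insert k by simp
    from insert.IH[OF _ this, of ?g] insert.prems(1) obtain z where
      z: "\<exists>j\<in>?J. z j \<noteq> 0" "\<And>e. e \<in> F \<Longrightarrow> (\<Sum>j\<in>?J. z j * ?g j e) = 0" by blast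
    define y where "y = z(k := - (\<Sum>j\<in>?J. z j * (g j f / g k f)))"
    have S: "(\<Sum>j\<in>J. y j * g j e) = (\<Sum>j\<in>?J. z j * ?g j e)" for e
    proof -
      have "(\<Sum>j\<in>J. y j * g j e) = y k * g k e + (\<Sum>j\<in>?J. y j * g j e)"
        using k insert.prems(1) by (simp add: sum.remove)
      also have "(\<Sum>j\<in>?J. y j * g j e) = (\<Sum>j\<in>?J. z j * g j e)"
        by (rule sum.cong) (auto simp: y_def)
      finally show ?thesis
        by (simp add: y_def algebra_simps sum_subtractf sum_distrib_left sum_distrib_right)
    qed
    have "(\<Sum>j\<in>J. y j * g j f) = 0" unfolding S using k by simp
    moreover have "\<exists>j\<in>J. y j \<noteq> 0" using z(1) by (auto simp: y_def)
    ultimately show ?thesis using S z(2) by (intro exI[of _ y]) auto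
  qed
qed

lemma bounded_family_convergent_subseq:
  fixes c :: "nat \<Rightarrow> 'f \<Rightarrow> real"
  assumes "finite F" "\<And>f. f \<in> F \<Longrightarrow> bounded (range (\<lambda>j. c j f))"
  shows "\<exists>r::nat \<Rightarrow> nat. strict_mono r \<and> (\<forall>f\<in>F. convergent (\<lambda>j. c (r j) f))"
  using assms
proof (induction F rule: finite_induct)
  case empty
  show ?case by (intro exI[of _ id]) (auto simp: strict_mono_def)
next
  case (insert f F)
  then obtain r where r: "strict_mono r" "\<forall>f\<in>F. convergent (\<lambda>j. c (r j) f)" by auto
  have "bounded (range (\<lambda>j. c (r j) f))"
    by (rule bounded_subset[OF insert.prems[of f]]) auto
  then obtain l s where s: "strict_mono s" "((\<lambda>j. c (r j) f) \<circ> s) \<longlonglongrightarrow> l"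
    using bounded_imp_convergent_subsequence[of "\<lambda>j. c (r j) f"] by blast
  have "convergent (\<lambda>j. c ((r \<circ> s) j) e)" if "e \<in> insert f F" for e
  proof (cases "e = f")
    case True
    with s show ?thesis by (auto simp: convergent_def o_def)
  next
    case False
    with that r have "convergent (\<lambda>j. c (r j) e)" by auto
    from convergent_subseq_convergent[OF this s(1)] show ?thesis by (simp add: o_def)
  qed
  then show ?case using strict_mono_o[OF r(1) s(1)] by blast
qed

text \<open>The vectors need not be normalised and one of them may be 0: the indicators of cells
  used later are orthogonal, and the indicator of a null cell is the zero vector.\<close>

lemma sum_orthogonal_inner:
  fixes z :: "'a::real_inner \<Rightarrow> real"
  assumes "finite E" "pairwise orthogonal E" "e \<in> E"
  shows "(\<Sum>x\<in>E. z x *\<^sub>R x) \<bullet> e = z e * (e \<bullet> e)"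
proof -
  have "(\<Sum>x\<in>E. z x *\<^sub>R x) \<bullet> e = (\<Sum>x\<in>E. if x = e then z e * (e \<bullet> e) else 0)"
    unfolding inner_sum_left
    by (rule sum.cong) (use assms in \<open>auto simp: pairwise_def orthogonal_def\<close>)
  then show ?thesis using assms by simp
qed

text \<open>The minimising sequence of the form on the orthogonal complement of \<^term>\<open>E\<close> is Cauchy: up to the
  finitely many directions in \<^term>\<open>F\<close>, along which a subsequence converges, the form exceeds its infimum.\<close>

lemma negative_eigenvector_orthogonal:
  fixes T :: "'a::{real_inner,complete_space} \<Rightarrow> 'a"
  assumes T: "bounded_linear T" and sym: "\<And>x y. T x \<bullet> y = x \<bullet> T y"
    and ess: "\<And>d. d > 0 \<Longrightarrow> \<exists>F. finite F \<and> pairwise orthogonal F \<and>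
                 (\<forall>u. (\<forall>f\<in>F. u \<bullet> f = 0) \<longrightarrow> T u \<bullet> u \<ge> - d * (u \<bullet> u))"
    and E: "finite E" "\<And>e. e \<in> E \<Longrightarrow> \<exists>k. T e = k *\<^sub>R e"
    and neg: "\<exists>u. (\<forall>e\<in>E. u \<bullet> e = 0) \<and> T u \<bullet> u < 0"
  shows "\<exists>u k. norm u = 1 \<and> (\<forall>e\<in>E. u \<bullet> e = 0) \<and> k < 0 \<and> T u = k *\<^sub>R u"
proof -
  interpret T: bounded_linear T by fact
  obtain K where K: "K > 0" "\<And>x. norm (T x) \<le> norm x * K" using T.pos_bounded by blast
  have Tb: "\<bar>T x \<bullet> y\<bar> \<le> K * norm x * norm y" for x y
  proof -
    have "\<bar>T x \<bullet> y\<bar> \<le> norm (T x) * norm y" by (rule Cauchy_Schwarz_ineq2)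
    also have "\<dots> \<le> (norm x * K) * norm y" by (intro mult_right_mono K) auto
    finally show ?thesis by (simp add: mult_ac)
  qed
  define H where "H = {u. \<forall>e\<in>E. u \<bullet> e = 0}"
  have Hadd: "x + y \<in> H" "x - y \<in> H" if "x \<in> H" "y \<in> H" for x y
    using that by (auto simp: H_def inner_add_left inner_diff_left)
  have Hscale: "c *\<^sub>R x \<in> H" if "x \<in> H" for x c
    using that by (auto simp: H_def)
  have HT: "T x \<in> H" if "x \<in> H" for x
  proof -
    have "T x \<bullet> e = 0" if e: "e \<in> E" for e
    proof -
      obtain k where "T e = k *\<^sub>R e" using E(2)[OF e] by blast
      then show ?thesis using \<open>x \<in> H\<close> e by (simp add: sym H_def)
    qed
    then show ?thesis by (simp add: H_def)
  qed
  define S where "S = {T u \<bullet> u | u. u \<in> H \<and> norm u = 1}"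
  define \<nu> where "\<nu> = Inf S"
  have bdd: "bdd_below S"
  proof (rule bdd_belowI)
    fix s assume "s \<in> S"
    then obtain u where "s = T u \<bullet> u" "norm u = 1" by (auto simp: S_def)
    then show "- K \<le> s" using Tb[of u u] by auto
  qed
  obtain u0 where u0: "u0 \<in> H" "T u0 \<bullet> u0 < 0" using neg by (auto simp: H_def)
  have u00: "u0 \<noteq> 0" using u0 by (auto simp: T.zero)
  define u1 where "u1 = (1 / norm u0) *\<^sub>R u0"
  have u1: "u1 \<in> H" "norm u1 = 1" "T u1 \<bullet> u1 < 0"
    using u0 u00 by (auto simp: u1_def Hscale T.scaleR divide_neg_pos mult_pos_neg)
  then have S1: "T u1 \<bullet> u1 \<in> S" by (auto simp: S_def)
  have nu: "\<nu> < 0" using cInf_lower[OF S1 bdd] u1 by (simp add: \<nu>_def)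
  define b where "b u = T u \<bullet> u - \<nu> * (u \<bullet> u)" for u
  have b0: "b u \<ge> 0" if "u \<in> H" for u
  proof (cases "u = 0")
    case False
    have "T ((1 / norm u) *\<^sub>R u) \<bullet> ((1 / norm u) *\<^sub>R u) \<in> S"
      using that False by (auto simp: S_def Hscale intro!: exI[of _ "(1 / norm u) *\<^sub>R u"])
    then have "\<nu> \<le> T ((1 / norm u) *\<^sub>R u) \<bullet> ((1 / norm u) *\<^sub>R u)"
      unfolding \<nu>_def by (rule cInf_lower[OF _ bdd])
    also have "\<dots> = (T u \<bullet> u) / (norm u)\<^sup>2" by (simp add: T.scaleR power2_eq_square)
    finally show ?thesis using False by (simp add: b_def field_simps power2_norm_eq_inner)
  qed (simp add: b_def T.zero)
  \<comment> \<open>The parallelogram law for the quadratic form \<open>b\<close>, with the term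
    \<open>b (x + y) \<ge> 0\<close> dropped. It makes \<open>b\<close> small on differences of
    members of a minimising sequence.\<close>
  have bpar: "b (x - y) \<le> 2 * b x + 2 * b y" if "x \<in> H" "y \<in> H" for x y
  proof -
    have "b (x - y) + b (x + y) = 2 * b x + 2 * b y"
      by (simp add: b_def T.diff T.add inner_simps algebra_simps inner_commute)
    then show ?thesis using b0[of "x + y"] that by (auto simp: Hadd)
  qed
  have "\<exists>u. u \<in> H \<and> norm u = 1 \<and> b u < 1 / Suc n" for n
  proof -
    have "\<exists>s\<in>S. s < \<nu> + 1 / Suc n"
      unfolding \<nu>_def by (rule cInf_lessD) (use S1 in auto)
    then show ?thesis by (auto simp: S_def b_def power2_norm_eq_inner[symmetric])
  qed
  then obtain u where u: "\<And>n. u n \<in> H" "\<And>n. norm (u n) = 1" "\<And>n. b (u n) < 1 / Suc n"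
    by metis
  \<comment> \<open>The level \<open>\<nu> / 2\<close> lies strictly between the infimum
    \<open>\<nu>\<close> and 0. The gap of \<open>- \<nu> / 2\<close> that it leaves is what
    controls the norm in \<open>key\<close>.\<close>
  obtain F where F: "finite F" "pairwise orthogonal F"
    "\<And>u. (\<forall>f\<in>F. u \<bullet> f = 0) \<Longrightarrow> T u \<bullet> u \<ge> \<nu> / 2 * (u \<bullet> u)"
    using ess[of "- \<nu> / 2"] nu by auto
  have "bounded (range (\<lambda>j. u j \<bullet> f))" for f
  proof (rule boundedI)
    fix x assume "x \<in> range (\<lambda>j. u j \<bullet> f)"
    then obtain j where "x = u j \<bullet> f" by auto
    then show "norm x \<le> norm f" using Cauchy_Schwarz_ineq2[of "u j" f] u(2) by simp
  qed
  with bounded_family_convergent_subseq[OF F(1), of "\<lambda>j f. u j \<bullet> f"] obtain r :: "nat \<Rightarrow> nat" where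
    r: "strict_mono r" "\<And>f. f \<in> F \<Longrightarrow> convergent (\<lambda>j. u (r j) \<bullet> f)" by auto
  \<comment> \<open>The orthogonal projection onto the span of \<open>F\<close>. Division by zero
    gives the coefficient 0, which is right for a zero vector in \<open>F\<close>.\<close>
  define P where "P x = (\<Sum>f\<in>F. ((x \<bullet> f) / (f \<bullet> f)) *\<^sub>R f)" for x
  have Pdiff: "P (x - y) = P x - P y" for x y
    by (simp add: P_def inner_diff_left diff_divide_distrib scaleR_left_diff_distrib sum_subtractf)
  have PF: "(x - P x) \<bullet> f = 0" if "f \<in> F" for x f
    using sum_orthogonal_inner[OF F(1,2) that, of "\<lambda>f. (x \<bullet> f) / (f \<bullet> f)"]
    by (cases "f = 0") (auto simp: P_def inner_diff_left)
  have Porth: "(x - P x) \<bullet> P x = 0" for x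
    unfolding P_def[of x] inner_sum_right
    by (rule sum.neutral) (use PF in \<open>auto simp: P_def\<close>)
  have pyth: "x \<bullet> x = (x - P x) \<bullet> (x - P x) + P x \<bullet> P x" for x
    using Porth[of x] by (simp add: inner_simps inner_commute)
  have Pn: "norm (P x) \<le> norm x" "norm (x - P x) \<le> norm x" for x
    using pyth[of x] by (auto simp: norm_le)
  \<comment> \<open>On the part orthogonal to \<open>F\<close> the form is at least
    \<open>\<nu> / 2\<close> times the squared norm, while \<open>b\<close> subtracts
    \<open>\<nu>\<close>. The two cross terms and the form of \<open>P v\<close> are each at most
    \<open>2 * K * norm (P v)\<close>, whence the 6. The bound 2 on the norm fits differences of
    unit vectors.\<close>
  have key: "(- \<nu> / 2) * (norm v)\<^sup>2 \<le> b v + 6 * K * norm (P v)" if "norm v \<le> 2" for v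
  proof -
    let ?w = "v - P v"
    have "T v \<bullet> v = T (?w + P v) \<bullet> (?w + P v)" by simp
    also have "\<dots> = T ?w \<bullet> ?w + 2 * (T (P v) \<bullet> ?w) + T (P v) \<bullet> P v"
      unfolding T.add inner_add_left inner_add_right
      using sym[of ?w "P v"] by (simp add: inner_commute)
    finally have e: "T v \<bullet> v = T ?w \<bullet> ?w + 2 * (T (P v) \<bullet> ?w) + T (P v) \<bullet> P v" .
    have "\<nu> / 2 * (?w \<bullet> ?w) \<ge> \<nu> / 2 * (v \<bullet> v)"
      using pyth[of v] nu by (simp add: mult_left_mono_neg)
    then have 1: "T ?w \<bullet> ?w \<ge> \<nu> / 2 * (norm v)\<^sup>2" using F(3)[of ?w] PF by (simp add: power2_norm_eq_inner)
    have "\<bar>T (P v) \<bullet> ?w\<bar> \<le> K * norm (P v) * norm ?w" by (rule Tb)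
    also have "\<dots> \<le> K * norm (P v) * 2"
      using Pn(2)[of v] that K by (intro mult_left_mono) auto
    finally have 2: "\<bar>T (P v) \<bullet> ?w\<bar> \<le> K * norm (P v) * 2" .
    have "\<bar>T (P v) \<bullet> P v\<bar> \<le> K * norm (P v) * norm (P v)" by (rule Tb)
    also have "\<dots> \<le> K * norm (P v) * 2"
      using Pn(1)[of v] that K by (intro mult_left_mono) auto
    finally have 3: "\<bar>T (P v) \<bullet> P v\<bar> \<le> K * norm (P v) * 2" .
    show ?thesis using e 1 2 3 by (simp add: b_def power2_norm_eq_inner abs_le_iff algebra_simps)
  qed
  have Pconv: "convergent (\<lambda>j. P (u (r j)))"
  proof -
    have "\<exists>c. \<forall>f\<in>F. (\<lambda>j. u (r j) \<bullet> f) \<longlonglongrightarrow> c f"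
      using r(2) unfolding convergent_def by metis
    then obtain c where c: "\<And>f. f \<in> F \<Longrightarrow> (\<lambda>j. u (r j) \<bullet> f) \<longlonglongrightarrow> c f" by blast
    have "(\<lambda>j. P (u (r j))) \<longlonglongrightarrow> (\<Sum>f\<in>F. (c f / (f \<bullet> f)) *\<^sub>R f)"
      unfolding P_def divide_inverse
      by (intro tendsto_sum tendsto_scaleR tendsto_mult c tendsto_const)
    then show ?thesis by (auto simp: convergent_def)
  qed
  have blim: "(\<lambda>j. b (u (r j))) \<longlonglongrightarrow> 0"
  proof -
    have "(\<lambda>j. b (u j)) \<longlonglongrightarrow> 0"
      by (rule tendsto_sandwich[OF _ _ tendsto_const LIMSEQ_Suc[OF lim_1_over_n]])
         (use b0 u in \<open>auto intro!: always_eventually less_imp_le\<close>)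
    from LIMSEQ_subseq_LIMSEQ[OF this r(1)] show ?thesis by (simp add: o_def)
  qed
  have "Cauchy (\<lambda>j. u (r j))"
  proof (rule CauchyI)
    fix e :: real assume e: "e > 0"
    \<comment> \<open>Chosen so that \<open>(4 + 6 * K) * d\<close> equals
      \<open>(- \<nu> / 2) * e^2\<close>: the parallelogram bound contributes 4 times
      \<open>d\<close> and the projection term \<open>6 * K\<close> times.\<close>
    define d where "d = (- \<nu> / 2) * e\<^sup>2 / (4 + 6 * K)"
    have d: "d > 0" using nu e K by (auto simp: d_def divide_neg_pos mult_neg_pos)
    obtain M1 where M1: "\<And>m n. m \<ge> M1 \<Longrightarrow> n \<ge> M1 \<Longrightarrow> norm (P (u (r m)) - P (u (r n))) < d"
      using Pconv d by (meson CauchyD convergent_Cauchy)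
    obtain M2 where M2: "\<And>n. n \<ge> M2 \<Longrightarrow> b (u (r n)) < d"
      using order_tendstoD(2)[OF blim d] by (auto simp: eventually_sequentially)
    have "norm (u (r m) - u (r n)) < e" if "m \<ge> max M1 M2" "n \<ge> max M1 M2" for m n
    proof -
      let ?v = "u (r m) - u (r n)"
      have "norm ?v \<le> 2" using norm_triangle_ineq4[of "u (r m)" "u (r n)"] u(2) by simp
      from key[OF this] have "(- \<nu> / 2) * (norm ?v)\<^sup>2 \<le> b ?v + 6 * K * norm (P ?v)" .
      also have "\<dots> \<le> 2 * b (u (r m)) + 2 * b (u (r n)) + 6 * K * norm (P ?v)"
        by (intro add_right_mono bpar) (auto simp: u)
      also have "2 * b (u (r m)) + 2 * b (u (r n)) + 6 * K * norm (P ?v) < 2 * d + 2 * d + 6 * K * d"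
        unfolding Pdiff using M1[of m n] M2[of m] M2[of n] that K
        by (intro add_strict_mono mult_strict_left_mono) auto
      also have "\<dots> = (4 + 6 * K) * d" by (simp add: algebra_simps)
      also have "\<dots> = (- \<nu> / 2) * e\<^sup>2"
      proof -
        have "4 + 6 * K \<noteq> 0" using K by linarith
        then show ?thesis unfolding d_def by (subst times_divide_eq_right) (rule nonzero_mult_div_cancel_left)
      qed
      finally have "(norm ?v)\<^sup>2 < e\<^sup>2" using nu by (subst (asm) mult_less_cancel_left_pos) auto
      then show ?thesis using e by (auto intro: power2_less_imp_less)
    qed
    then show "\<exists>M. \<forall>m\<ge>M. \<forall>n\<ge>M. norm (u (r m) - u (r n)) < e" by blast
  qed
  then obtain w where w: "(\<lambda>j. u (r j)) \<longlonglongrightarrow> w" using Cauchy_convergent by (auto simp: convergent_def)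
  have wH: "w \<in> H"
  proof -
    have "w \<bullet> e = 0" if "e \<in> E" for e
    proof (rule LIMSEQ_unique)
      show "(\<lambda>j. u (r j) \<bullet> e) \<longlonglongrightarrow> w \<bullet> e" by (intro tendsto_inner w tendsto_const)
      show "(\<lambda>j. u (r j) \<bullet> e) \<longlonglongrightarrow> 0" using u(1) that by (simp add: H_def)
    qed
    then show ?thesis by (simp add: H_def)
  qed
  have wn: "norm w = 1" using tendsto_norm[OF w] u(2) by (simp add: LIMSEQ_const_iff)
  have "(\<lambda>j. b (u (r j))) \<longlonglongrightarrow> b w"
    unfolding b_def by (intro tendsto_diff tendsto_mult tendsto_inner tendsto_const w T.tendsto)
  then have bw: "b w = 0" using blim LIMSEQ_unique by blast
  define B where "B x = T x - \<nu> *\<^sub>R x" for x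
  have bB: "b x = B x \<bullet> x" for x by (simp add: b_def B_def inner_diff_left)
  have BH: "B w \<in> H" unfolding B_def by (intro Hadd Hscale HT wH)
  \<comment> \<open>A first variation: moving the minimiser \<open>w\<close> in the direction
    \<open>- B w\<close>, which stays in \<open>H\<close>, changes \<open>b\<close> by
    \<open>- 2 * t\<close> times the squared norm of \<open>B w\<close> up to order
    \<open>t^2\<close>. Unless \<open>B w\<close> vanishes this makes \<open>b\<close>
    negative.\<close>
  have "B w = 0"
  proof (rule ccontr)
    assume nz: "B w \<noteq> 0"
    define h where "h = B w"
    have hh: "h \<bullet> h > 0" using nz by (simp add: h_def)
    have exp: "b (w - t *\<^sub>R h) = - 2 * t * (h \<bullet> h) + t\<^sup>2 * b h" for t
    proof -
      have "B (w - t *\<^sub>R h) = h - t *\<^sub>R B h" by (simp add: B_def h_def T.diff T.add T.scaleR algebra_simps)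
      then have "b (w - t *\<^sub>R h) = (h - t *\<^sub>R B h) \<bullet> (w - t *\<^sub>R h)" by (simp add: bB)
      also have "\<dots> = h \<bullet> w - t * (h \<bullet> h) - t * (B h \<bullet> w) + t\<^sup>2 * (B h \<bullet> h)"
        by (simp add: inner_simps algebra_simps power2_eq_square)
      also have "h \<bullet> w = 0" using bw by (simp add: bB h_def)
      also have "B h \<bullet> w = h \<bullet> h"
      proof -
        have "B h \<bullet> w = T h \<bullet> w - \<nu> * (h \<bullet> w)" by (simp add: B_def inner_diff_left)
        also have "\<dots> = h \<bullet> T w - \<nu> * (h \<bullet> w)" by (simp only: sym)
        also have "\<dots> = h \<bullet> h" by (simp add: h_def B_def inner_diff_right)
        finally show ?thesis .
      qed
      finally show ?thesis by (simp add: bB)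
    qed
    have hH: "h \<in> H" using BH by (simp add: h_def)
    \<comment> \<open>The summand 1 keeps the denominator positive when \<open>b h = 0\<close> and
      still gives \<open>t * b h \<le> h \<bullet> h\<close>.\<close>
    define t where "t = (h \<bullet> h) / (b h + 1)"
    have bh: "b h \<ge> 0" by (rule b0[OF hH])
    then have t: "t > 0" using hh by (simp add: t_def)
    have "t * b h < 2 * (h \<bullet> h)"
    proof -
      have "t * b h \<le> t * (b h + 1)" using t by simp
      also have "\<dots> = h \<bullet> h" using bh by (simp add: t_def)
      finally show ?thesis using hh by linarith
    qed
    then have "b (w - t *\<^sub>R h) < 0"
      using t mult_strict_left_mono[of "t * b h" "2 * (h \<bullet> h)" t] by (simp add: exp power2_eq_square mult_ac)
    moreover have "b (w - t *\<^sub>R h) \<ge> 0" by (intro b0 Hadd Hscale wH hH)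
    ultimately show False by simp
  qed
  then have "T w = \<nu> *\<^sub>R w" by (simp add: B_def)
  then show ?thesis using wn wH nu by (auto simp: H_def)
qed

text \<open>Distinct eigenvalues are counted, so infinite multiplicity of a single one has to be
  excluded. A finite set of negative eigenvalues stays away from 0, while a large orthonormal system
  of eigenvectors always has a combination in the subspace where the form is almost
  nonnegative.\<close>

theorem infinite_negative_eigenvalues:
  fixes T :: "'a::{real_inner,complete_space} \<Rightarrow> 'a"
  assumes T: "bounded_linear T" and sym: "\<And>x y. T x \<bullet> y = x \<bullet> T y"
    and ess: "\<And>d. d > 0 \<Longrightarrow> \<exists>F. finite F \<and> pairwise orthogonal F \<and>
                 (\<forall>u. (\<forall>f\<in>F. u \<bullet> f = 0) \<longrightarrow> T u \<bullet> u \<ge> - d * (u \<bullet> u))"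
    and neg: "\<And>E. finite E \<Longrightarrow> \<exists>u. (\<forall>e\<in>E. u \<bullet> e = 0) \<and> T u \<bullet> u < 0"
  shows "infinite {k. k < 0 \<and> (\<exists>u. u \<noteq> 0 \<and> T u = k *\<^sub>R u)}" (is "infinite ?L")
proof
  assume "finite ?L"
  moreover define L where "L = ?L"
  ultimately have fin: "finite L" by simp
  interpret T: bounded_linear T by fact
  have ex: "\<exists>E. finite E \<and> card E = n \<and> pairwise orthogonal E \<and>
          (\<forall>e\<in>E. norm e = 1 \<and> (\<exists>k\<in>L. T e = k *\<^sub>R e))" for n
  proof (induction n)
    case 0
    show ?case by (intro exI[of _ "{}"]) auto
  next
    case (Suc n)
    then obtain E where E0: "finite E \<and> card E = n \<and> pairwise orthogonal E \<and>
          (\<forall>e\<in>E. norm e = 1 \<and> (\<exists>k\<in>L. T e = k *\<^sub>R e))" ..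
    note E = E0[THEN conjunct1] E0[THEN conjunct2, THEN conjunct1]
      E0[THEN conjunct2, THEN conjunct2, THEN conjunct1]
      bspec[OF E0[THEN conjunct2, THEN conjunct2, THEN conjunct2], THEN conjunct1]
      bspec[OF E0[THEN conjunct2, THEN conjunct2, THEN conjunct2], THEN conjunct2]
    have "\<exists>u k. norm u = 1 \<and> (\<forall>e\<in>E. u \<bullet> e = 0) \<and> k < 0 \<and> T u = k *\<^sub>R u"
      by (rule negative_eigenvector_orthogonal[OF T sym ess E(1) _ neg[OF E(1)]]) (use E(5) in auto)
    then obtain u k where u: "norm u = 1" "\<And>e. e \<in> E \<Longrightarrow> u \<bullet> e = 0" "k < 0" "T u = k *\<^sub>R u" by blast
    have "u \<notin> E" using u(1) u(2)[of u] by auto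
    moreover have "k \<in> L" unfolding L_def using u by (auto intro!: exI[of _ u])
    moreover have "pairwise orthogonal (insert u E)"
      using E(3) u(2) by (auto simp: pairwise_insert orthogonal_def inner_commute)
    ultimately show ?case using E u by (intro exI[of _ "insert u E"]) auto
  qed
  have ne: "L \<noteq> {}"
  proof
    assume "L = {}"
    then show False using ex[of 1] by (auto simp: card_1_singleton_iff)
  qed
  \<comment> \<open>Half the distance of the eigenvalues from 0: on the span of the eigenvectors the
    form is at most \<open>- 2 * d\<close>, orthogonally to \<open>F\<close> at least
    \<open>- d\<close> times the squared norm.\<close>
  define d where "d = - Max L / 2"
  have "Max L \<in> L" by (rule Max_in[OF fin ne])
  then have d: "d > 0" by (auto simp: d_def L_def)
  have dL: "k \<le> - 2 * d" if "k \<in> L" for k using Max_ge[OF fin that] by (simp add: d_def)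
  obtain F where F: "finite F" "\<And>u. (\<forall>f\<in>F. u \<bullet> f = 0) \<Longrightarrow> T u \<bullet> u \<ge> - d * (u \<bullet> u)"
    using ess[OF d] by blast
  from ex[of "Suc (card F)"] obtain E where E0: "finite E \<and> card E = Suc (card F) \<and> pairwise orthogonal E \<and>
          (\<forall>e\<in>E. norm e = 1 \<and> (\<exists>k\<in>L. T e = k *\<^sub>R e))" ..
  note E = E0[THEN conjunct1] E0[THEN conjunct2, THEN conjunct1]
      E0[THEN conjunct2, THEN conjunct2, THEN conjunct1]
      bspec[OF E0[THEN conjunct2, THEN conjunct2, THEN conjunct2], THEN conjunct1]
      bspec[OF E0[THEN conjunct2, THEN conjunct2, THEN conjunct2], THEN conjunct2]
  \<comment> \<open>One eigenvector more than there are vectors in \<open>F\<close>, so some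
    nontrivial combination is orthogonal to all of \<open>F\<close>.\<close>
  obtain z where z: "\<exists>e\<in>E. z e \<noteq> 0" "\<And>f. f \<in> F \<Longrightarrow> (\<Sum>e\<in>E. z e * (e \<bullet> f)) = 0"
    using homogeneous_system[OF F(1) E(1), of "\<lambda>e f. e \<bullet> f"] E(2) by auto
  have "\<forall>e\<in>E. \<exists>k. k \<in> L \<and> T e = k *\<^sub>R e" using E(5) by blast
  from bchoice[OF this] obtain k where k: "\<And>e. e \<in> E \<Longrightarrow> k e \<in> L \<and> T e = k e *\<^sub>R e" by blast
  define u where "u = (\<Sum>e\<in>E. z e *\<^sub>R e)"
  have lower: "T u \<bullet> u \<ge> - d * (u \<bullet> u)" by (rule F(2)) (simp add: u_def inner_sum_left z)
  have ue: "u \<bullet> e = z e" if "e \<in> E" for e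
    using sum_orthogonal_inner[OF E(1,3) that, of z] E(4)[OF that] by (simp add: u_def norm_eq_1)
  have uu: "u \<bullet> u = (\<Sum>e\<in>E. (z e)\<^sup>2)"
  proof -
    have "u \<bullet> u = (\<Sum>e\<in>E. z e * (u \<bullet> e))" by (subst (2) u_def) (simp add: inner_sum_right)
    then show ?thesis by (simp add: ue power2_eq_square)
  qed
  have "T u = (\<Sum>e\<in>E. (z e * k e) *\<^sub>R e)"
    unfolding u_def T.sum by (rule sum.cong) (use k in \<open>auto simp: T.scaleR\<close>)
  then have "T u \<bullet> u = (\<Sum>e\<in>E. z e * k e * (u \<bullet> e))"
    by (simp only: inner_commute[of _ u] inner_sum_right inner_scaleR_right)
  also have "\<dots> = (\<Sum>e\<in>E. k e * (z e)\<^sup>2)"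
    by (rule sum.cong) (auto simp: ue power2_eq_square)
  also have "\<dots> \<le> (\<Sum>e\<in>E. (- 2 * d) * (z e)\<^sup>2)"
    by (intro sum_mono mult_right_mono dL) (use k in auto)
  also have "\<dots> = - 2 * d * (u \<bullet> u)" by (simp add: uu sum_distrib_left)
  finally have upper: "T u \<bullet> u \<le> - 2 * d * (u \<bullet> u)" .
  have "d * (u \<bullet> u) > 0"
  proof -
    obtain e where "e \<in> E" "z e \<noteq> 0" using z(1) by blast
    then have "u \<noteq> 0" using ue[of e] by auto
    then show ?thesis using d by simp
  qed
  with lower upper show False by linarith
qed

section \<open>The Hilbert space of square integrable functions\<close>

text \<open>Borel measurability, in contrast to the Lebesgue measurability of \<open>L2\<close>,
  allows kernels on a product of Borel spaces to be integrated in either order. The passage between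
  \<open>lborel\<close> and \<open>lebesgue\<close> is made at the end.\<close>

definition sq_int :: "('a::euclidean_space \<Rightarrow> complex) \<Rightarrow> bool" where
  "sq_int f \<longleftrightarrow> f \<in> borel_measurable borel \<and> integrable lborel (\<lambda>x. (norm (f x))\<^sup>2)"

lemma sq_int_measurable [measurable_dest]: "sq_int f \<Longrightarrow> f \<in> borel_measurable borel"
  by (simp add: sq_int_def)

lemma sq_int_norm: "sq_int f \<Longrightarrow> integrable lborel (\<lambda>x. (norm (f x))\<^sup>2)"
  by (simp add: sq_int_def)

lemma sq_int_bound:
  assumes [measurable]: "f \<in> borel_measurable borel" and "integrable lborel g"
    and "\<And>x. (norm (f x))\<^sup>2 \<le> g x"
  shows "sq_int f"
  unfolding sq_int_def
  by (auto intro!: Bochner_Integration.integrable_bound[OF assms(2)] always_eventually order_trans[OF assms(3)])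

lemma sq_int_0: "sq_int (\<lambda>x. 0)" by (simp add: sq_int_def)

lemma sq_int_add:
  assumes f: "sq_int f" and g: "sq_int g"
  shows "sq_int (\<lambda>x. f x + g x)"
proof (rule sq_int_bound)
  show "(\<lambda>x. f x + g x) \<in> borel_measurable borel" using f g by measurable
  show "integrable lborel (\<lambda>x. 2 * (norm (f x))\<^sup>2 + 2 * (norm (g x))\<^sup>2)"
    using f g by (auto simp: sq_int_def)
  fix x
  have "(norm (f x + g x))\<^sup>2 \<le> (norm (f x) + norm (g x))\<^sup>2" by (intro power_mono norm_triangle_ineq) auto
  also have "\<dots> \<le> 2 * (norm (f x))\<^sup>2 + 2 * (norm (g x))\<^sup>2"
    using sum_squares_bound[of "norm (f x)" "norm (g x)"] by (simp add: power2_sum)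
  finally show "(norm (f x + g x))\<^sup>2 \<le> 2 * (norm (f x))\<^sup>2 + 2 * (norm (g x))\<^sup>2" .
qed

lemma sq_int_mult_bounded:
  assumes f: "sq_int f" and [measurable]: "h \<in> borel_measurable borel" and h: "\<And>x. norm (h x) \<le> C"
  shows "sq_int (\<lambda>x. h x * f x)"
proof (rule sq_int_bound)
  show "(\<lambda>x. h x * f x) \<in> borel_measurable borel" using f by measurable
  show "integrable lborel (\<lambda>x. C\<^sup>2 * (norm (f x))\<^sup>2)" using f by (auto simp: sq_int_def)
  show "(norm (h x * f x))\<^sup>2 \<le> C\<^sup>2 * (norm (f x))\<^sup>2" for x
    unfolding norm_mult power_mult_distrib by (intro mult_right_mono power_mono h) auto
qed

lemma sq_int_scaleR: "sq_int f \<Longrightarrow> sq_int (\<lambda>x. c *\<^sub>R f x)"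
  using sq_int_mult_bounded[of f "\<lambda>_. of_real c" "\<bar>c\<bar>"] by (simp add: scaleR_conv_of_real)

lemma sq_int_diff: "sq_int f \<Longrightarrow> sq_int g \<Longrightarrow> sq_int (\<lambda>x. f x - g x)"
  using sq_int_add[of f "\<lambda>x. (-1) *\<^sub>R g x"] sq_int_scaleR[of g "-1"] by simp

lemma sq_int_mult:
  assumes f: "sq_int f" and g: "sq_int g"
  shows "integrable lborel (\<lambda>x. norm (f x) * norm (g x))"
proof (rule Bochner_Integration.integrable_bound)
  show "integrable lborel (\<lambda>x. (norm (f x))\<^sup>2 + (norm (g x))\<^sup>2)" using f g by (auto simp: sq_int_def)
  show "(\<lambda>x. norm (f x) * norm (g x)) \<in> borel_measurable lborel" using f g by measurable
  have "norm (f x) * norm (g x) \<le> (norm (f x))\<^sup>2 + (norm (g x))\<^sup>2" for x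
    using sum_squares_bound[of "norm (f x)" "norm (g x)"] mult_nonneg_nonneg[OF norm_ge_zero[of "f x"] norm_ge_zero[of "g x"]]
    by linarith
  then show "AE x in lborel. norm (norm (f x) * norm (g x)) \<le> norm ((norm (f x))\<^sup>2 + (norm (g x))\<^sup>2)"
    by (auto intro!: always_eventually)
qed

lemma sq_int_inner:
  assumes f: "sq_int f" and g: "sq_int g"
  shows "integrable lborel (\<lambda>x. f x \<bullet> g x)"
  by (rule Bochner_Integration.integrable_bound[OF sq_int_mult[OF f g]])
     (use f g in \<open>auto intro!: always_eventually Cauchy_Schwarz_ineq2\<close>)

definition l2_rel :: "('a::euclidean_space \<Rightarrow> complex) \<Rightarrow> ('a \<Rightarrow> complex) \<Rightarrow> bool" where
  "l2_rel f g \<longleftrightarrow> sq_int f \<and> sq_int g \<and> (AE x in lborel. f x = g x)"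

\<comment> \<open>The quotient is partial because \<open>l2_rel\<close> is reflexive exactly at the
  square integrable functions.\<close>
quotient_type (overloaded) 'a l2 = "'a::euclidean_space \<Rightarrow> complex" / partial: l2_rel
proof (rule part_equivpI)
  show "\<exists>f::'a \<Rightarrow> complex. l2_rel f f" using sq_int_0 by (auto simp: l2_rel_def)
  show "symp l2_rel" by (auto simp: symp_def l2_rel_def elim: eventually_mono)
  show "transp l2_rel" by (auto simp: transp_def l2_rel_def)
qed

lemma sq_int_rep [simp]: "sq_int (rep_l2 u)"
  using Quotient3_rel_rep[OF Quotient3_l2, of u u] by (auto simp: l2_rel_def)

lemma rep_measurable [measurable]: "rep_l2 u \<in> borel_measurable borel"
  by (rule sq_int_measurable[OF sq_int_rep])

lemma abs_rep_l2: "abs_l2 (rep_l2 u) = u"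
  using Quotient3_abs_rep[OF Quotient3_l2] .

lemma rep_abs_l2: "sq_int f \<Longrightarrow> AE x in lborel. rep_l2 (abs_l2 f) x = f x"
  using rep_abs_rsp_left[OF Quotient3_l2, of f f] by (auto simp: l2_rel_def)

lemma l2_eqI: "(AE x in lborel. rep_l2 u x = rep_l2 v x) \<Longrightarrow> u = v"
  using Quotient3_rel_rep[OF Quotient3_l2, of u v] by (auto simp: l2_rel_def)

instantiation l2 :: (euclidean_space) real_vector
begin

definition "0 = abs_l2 (\<lambda>x. 0)"
definition "u + v = abs_l2 (\<lambda>x. rep_l2 u x + rep_l2 v x)"
definition "u - v = abs_l2 (\<lambda>x. rep_l2 u x - rep_l2 v x)"
definition "- u = abs_l2 (\<lambda>x. - rep_l2 u x)"
definition "c *\<^sub>R u = abs_l2 (\<lambda>x. c *\<^sub>R rep_l2 u x)"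
lemma rep_zero_l2: "AE x in lborel. rep_l2 0 x = 0"
  unfolding zero_l2_def by (intro rep_abs_l2 sq_int_0)
lemma rep_plus_l2: "AE x in lborel. rep_l2 (u + v) x = rep_l2 u x + rep_l2 v x"
  unfolding plus_l2_def by (intro rep_abs_l2 sq_int_add) simp_all
lemma rep_minus_l2: "AE x in lborel. rep_l2 (u - v) x = rep_l2 u x - rep_l2 v x"
  unfolding minus_l2_def by (intro rep_abs_l2 sq_int_diff) simp_all
lemma rep_uminus_l2: "AE x in lborel. rep_l2 (- u) x = - rep_l2 u x"
  unfolding uminus_l2_def using rep_abs_l2[OF sq_int_scaleR[of "rep_l2 u" "-1"]] by simp
lemma rep_scaleR_l2: "AE x in lborel. rep_l2 (c *\<^sub>R u) x = c *\<^sub>R rep_l2 u x"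
  unfolding scaleR_l2_def by (intro rep_abs_l2 sq_int_scaleR) simp_all

instance
proof
  fix u v w :: "'a l2" and b c :: real
  show "u + v + w = u + (v + w)"
    by (rule l2_eqI, use rep_plus_l2[of "u+v" w] rep_plus_l2[of u v] rep_plus_l2[of u "v+w"] rep_plus_l2[of v w] in eventually_elim) (simp)
  show "u + v = v + u"
    by (rule l2_eqI, use rep_plus_l2[of u v] rep_plus_l2[of v u] in eventually_elim) (simp)
  show "0 + u = u"
    by (rule l2_eqI, use rep_plus_l2[of 0 u] rep_zero_l2 in eventually_elim) (simp)
  show "- u + u = 0"
    by (rule l2_eqI, use rep_plus_l2[of "-u" u] rep_uminus_l2[of u] rep_zero_l2 in eventually_elim) (simp)
  show "u - v = u + - v"
    by (rule l2_eqI, use rep_plus_l2[of u "-v"] rep_uminus_l2[of v] rep_minus_l2[of u v] in eventually_elim) (simp)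
  show "b *\<^sub>R (u + v) = b *\<^sub>R u + b *\<^sub>R v"
    by (rule l2_eqI, use rep_scaleR_l2[of b "u+v"] rep_plus_l2[of u v] rep_plus_l2[of "b *\<^sub>R u" "b *\<^sub>R v"]
      rep_scaleR_l2[of b u] rep_scaleR_l2[of b v] in eventually_elim) (simp add: scaleR_add_right)
  show "(b + c) *\<^sub>R u = b *\<^sub>R u + c *\<^sub>R u"
    by (rule l2_eqI, use rep_scaleR_l2[of "b+c" u] rep_plus_l2[of "b *\<^sub>R u" "c *\<^sub>R u"]
      rep_scaleR_l2[of b u] rep_scaleR_l2[of c u] in eventually_elim) (simp add: scaleR_add_left)
  show "b *\<^sub>R c *\<^sub>R u = (b * c) *\<^sub>R u"
    by (rule l2_eqI, use rep_scaleR_l2[of b "c *\<^sub>R u"] rep_scaleR_l2[of c u] rep_scaleR_l2[of "b*c" u] in eventually_elim) (simp)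
  show "1 *\<^sub>R u = u"
    by (rule l2_eqI, use rep_scaleR_l2[of 1 u] in eventually_elim) (simp)
qed

end

instantiation l2 :: (euclidean_space) real_inner
begin

text \<open>On complex numbers \<open>\<bullet>\<close> is the real part of z times the conjugate of
  w, so this is the real part of the usual inner product of L2. For a real eigenvalue the
  eigenvector equation is the same in both structures.\<close>

definition "inner u v = (\<integral>x. rep_l2 u x \<bullet> rep_l2 v x \<partial>lborel)"
definition "norm (u::'a l2) = sqrt (inner u u)"
definition "dist (u::'a l2) v = norm (u - v)"
definition "sgn (u::'a l2) = u /\<^sub>R norm u"
definition "(uniformity :: ('a l2 \<times> 'a l2) filter) = (INF e\<in>{0 <..}. principal {(x, y). dist x y < e})"
definition "open (S::'a l2 set) \<longleftrightarrow> (\<forall>x\<in>S. \<forall>\<^sub>F (x', y) in uniformity. x' = x \<longrightarrow> y \<in> S)"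

instance
proof
  fix u v w :: "'a l2" and b c :: real
  show "dist u v = norm (u - v)" by (rule dist_l2_def)
  show "sgn u = u /\<^sub>R norm u" by (rule sgn_l2_def)
  show "uniformity = (INF e\<in>{0 <..}. principal {(x::'a l2, y). dist x y < e})"
    by (rule uniformity_l2_def)
  show "open S \<longleftrightarrow> (\<forall>x\<in>S. \<forall>\<^sub>F (x', y) in uniformity. x' = x \<longrightarrow> y \<in> S)" for S :: "'a l2 set"
    by (rule open_l2_def)
  show "u \<bullet> v = v \<bullet> u" by (simp add: inner_l2_def inner_commute)
  show "(u + v) \<bullet> w = u \<bullet> w + v \<bullet> w"
  proof -
    have "(u + v) \<bullet> w = (\<integral>x. rep_l2 u x \<bullet> rep_l2 w x + rep_l2 v x \<bullet> rep_l2 w x \<partial>lborel)"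
      unfolding inner_l2_def
      by (rule integral_cong_AE) (use rep_plus_l2[of u v] in \<open>auto simp: inner_add_left elim!: eventually_mono\<close>)
    then show ?thesis
      by (simp add: inner_l2_def Bochner_Integration.integral_add sq_int_inner)
  qed
  show "(b *\<^sub>R u) \<bullet> v = b * (u \<bullet> v)"
  proof -
    have "(b *\<^sub>R u) \<bullet> v = (\<integral>x. b * (rep_l2 u x \<bullet> rep_l2 v x) \<partial>lborel)"
      unfolding inner_l2_def
      by (rule integral_cong_AE) (use rep_scaleR_l2[of b u] in \<open>auto elim!: eventually_mono\<close>)
    then show ?thesis by (simp add: inner_l2_def)
  qed
  show "0 \<le> u \<bullet> u" by (simp add: inner_l2_def)
  show "(u \<bullet> u = 0) = (u = 0)"
  proof
    assume "u \<bullet> u = 0"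
    then have "AE x in lborel. rep_l2 u x \<bullet> rep_l2 u x = 0"
      unfolding inner_l2_def by (subst (asm) integral_nonneg_eq_0_iff_AE) (auto intro: sq_int_inner)
    with rep_zero_l2 have "AE x in lborel. rep_l2 u x = rep_l2 0 x" by eventually_elim simp
    then show "u = 0" by (rule l2_eqI)
  next
    assume "u = 0"
    have "(0::'a l2) \<bullet> 0 = integral\<^sup>L lborel (\<lambda>x::'a. 0::real)"
      unfolding inner_l2_def by (rule integral_cong_AE) (use rep_zero_l2 in \<open>auto elim!: eventually_mono\<close>)
    then show "u \<bullet> u = 0" using \<open>u = 0\<close> by simp
  qed
  show "norm u = sqrt (u \<bullet> u)" by (rule norm_l2_def)
qed

end

lemma norm2_l2: "(norm u)\<^sup>2 = (\<integral>x. (norm (rep_l2 u x))\<^sup>2 \<partial>lborel)"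
  by (simp add: power2_norm_eq_inner inner_l2_def)

lemma nn_norm2_l2: "(\<integral>\<^sup>+x. ennreal ((norm (rep_l2 u x))\<^sup>2) \<partial>lborel) = ennreal ((norm u)\<^sup>2)"
  unfolding norm2_l2 by (rule nn_integral_eq_integral) (auto intro: sq_int_norm)

text \<open>Weighting the increments by \<open>2 ^ n\<close> and Cauchy-Schwarz for series replace Minkowski's inequality
  in the almost everywhere convergence of a rapidly Cauchy sequence.\<close>

instance l2 :: (euclidean_space) complete_space
proof
  fix X :: "nat \<Rightarrow> 'a l2" assume X: "Cauchy X"
  have "\<exists>N. \<forall>m\<ge>N. \<forall>n\<ge>N. norm (X m - X n) < (1/2)^k" for k
    using CauchyD[OF X, of "(1/2)^k"] by auto
  then obtain N where N: "\<And>k m n. m \<ge> N k \<Longrightarrow> n \<ge> N k \<Longrightarrow> norm (X m - X n) < (1/2)^k" by metis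
  define r where "r = rec_nat (N 0) (\<lambda>k p. max (Suc p) (N (Suc k)))"
  have r: "strict_mono r"
    by (rule strict_monoI_Suc) (simp add: r_def)
  have rN: "r k \<ge> N k" for k by (cases k) (auto simp: r_def)
  have fast: "norm (X (r (Suc k)) - X (r k)) < (1/2)^k" for k
    using strict_monoD[OF r, of k "Suc k"] rN[of k] by (intro N) auto
  define f where "f k = rep_l2 (X (r k))" for k
  have [measurable]: "f k \<in> borel_measurable borel" for k by (simp add: f_def)
  have nd: "(\<integral>\<^sup>+x. ennreal ((norm (f m x - f n x))\<^sup>2) \<partial>lborel) = ennreal ((norm (X (r m) - X (r n)))\<^sup>2)" for m n
  proof -
    have "(\<integral>\<^sup>+x. ennreal ((norm (f m x - f n x))\<^sup>2) \<partial>lborel) = (\<integral>\<^sup>+x. ennreal ((norm (rep_l2 (X (r m) - X (r n)) x))\<^sup>2) \<partial>lborel)"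
      by (rule nn_integral_cong_AE)
         (use rep_minus_l2[of "X (r m)" "X (r n)"] in \<open>auto simp: f_def elim!: eventually_mono\<close>)
    then show ?thesis by (simp add: nn_norm2_l2)
  qed
  have "(\<integral>\<^sup>+x. (\<Sum>k. ennreal (2^k * (norm (f (Suc k) x - f k x))\<^sup>2)) \<partial>lborel)
      = (\<Sum>k. (\<integral>\<^sup>+x. ennreal (2^k * (norm (f (Suc k) x - f k x))\<^sup>2) \<partial>lborel))"
    by (rule nn_integral_suminf) measurable
  also have "\<dots> = (\<Sum>k. ennreal (2^k * (norm (X (r (Suc k)) - X (r k)))\<^sup>2))"
    by (subst ennreal_mult) (auto simp: nn_integral_cmult nd ennreal_mult)
  also have "\<dots> \<le> (\<Sum>k. ennreal ((1/2)^k))"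
  proof (intro suminf_le allI ennreal_leI)
    fix k
    have "(norm (X (r (Suc k)) - X (r k)))\<^sup>2 \<le> ((1/2)^k)\<^sup>2"
      using fast[of k] by (intro power_mono) auto
    then have "2^k * (norm (X (r (Suc k)) - X (r k)))\<^sup>2 \<le> 2^k * ((1/2)^k)\<^sup>2" by simp
    also have "\<dots> = (2 * (1/2) * (1/2)) ^ k" by (simp only: power_mult_distrib power2_eq_square mult_ac)
    finally show "2^k * (norm (X (r (Suc k)) - X (r k)))\<^sup>2 \<le> (1/2)^k" by simp
  qed auto
  also have "\<dots> = ennreal (\<Sum>k. (1/2)^k)" by (intro suminf_ennreal2) auto
  finally have fin: "(\<integral>\<^sup>+x. (\<Sum>k. ennreal (2^k * (norm (f (Suc k) x - f k x))\<^sup>2)) \<partial>lborel) < \<infinity>"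
    by (simp add: le_less_trans)
  have "AE x in lborel. (\<Sum>k. ennreal (2^k * (norm (f (Suc k) x - f k x))\<^sup>2)) \<noteq> \<infinity>"
    by (rule nn_integral_noteq_infinite) (use fin in auto)
  then have conv: "AE x in lborel. convergent (\<lambda>k. f k x)"
  proof eventually_elim
    fix x assume fx: "(\<Sum>k. ennreal (2^k * (norm (f (Suc k) x - f k x))\<^sup>2)) \<noteq> \<infinity>"
    have s: "summable (\<lambda>k. 2^k * (norm (f (Suc k) x - f k x))\<^sup>2)"
      by (rule summable_suminf_not_top) (use fx in auto)
    have "summable (\<lambda>k. norm (f (Suc k) x - f k x))"
    proof (rule summable_comparison_test')
      show "summable (\<lambda>k. (1/2)^k + 2^k * (norm (f (Suc k) x - f k x))\<^sup>2)"
        by (intro summable_add s) auto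
      fix k
      let ?d = "norm (f (Suc k) x - f k x)"
      have p: "(2::real) ^ k > 0" by simp
      \<comment> \<open>With \<open>t = 2 ^ k * ?d\<close>, the inequality
        \<open>t \<le> 1 + t^2\<close> bounds the increment by a geometric term plus the weighted
        square, both of which are summable at this point.\<close>
      have "0 \<le> (1 - 2 ^ k * ?d)\<^sup>2" by simp
      moreover have "0 \<le> 2 ^ k * ?d" by simp
      moreover have "t \<le> 1 + t\<^sup>2" if "0 \<le> (1 - t)\<^sup>2" "0 \<le> t" for t :: real
        using that by (simp add: power2_diff)
      ultimately have "2 ^ k * ?d \<le> 1 + (2 ^ k * ?d)\<^sup>2" by blast
      then have "2 ^ k * ?d \<le> 2 ^ k * ((1/2)^k + 2^k * ?d\<^sup>2)"
        by (simp add: algebra_simps power_mult_distrib power2_eq_square power_one_over)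
      then show "norm ?d \<le> (1/2)^k + 2^k * ?d\<^sup>2" using p by simp
    qed
    then have "summable (\<lambda>k. f (Suc k) x - f k x)" by (rule summable_norm_cancel)
    then have "convergent (\<lambda>n. \<Sum>k<n. f (Suc k) x - f k x)" by (simp add: summable_iff_convergent)
    then have "convergent (\<lambda>n. f n x - f 0 x)" using sum_lessThan_telescope[of "\<lambda>k. f k x"] by simp
    then have "convergent (\<lambda>n. (f n x - f 0 x) + f 0 x)" by (intro convergent_add) (auto simp: convergent_const)
    then show "convergent (\<lambda>k. f k x)" by simp
  qed
  define g where "g x = lim (\<lambda>k. f k x)" for x
  have [measurable]: "g \<in> borel_measurable borel"
  proof -
    have "(\<lambda>x. lim (\<lambda>k. f k x)) \<in> borel_measurable borel" by (rule borel_measurable_lim_metric) measurable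
    then show ?thesis by (simp add: g_def[abs_def])
  qed
  have flim: "AE x in lborel. (\<lambda>k. f k x) \<longlonglongrightarrow> g x"
    using conv by eventually_elim (simp add: g_def convergent_LIMSEQ_iff)
  \<comment> \<open>For fixed \<open>k\<close>, Fatou's lemma in \<open>m\<close> carries the bound
    on \<open>f m - f k\<close> over to the almost everywhere limit \<open>g\<close>. It yields both
    that \<open>g\<close> is square integrable and that the subsequence converges to it.\<close>
  have fatou: "(\<integral>\<^sup>+x. ennreal ((norm (g x - f k x))\<^sup>2) \<partial>lborel) \<le> ennreal (((1/2)^k)\<^sup>2)" for k
  proof -
    have "(\<integral>\<^sup>+x. ennreal ((norm (g x - f k x))\<^sup>2) \<partial>lborel)
        = (\<integral>\<^sup>+x. liminf (\<lambda>m. ennreal ((norm (f m x - f k x))\<^sup>2)) \<partial>lborel)"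
    proof (rule nn_integral_cong_AE, use flim in eventually_elim)
      fix x assume "(\<lambda>k. f k x) \<longlonglongrightarrow> g x"
      then have "(\<lambda>m. ennreal ((norm (f m x - f k x))\<^sup>2)) \<longlonglongrightarrow> ennreal ((norm (g x - f k x))\<^sup>2)"
        by (intro tendsto_intros)
      then show "ennreal ((norm (g x - f k x))\<^sup>2) = liminf (\<lambda>m. ennreal ((norm (f m x - f k x))\<^sup>2))"
        using lim_imp_Liminf[OF trivial_limit_sequentially] by metis
    qed
    also have "\<dots> \<le> liminf (\<lambda>m. \<integral>\<^sup>+x. ennreal ((norm (f m x - f k x))\<^sup>2) \<partial>lborel)"
      by (rule nn_integral_liminf) measurable
    also have "\<dots> \<le> ennreal (((1/2)^k)\<^sup>2)"
    proof (rule Liminf_le)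
      show "\<forall>\<^sub>F m in sequentially. (\<integral>\<^sup>+x. ennreal ((norm (f m x - f k x))\<^sup>2) \<partial>lborel) \<le> ennreal (((1/2)^k)\<^sup>2)"
        unfolding nd eventually_sequentially
      proof (intro exI[of _ k] allI impI ennreal_leI power_mono)
        fix m assume "k \<le> m"
        then have "r k \<le> r m" using r by (simp add: strict_mono_less_eq)
        then show "norm (X (r m) - X (r k)) \<le> (1/2)^k" using rN[of k] N[of k "r m" "r k"] by auto
      qed auto
    qed simp
    finally show ?thesis .
  qed
  have gf: "sq_int (\<lambda>x. g x - f k x)" for k
    unfolding sq_int_def
    by (auto simp: integrable_iff_bounded intro: le_less_trans[OF fatou])
  have g: "sq_int g" using sq_int_add[OF gf[of 0], of "f 0"] by (simp add: f_def)
  define Y where "Y = abs_l2 g"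
  have Yk: "norm (Y - X (r k)) \<le> (1/2)^k" for k
  proof -
    have "ennreal ((norm (Y - X (r k)))\<^sup>2) = (\<integral>\<^sup>+x. ennreal ((norm (g x - f k x))\<^sup>2) \<partial>lborel)"
      unfolding nn_norm2_l2[symmetric]
    proof (rule nn_integral_cong_AE)
      show "AE x in lborel. ennreal ((norm (rep_l2 (Y - X (r k)) x))\<^sup>2) = ennreal ((norm (g x - f k x))\<^sup>2)"
        using rep_minus_l2[of Y "X (r k)"] rep_abs_l2[OF g]
        by eventually_elim (simp add: Y_def f_def)
    qed
    with fatou[of k] have "ennreal ((norm (Y - X (r k)))\<^sup>2) \<le> ennreal (((1/2)^k)\<^sup>2)" by simp
    then have "(norm (Y - X (r k)))\<^sup>2 \<le> ((1/2)^k)\<^sup>2" by (subst (asm) ennreal_le_iff) auto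
    then show ?thesis by (rule power2_le_imp_le) simp
  qed
  have "(\<lambda>k. X (r k)) \<longlonglongrightarrow> Y"
  proof (rule LIM_zero_cancel, rule Lim_null_comparison)
    show "\<forall>\<^sub>F k in sequentially. norm (X (r k) - Y) \<le> (1/2)^k"
      using Yk by (auto simp: norm_minus_commute)
    show "(\<lambda>k. (1/2::real)^k) \<longlonglongrightarrow> 0" by (rule LIMSEQ_realpow_zero) auto
  qed
  then have "X \<longlonglongrightarrow> Y" using Cauchy_converges_subseq[OF X r, of Y] by (simp add: o_def)
  then show "convergent X" by (auto simp: convergent_def)
qed

section \<open>Integral and multiplication operators\<close>

text \<open>As \<open>c\<close> is 1 or -1, a single affine change of variables serves translations
  and reflections alike.\<close>

lemma lborel_distr_reflect:
  fixes t :: "'a::euclidean_space"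
  assumes "\<bar>c\<bar> = 1"
  shows "distr lborel borel (\<lambda>x. t + c *\<^sub>R x) = lborel"
proof -
  have "c \<noteq> 0" using assms by auto
  from lborel_affine[OF this, of t] assms show ?thesis by (simp add: density_1 one_ennreal_def[symmetric])
qed

lemma
  fixes t :: "'a::euclidean_space"
  assumes [measurable]: "f \<in> borel_measurable borel"
  shows nn_integral_shift: "(\<integral>\<^sup>+x. f (x + t) \<partial>lborel) = (\<integral>\<^sup>+x. f x \<partial>lborel)"
    and nn_integral_reflect: "(\<integral>\<^sup>+x. f (t - x) \<partial>lborel) = (\<integral>\<^sup>+x. f x \<partial>lborel)"
  using nn_integral_distr[of "\<lambda>x. t + 1 *\<^sub>R x" lborel borel f]
    nn_integral_distr[of "\<lambda>x. t + (-1) *\<^sub>R x" lborel borel f]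
  by (simp_all only: lborel_distr_reflect) (simp_all add: add.commute)

lemma
  fixes t :: "'a::euclidean_space" and f :: "'a \<Rightarrow> 'b::{banach, second_countable_topology}"
  assumes [measurable]: "f \<in> borel_measurable borel"
  shows integral_shift: "(\<integral>x. f (x + t) \<partial>lborel) = (\<integral>x. f x \<partial>lborel)"
    and integral_reflect: "(\<integral>x. f (t - x) \<partial>lborel) = (\<integral>x. f x \<partial>lborel)"
    and integrable_shift: "integrable lborel (\<lambda>x. f (x + t)) \<longleftrightarrow> integrable lborel f"
    and integrable_reflect: "integrable lborel (\<lambda>x. f (t - x)) \<longleftrightarrow> integrable lborel f"
  using integral_distr[of "\<lambda>x. t + 1 *\<^sub>R x" lborel borel f]
    integral_distr[of "\<lambda>x. t + (-1) *\<^sub>R x" lborel borel f]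
    integrable_distr_eq[of "\<lambda>x. t + 1 *\<^sub>R x" lborel borel f]
    integrable_distr_eq[of "\<lambda>x. t + (-1) *\<^sub>R x" lborel borel f]
  by (simp_all only: lborel_distr_reflect) (simp_all add: add.commute)

lemma AE_reflect:
  fixes t :: "'a::euclidean_space"
  assumes "AE x in lborel. P x" "\<bar>c\<bar> = 1"
  shows "AE x in lborel. P (t + c *\<^sub>R x)"
proof -
  have "AE x in distr lborel borel (\<lambda>x. t + c *\<^sub>R x). P x"
    using assms(1) by (subst lborel_distr_reflect[OF assms(2)])
  then show ?thesis by (rule AE_distrD[rotated]) simp
qed

text \<open>The data of Schur's test: a bound \<open>C\<close> on the rows and a bound
  \<open>D\<close> on the columns, giving operator norm at most \<open>sqrt (C * D)\<close>. The
  bounds are kept apart because later a kernel has small columns but only bounded rows.\<close>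

definition schur_kernel :: "('a::euclidean_space \<Rightarrow> 'a \<Rightarrow> complex) \<Rightarrow> real \<Rightarrow> real \<Rightarrow> bool" where
  "schur_kernel k C D \<longleftrightarrow> (\<lambda>(x, y). k x y) \<in> borel_measurable (borel \<Otimes>\<^sub>M borel) \<and> 0 \<le> C \<and> 0 \<le> D \<and>
     (\<forall>x. (\<integral>\<^sup>+y. ennreal (norm (k x y)) \<partial>lborel) \<le> ennreal C) \<and>
     (\<forall>y. (\<integral>\<^sup>+x. ennreal (norm (k x y)) \<partial>lborel) \<le> ennreal D)"

lemma schur_kernel_measurable:
  "schur_kernel k C D \<Longrightarrow> (\<lambda>(x, y). k x y) \<in> borel_measurable (borel \<Otimes>\<^sub>M borel)"
  by (simp add: schur_kernel_def)

lemma schur_weighted: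
  assumes k: "schur_kernel k C D" and f[measurable]: "f \<in> borel_measurable borel"
  shows "(\<integral>\<^sup>+x. (\<integral>\<^sup>+y. ennreal (norm (k x y)) * f y \<partial>lborel) \<partial>lborel) \<le> ennreal D * (\<integral>\<^sup>+y. f y \<partial>lborel)"
    and "(\<integral>\<^sup>+x. (\<integral>\<^sup>+y. ennreal (norm (k x y)) * f x \<partial>lborel) \<partial>lborel) \<le> ennreal C * (\<integral>\<^sup>+y. f y \<partial>lborel)"
proof -
  note [measurable] = schur_kernel_measurable[OF k]
  have "(\<integral>\<^sup>+x. (\<integral>\<^sup>+y. ennreal (norm (k x y)) * f y \<partial>lborel) \<partial>lborel) =
        (\<integral>\<^sup>+y. (\<integral>\<^sup>+x. ennreal (norm (k x y)) * f y \<partial>lborel) \<partial>lborel)"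
    by (rule lborel_pair.Fubini'[symmetric]) measurable
  also have "\<dots> = (\<integral>\<^sup>+y. (\<integral>\<^sup>+x. ennreal (norm (k x y)) \<partial>lborel) * f y \<partial>lborel)"
    by (simp add: nn_integral_multc)
  also have "\<dots> \<le> (\<integral>\<^sup>+y. ennreal D * f y \<partial>lborel)"
    using k by (intro nn_integral_mono mult_right_mono) (auto simp: schur_kernel_def)
  finally show "(\<integral>\<^sup>+x. (\<integral>\<^sup>+y. ennreal (norm (k x y)) * f y \<partial>lborel) \<partial>lborel) \<le> ennreal D * (\<integral>\<^sup>+y. f y \<partial>lborel)"
    by (simp add: nn_integral_cmult)
  have "(\<integral>\<^sup>+x. (\<integral>\<^sup>+y. ennreal (norm (k x y)) * f x \<partial>lborel) \<partial>lborel) =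
        (\<integral>\<^sup>+x. (\<integral>\<^sup>+y. ennreal (norm (k x y)) \<partial>lborel) * f x \<partial>lborel)"
    by (simp add: nn_integral_multc)
  also have "\<dots> \<le> (\<integral>\<^sup>+x. ennreal C * f x \<partial>lborel)"
    using k by (intro nn_integral_mono mult_right_mono) (auto simp: schur_kernel_def)
  finally show "(\<integral>\<^sup>+x. (\<integral>\<^sup>+y. ennreal (norm (k x y)) * f x \<partial>lborel) \<partial>lborel) \<le> ennreal C * (\<integral>\<^sup>+y. f y \<partial>lborel)"
    by (simp add: nn_integral_cmult)
qed

lemma sq_int_nn_finite: "sq_int f \<Longrightarrow> (\<integral>\<^sup>+x. ennreal ((norm (f x))\<^sup>2) \<partial>lborel) < \<infinity>"
  by (simp add: sq_int_def integrable_iff_bounded)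

text \<open>The product of \<open>norm (u y)\<close> and \<open>norm (v x)\<close> is at most the
  sum of their squares, and each summand is controlled by one of the two Schur bounds. This absolute
  integrability is what allows the order of integration to be exchanged for
  self-adjointness.\<close>

lemma schur_pair_integrable:
  assumes k: "schur_kernel k C D" and u: "sq_int u" and v: "sq_int v"
  shows "integrable (lborel \<Otimes>\<^sub>M lborel) (\<lambda>(x, y). (k x y * u y) \<bullet> v x)"
proof -
  note [measurable] = schur_kernel_measurable[OF k] sq_int_measurable[OF u] sq_int_measurable[OF v]
  have "(\<integral>\<^sup>+z. ennreal (norm (case z of (x, y) \<Rightarrow> (k x y * u y) \<bullet> v x)) \<partial>(lborel \<Otimes>\<^sub>M lborel)) =
     (\<integral>\<^sup>+x. (\<integral>\<^sup>+y. ennreal (norm ((k x y * u y) \<bullet> v x)) \<partial>lborel) \<partial>lborel)"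
    by (subst lborel.nn_integral_fst[symmetric]) (simp_all add: split_beta)
  also have "\<dots> \<le> (\<integral>\<^sup>+x. (\<integral>\<^sup>+y. ennreal (norm (k x y)) * ennreal ((norm (u y))\<^sup>2) +
       ennreal (norm (k x y)) * ennreal ((norm (v x))\<^sup>2) \<partial>lborel) \<partial>lborel)"
  proof (intro nn_integral_mono)
    fix x y
    have "norm ((k x y * u y) \<bullet> v x) \<le> norm (k x y * u y) * norm (v x)" by (simp add: Cauchy_Schwarz_ineq2)
    also have "\<dots> = norm (k x y) * (norm (u y) * norm (v x))" by (simp add: norm_mult)
    also have "\<dots> \<le> norm (k x y) * ((norm (u y))\<^sup>2 + (norm (v x))\<^sup>2)"
      using sum_squares_bound[of "norm (u y)" "norm (v x)"]
        mult_nonneg_nonneg[OF norm_ge_zero[of "u y"] norm_ge_zero[of "v x"]]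
      by (intro mult_left_mono norm_ge_zero) linarith
    finally show "ennreal (norm ((k x y * u y) \<bullet> v x)) \<le>
       ennreal (norm (k x y)) * ennreal ((norm (u y))\<^sup>2) + ennreal (norm (k x y)) * ennreal ((norm (v x))\<^sup>2)"
      by (simp add: ennreal_mult[symmetric] ennreal_plus[symmetric] distrib_left del: ennreal_plus)
  qed
  also have "\<dots> = (\<integral>\<^sup>+x. (\<integral>\<^sup>+y. ennreal (norm (k x y)) * ennreal ((norm (u y))\<^sup>2) \<partial>lborel) \<partial>lborel) +
      (\<integral>\<^sup>+x. (\<integral>\<^sup>+y. ennreal (norm (k x y)) * ennreal ((norm (v x))\<^sup>2) \<partial>lborel) \<partial>lborel)"
    by (subst nn_integral_add[symmetric]) (simp_all add: nn_integral_add)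
  also have "\<dots> \<le> ennreal D * (\<integral>\<^sup>+y. ennreal ((norm (u y))\<^sup>2) \<partial>lborel) +
      ennreal C * (\<integral>\<^sup>+y. ennreal ((norm (v y))\<^sup>2) \<partial>lborel)"
    by (intro add_mono schur_weighted[OF k]) measurable
  also have "\<dots> < \<infinity>" using sq_int_nn_finite[OF u] sq_int_nn_finite[OF v] by (simp add: ennreal_mult_less_top)
  finally show ?thesis by (intro integrableI_bounded) auto
qed

lemma norm_integral_le_nn: "ennreal (norm (integral\<^sup>L M f)) \<le> (\<integral>\<^sup>+x. ennreal (norm (f x)) \<partial>M)"
  by (cases "integrable M f") (auto simp: integral_norm_bound_ennreal not_integrable_integral_eq)

text \<open>Cauchy-Schwarz for the splitting of the kernel into two square roots: one factor is a
  row integral, bounded by \<open>C\<close>, the other is integrated over \<open>x\<close> and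
  bounded by \<open>D\<close>. Keeping the absolute value inside the inner integral also gives its
  convergence for almost every \<open>x\<close>.\<close>

lemma schur_test:
  assumes k: "schur_kernel k C D" and u: "sq_int u"
  shows "(\<integral>\<^sup>+x. (\<integral>\<^sup>+y. ennreal (norm (k x y * u y)) \<partial>lborel)\<^sup>2 \<partial>lborel) \<le> ennreal (C * D) * (\<integral>\<^sup>+y. ennreal ((norm (u y))\<^sup>2) \<partial>lborel)"
proof -
  note [measurable] = schur_kernel_measurable[OF k] sq_int_measurable[OF u]
  have CD: "C \<ge> 0" "D \<ge> 0" using k by (auto simp: schur_kernel_def)
  have "(\<integral>\<^sup>+y. ennreal (norm (k x y * u y)) \<partial>lborel)\<^sup>2 \<le> ennreal C * (\<integral>\<^sup>+y. ennreal (norm (k x y)) * ennreal ((norm (u y))\<^sup>2) \<partial>lborel)" for x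
  proof -
    have "(\<integral>\<^sup>+y. ennreal (norm (k x y * u y)) \<partial>lborel)\<^sup>2 =
       (\<integral>\<^sup>+y. ennreal (sqrt (norm (k x y))) * ennreal (sqrt (norm (k x y)) * norm (u y)) \<partial>lborel)\<^sup>2"
      by (intro arg_cong[where f="\<lambda>t. t\<^sup>2"] nn_integral_cong)
         (simp add: ennreal_mult[symmetric] norm_mult mult.assoc[symmetric])
    also have "\<dots> \<le> (\<integral>\<^sup>+y. (ennreal (sqrt (norm (k x y))))\<^sup>2 \<partial>lborel) *
        (\<integral>\<^sup>+y. (ennreal (sqrt (norm (k x y)) * norm (u y)))\<^sup>2 \<partial>lborel)"
      by (rule Cauchy_Schwarz_nn_integral) measurable
    also have "\<dots> = (\<integral>\<^sup>+y. ennreal (norm (k x y)) \<partial>lborel) * (\<integral>\<^sup>+y. ennreal (norm (k x y)) * ennreal ((norm (u y))\<^sup>2) \<partial>lborel)"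
      by (simp add: ennreal_power ennreal_mult[symmetric] power_mult_distrib)
    also have "\<dots> \<le> ennreal C * (\<integral>\<^sup>+y. ennreal (norm (k x y)) * ennreal ((norm (u y))\<^sup>2) \<partial>lborel)"
      using k by (intro mult_right_mono) (auto simp: schur_kernel_def)
    finally show ?thesis .
  qed
  then have "(\<integral>\<^sup>+x. (\<integral>\<^sup>+y. ennreal (norm (k x y * u y)) \<partial>lborel)\<^sup>2 \<partial>lborel) \<le>
     (\<integral>\<^sup>+x. ennreal C * (\<integral>\<^sup>+y. ennreal (norm (k x y)) * ennreal ((norm (u y))\<^sup>2) \<partial>lborel) \<partial>lborel)"
    by (intro nn_integral_mono)
  also have "\<dots> = ennreal C * (\<integral>\<^sup>+x. (\<integral>\<^sup>+y. ennreal (norm (k x y)) * ennreal ((norm (u y))\<^sup>2) \<partial>lborel) \<partial>lborel)"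
    by (rule nn_integral_cmult) measurable
  also have "\<dots> \<le> ennreal C * (ennreal D * (\<integral>\<^sup>+y. ennreal ((norm (u y))\<^sup>2) \<partial>lborel))"
    by (intro mult_left_mono schur_weighted[OF k]) auto
  finally show ?thesis using CD by (simp add: ennreal_mult mult.assoc)
qed

lemma schur_AE_integrable:
  assumes k: "schur_kernel k C D" and u: "sq_int u"
  shows "AE x in lborel. integrable lborel (\<lambda>y. k x y * u y)"
proof -
  note [measurable] = schur_kernel_measurable[OF k] sq_int_measurable[OF u]
  have "(\<integral>\<^sup>+x. (\<integral>\<^sup>+y. ennreal (norm (k x y * u y)) \<partial>lborel)\<^sup>2 \<partial>lborel) < \<infinity>"
    by (rule le_less_trans[OF schur_test[OF k u]]) (use sq_int_nn_finite[OF u] in \<open>simp add: ennreal_mult_less_top\<close>)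
  then have "AE x in lborel. (\<integral>\<^sup>+y. ennreal (norm (k x y * u y)) \<partial>lborel)\<^sup>2 \<noteq> \<infinity>"
    by (intro nn_integral_noteq_infinite) auto
  then show ?thesis
  proof eventually_elim
    fix x assume "(\<integral>\<^sup>+y. ennreal (norm (k x y * u y)) \<partial>lborel)\<^sup>2 \<noteq> \<infinity>"
    then have "(\<integral>\<^sup>+y. ennreal (norm (k x y * u y)) \<partial>lborel) < \<infinity>"
      by (simp add: power2_eq_square ennreal_mult_eq_top_iff less_top[symmetric])
    then show "integrable lborel (\<lambda>y. k x y * u y)" by (intro integrableI_bounded) auto
  qed
qed

lemma schur_sq_int:
  assumes k: "schur_kernel k C D" and u: "sq_int u"
  shows "sq_int (\<lambda>x. \<integral>y. k x y * u y \<partial>lborel)"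
    and "(\<integral>\<^sup>+x. ennreal ((norm (\<integral>y. k x y * u y \<partial>lborel))\<^sup>2) \<partial>lborel) \<le> ennreal (C * D) * (\<integral>\<^sup>+y. ennreal ((norm (u y))\<^sup>2) \<partial>lborel)"
proof -
  note [measurable] = schur_kernel_measurable[OF k] sq_int_measurable[OF u]
  have "(\<integral>\<^sup>+x. ennreal ((norm (\<integral>y. k x y * u y \<partial>lborel))\<^sup>2) \<partial>lborel) \<le>
     (\<integral>\<^sup>+x. (\<integral>\<^sup>+y. ennreal (norm (k x y * u y)) \<partial>lborel)\<^sup>2 \<partial>lborel)"
    unfolding ennreal_power[OF norm_ge_zero, symmetric]
    by (intro nn_integral_mono power_mono norm_integral_le_nn) auto
  also note schur_test[OF k u]
  finally show 1: "(\<integral>\<^sup>+x. ennreal ((norm (\<integral>y. k x y * u y \<partial>lborel))\<^sup>2) \<partial>lborel) \<le> ennreal (C * D) * (\<integral>\<^sup>+y. ennreal ((norm (u y))\<^sup>2) \<partial>lborel)" .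
  have "\<dots> < \<infinity>" using sq_int_nn_finite[OF u] by (simp add: ennreal_mult_less_top)
  with 1 have "(\<integral>\<^sup>+x. ennreal ((norm (\<integral>y. k x y * u y \<partial>lborel))\<^sup>2) \<partial>lborel) < \<infinity>" by (rule le_less_trans)
  then show "sq_int (\<lambda>x. \<integral>y. k x y * u y \<partial>lborel)"
    unfolding sq_int_def by (auto intro!: integrableI_bounded)
qed

definition kernel_op :: "('a::euclidean_space \<Rightarrow> 'a \<Rightarrow> complex) \<Rightarrow> 'a l2 \<Rightarrow> 'a l2" where
  "kernel_op k u = abs_l2 (\<lambda>x. \<integral>y. k x y * rep_l2 u y \<partial>lborel)"

lemma rep_kernel_op:
  "schur_kernel k C D \<Longrightarrow> AE x in lborel. rep_l2 (kernel_op k u) x = (\<integral>y. k x y * rep_l2 u y \<partial>lborel)"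
  unfolding kernel_op_def by (intro rep_abs_l2 schur_sq_int(1)) simp_all

lemma norm_kernel_op:
  assumes k: "schur_kernel k C D"
  shows "norm (kernel_op k u) \<le> sqrt (C * D) * norm u"
proof -
  have CD: "C * D \<ge> 0" using k by (auto simp: schur_kernel_def)
  have "ennreal ((norm (kernel_op k u))\<^sup>2) = (\<integral>\<^sup>+x. ennreal ((norm (\<integral>y. k x y * rep_l2 u y \<partial>lborel))\<^sup>2) \<partial>lborel)"
    unfolding nn_norm2_l2[symmetric]
    by (rule nn_integral_cong_AE) (use rep_kernel_op[OF k, of u] in \<open>auto elim!: eventually_mono\<close>)
  also have "\<dots> \<le> ennreal (C * D) * ennreal ((norm u)\<^sup>2)"
    unfolding nn_norm2_l2[symmetric] by (rule schur_sq_int(2)[OF k]) simp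
  also have "\<dots> = ennreal ((sqrt (C * D) * norm u)\<^sup>2)"
    using CD by (simp add: ennreal_mult[symmetric] power_mult_distrib)
  finally have "(norm (kernel_op k u))\<^sup>2 \<le> (sqrt (C * D) * norm u)\<^sup>2"
    by (subst (asm) ennreal_le_iff) auto
  then show ?thesis by (rule power2_le_imp_le) (use CD in auto)
qed

lemma bounded_linear_kernel_op:
  assumes k: "schur_kernel k C D"
  shows "bounded_linear (kernel_op k)"
proof (rule bounded_linear_intro)
  fix u v :: "'a l2" and c :: real
  have "AE x in lborel. rep_l2 (kernel_op k (u + v)) x = rep_l2 (kernel_op k u + kernel_op k v) x"
    using rep_kernel_op[OF k, of "u + v"] rep_kernel_op[OF k, of u] rep_kernel_op[OF k, of v]
      rep_plus_l2[of "kernel_op k u" "kernel_op k v"]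
      schur_AE_integrable[OF k sq_int_rep, of u] schur_AE_integrable[OF k sq_int_rep, of v]
  proof eventually_elim
    case (elim x)
    note [measurable] = schur_kernel_measurable[OF k]
    have "rep_l2 (kernel_op k (u + v)) x = (\<integral>y. k x y * rep_l2 u y + k x y * rep_l2 v y \<partial>lborel)"
      unfolding elim(1)
      by (rule integral_cong_AE) (use rep_plus_l2[of u v] in \<open>auto simp: distrib_left elim!: eventually_mono\<close>)
    then show ?case using elim by simp
  qed
  then show "kernel_op k (u + v) = kernel_op k u + kernel_op k v" by (rule l2_eqI)
  have "AE x in lborel. rep_l2 (kernel_op k (c *\<^sub>R u)) x = rep_l2 (c *\<^sub>R kernel_op k u) x"
    using rep_kernel_op[OF k, of "c *\<^sub>R u"] rep_kernel_op[OF k, of u] rep_scaleR_l2[of c "kernel_op k u"]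
  proof eventually_elim
    case (elim x)
    note [measurable] = schur_kernel_measurable[OF k]
    have "rep_l2 (kernel_op k (c *\<^sub>R u)) x = (\<integral>y. c *\<^sub>R (k x y * rep_l2 u y) \<partial>lborel)"
      unfolding elim(1)
      by (rule integral_cong_AE) (use rep_scaleR_l2[of c u] in \<open>auto elim!: eventually_mono\<close>)
    then show ?case using elim by simp
  qed
  then show "kernel_op k (c *\<^sub>R u) = c *\<^sub>R kernel_op k u" by (rule l2_eqI)
  show "norm (kernel_op k u) \<le> norm u * sqrt (C * D)" using norm_kernel_op[OF k, of u] by (simp add: mult.commute)
qed

text \<open>Changing \<open>f\<close> on a null set alters no inner integral, so explicit functions
  may replace the chosen representatives. Forms of translated bumps are computed in this
  way.\<close>

lemma inner_kernel_op_abs: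
  assumes k: "schur_kernel k C D" and f: "sq_int f" and g: "sq_int g"
  shows "kernel_op k (abs_l2 f) \<bullet> abs_l2 g = (\<integral>x. (\<integral>y. (k x y * f y) \<bullet> g x \<partial>lborel) \<partial>lborel)"
proof -
  note [measurable] = schur_kernel_measurable[OF k] sq_int_measurable[OF f] sq_int_measurable[OF g]
  have e: "(\<integral>y. k x y * rep_l2 (abs_l2 f) y \<partial>lborel) = (\<integral>y. k x y * f y \<partial>lborel)" for x
    by (rule integral_cong_AE) (use rep_abs_l2[OF f] in \<open>auto elim!: eventually_mono\<close>)
  show ?thesis
    unfolding inner_l2_def
  proof (rule integral_cong_AE)
    show "AE x in lborel. rep_l2 (kernel_op k (abs_l2 f)) x \<bullet> rep_l2 (abs_l2 g) x = (\<integral>y. (k x y * f y) \<bullet> g x \<partial>lborel)"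
      using rep_kernel_op[OF k, of "abs_l2 f"] schur_AE_integrable[OF k f] rep_abs_l2[OF g]
      by eventually_elim (simp add: e)
  qed measurable
qed

lemma inner_kernel_op:
  assumes k: "schur_kernel k C D"
  shows "kernel_op k u \<bullet> v = (\<integral>(x, y). (k x y * rep_l2 u y) \<bullet> rep_l2 v x \<partial>(lborel \<Otimes>\<^sub>M lborel))"
proof -
  have "kernel_op k u \<bullet> v = (\<integral>x. (\<integral>y. (k x y * rep_l2 u y) \<bullet> rep_l2 v x \<partial>lborel) \<partial>lborel)"
    using inner_kernel_op_abs[OF k sq_int_rep[of u] sq_int_rep[of v]] by (simp only: abs_rep_l2)
  also have "\<dots> = (\<integral>(x, y). (k x y * rep_l2 u y) \<bullet> rep_l2 v x \<partial>(lborel \<Otimes>\<^sub>M lborel))"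
    using lborel_pair.integral_fst[OF schur_pair_integrable[OF k sq_int_rep[of u] sq_int_rep[of v]]] .
  finally show ?thesis .
qed

lemma kernel_op_self_adjoint:
  assumes k: "schur_kernel k C D" and herm: "\<And>x y. k y x = cnj (k x y)"
  shows "kernel_op k u \<bullet> v = u \<bullet> kernel_op k v"
proof -
  note [measurable] = schur_kernel_measurable[OF k]
  have "kernel_op k u \<bullet> v = (\<integral>(x, y). (k x y * rep_l2 u y) \<bullet> rep_l2 v x \<partial>(lborel \<Otimes>\<^sub>M lborel))"
    by (rule inner_kernel_op[OF k])
  also have "\<dots> = (\<integral>(y, x). (k x y * rep_l2 u y) \<bullet> rep_l2 v x \<partial>(lborel \<Otimes>\<^sub>M lborel))"
    by (subst lborel_pair.integral_product_swap[symmetric]) (simp_all add: split_beta)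
  also have "\<dots> = (\<integral>(y, x). (k y x * rep_l2 v x) \<bullet> rep_l2 u y \<partial>(lborel \<Otimes>\<^sub>M lborel))"
  proof (intro Bochner_Integration.integral_cong refl)
    fix z :: "'a \<times> 'a"
    have "(p * q) \<bullet> r = (cnj p * r) \<bullet> q" for p q r :: complex
      by (simp add: inner_complex_def algebra_simps)
    from this[of "k (snd z) (fst z)" "rep_l2 u (fst z)" "rep_l2 v (snd z)"]
    show "(case z of (y, x) \<Rightarrow> (k x y * rep_l2 u y) \<bullet> rep_l2 v x) =
        (case z of (y, x) \<Rightarrow> (k y x * rep_l2 v x) \<bullet> rep_l2 u y)"
      by (simp add: split_beta herm[of "fst z" "snd z"])
  qed
  also have "\<dots> = kernel_op k v \<bullet> u" by (rule inner_kernel_op[OF k, symmetric])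
  finally show ?thesis by (simp add: inner_commute)
qed

text \<open>Young's inequality for an integrable \<open>a\<close> as a case of Schur's test: every
  row and every column has the L1 norm of \<open>a\<close> as its integral.\<close>

lemma schur_kernel_conv:
  fixes a :: "'a::euclidean_space \<Rightarrow> complex"
  assumes a: "integrable lborel a"
  shows "schur_kernel (\<lambda>x y. a (x - y)) (\<integral>x. norm (a x) \<partial>lborel) (\<integral>x. norm (a x) \<partial>lborel)"
proof -
  have [measurable]: "a \<in> borel_measurable borel" using borel_measurable_integrable[OF a] by simp
  have e: "(\<integral>\<^sup>+x. ennreal (norm (a x)) \<partial>lborel) = ennreal (\<integral>x. norm (a x) \<partial>lborel)"
    using a by (intro nn_integral_eq_integral) auto
  have "(\<integral>\<^sup>+y. ennreal (norm (a (x - y))) \<partial>lborel) = ennreal (\<integral>x. norm (a x) \<partial>lborel)" for x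
    using nn_integral_reflect[of "\<lambda>x. ennreal (norm (a x))" x] e by simp
  moreover have "(\<integral>\<^sup>+x. ennreal (norm (a (x - y))) \<partial>lborel) = ennreal (\<integral>x. norm (a x) \<partial>lborel)" for y
    using nn_integral_shift[of "\<lambda>x. ennreal (norm (a x))" "-y"] e by simp
  ultimately show ?thesis unfolding schur_kernel_def by (auto intro: integral_nonneg_AE)
qed

section \<open>Multiplication operators\<close>

definition mult_op :: "('a::euclidean_space \<Rightarrow> complex) \<Rightarrow> 'a l2 \<Rightarrow> 'a l2" where
  "mult_op h u = abs_l2 (\<lambda>x. h x * rep_l2 u x)"

context
  fixes h :: "'a::euclidean_space \<Rightarrow> complex" and C :: real
  assumes [measurable]: "h \<in> borel_measurable borel" and h: "\<And>x. norm (h x) \<le> C"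
begin

lemma rep_mult_op: "AE x in lborel. rep_l2 (mult_op h u) x = h x * rep_l2 u x"
  unfolding mult_op_def by (intro rep_abs_l2 sq_int_mult_bounded[where C=C] h) simp_all

lemma norm_mult_op: "norm (mult_op h u) \<le> C * norm u"
proof -
  have C: "C \<ge> 0" using h[of 0] norm_ge_zero[of "h 0"] by linarith
  have "(norm (mult_op h u))\<^sup>2 = (\<integral>x. (norm (h x * rep_l2 u x))\<^sup>2 \<partial>lborel)"
    unfolding norm2_l2
    by (rule integral_cong_AE) (use rep_mult_op[of u] in \<open>auto elim!: eventually_mono\<close>)
  also have "\<dots> \<le> (\<integral>x. C\<^sup>2 * (norm (rep_l2 u x))\<^sup>2 \<partial>lborel)"
  proof (rule integral_mono)
    show "integrable lborel (\<lambda>x. (norm (h x * rep_l2 u x))\<^sup>2)"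
      by (intro sq_int_norm sq_int_mult_bounded[where C=C] h) simp_all
    show "integrable lborel (\<lambda>x. C\<^sup>2 * (norm (rep_l2 u x))\<^sup>2)" by (intro integrable_mult_right sq_int_norm) simp
    show "(norm (h x * rep_l2 u x))\<^sup>2 \<le> C\<^sup>2 * (norm (rep_l2 u x))\<^sup>2" for x
      unfolding norm_mult power_mult_distrib by (intro mult_right_mono power_mono h) auto
  qed
  also have "\<dots> = (C * norm u)\<^sup>2" by (simp add: norm2_l2[of u] power_mult_distrib)
  finally show ?thesis by (rule power2_le_imp_le) (use C in simp)
qed

lemma bounded_linear_mult_op: "bounded_linear (mult_op h)"
proof (rule bounded_linear_intro)
  fix u v :: "'a l2" and c :: real
  have "AE x in lborel. rep_l2 (mult_op h (u + v)) x = rep_l2 (mult_op h u + mult_op h v) x"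
    using rep_mult_op[of "u + v"] rep_mult_op[of u] rep_mult_op[of v]
      rep_plus_l2[of "mult_op h u" "mult_op h v"] rep_plus_l2[of u v]
    by eventually_elim (simp add: distrib_left)
  then show "mult_op h (u + v) = mult_op h u + mult_op h v" by (rule l2_eqI)
  have "AE x in lborel. rep_l2 (mult_op h (c *\<^sub>R u)) x = rep_l2 (c *\<^sub>R mult_op h u) x"
    using rep_mult_op[of "c *\<^sub>R u"] rep_mult_op[of u] rep_scaleR_l2[of c u] rep_scaleR_l2[of c "mult_op h u"]
    by eventually_elim simp
  then show "mult_op h (c *\<^sub>R u) = c *\<^sub>R mult_op h u" by (rule l2_eqI)
  show "norm (mult_op h u) \<le> norm u * C" using norm_mult_op[of u] by (simp add: mult.commute)
qed

lemma inner_mult_op: "mult_op h u \<bullet> v = (\<integral>x. (h x * rep_l2 u x) \<bullet> rep_l2 v x \<partial>lborel)"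
  unfolding inner_l2_def
  by (rule integral_cong_AE) (use rep_mult_op[of u] in \<open>auto elim!: eventually_mono\<close>)

lemma mult_op_self_adjoint:
  assumes "\<And>x. Im (h x) = 0"
  shows "mult_op h u \<bullet> v = u \<bullet> mult_op h v"
proof -
  have "(h x * p) \<bullet> q = (h x * q) \<bullet> p" for x p q
    using assms[of x] by (simp add: inner_complex_def algebra_simps)
  then have "mult_op h u \<bullet> v = mult_op h v \<bullet> u"
    unfolding inner_mult_op by (intro Bochner_Integration.integral_cong refl)
  then show ?thesis by (simp only: inner_commute[of u])
qed

end

section \<open>Translation continuity and the Riemann-Lebesgue lemma\<close>

definition L1_translation_continuous :: "('a::euclidean_space \<Rightarrow> 'b::{banach, second_countable_topology}) \<Rightarrow> bool" where
  "L1_translation_continuous f \<longleftrightarrow>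
     (\<forall>e>0. \<exists>d>0. \<forall>t. norm t < d \<longrightarrow> (\<integral>x. norm (f (x + t) - f x) \<partial>lborel) < e)"

lemma integrable_shift_diff:
  fixes f :: "'a::euclidean_space \<Rightarrow> 'b::{banach, second_countable_topology}"
  assumes f: "integrable lborel f"
  shows "integrable lborel (\<lambda>x. f (x + t) - f x)"
proof -
  have "f \<in> borel_measurable borel" using borel_measurable_integrable[OF f] by simp
  from integrable_shift[OF this, of t] f show ?thesis by simp
qed

text \<open>An \<open>e / 3\<close> argument; by translation invariance the shifted error of
  approximation equals the unshifted one.\<close>

lemma L1_translation_continuous_approx:
  fixes f :: "'a::euclidean_space \<Rightarrow> 'b::{banach, second_countable_topology}"
  assumes f: "integrable lborel f"
    and approx: "\<And>e. e > 0 \<Longrightarrow> \<exists>g. integrable lborel g \<and> L1_translation_continuous g \<and>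
                   (\<integral>x. norm (f x - g x) \<partial>lborel) < e"
  shows "L1_translation_continuous f"
  unfolding L1_translation_continuous_def
proof (intro allI impI)
  fix e :: real assume "e > 0"
  then have e: "e / 3 > 0" by simp
  from approx[OF e] obtain g where g: "integrable lborel g" "L1_translation_continuous g"
    and fg: "(\<integral>x. norm (f x - g x) \<partial>lborel) < e / 3" by blast
  from g(2) e obtain d where d: "d > 0"
    and gd: "\<And>t. norm t < d \<Longrightarrow> (\<integral>x. norm (g (x + t) - g x) \<partial>lborel) < e / 3"
    unfolding L1_translation_continuous_def by blast
  have [measurable]: "f \<in> borel_measurable borel" "g \<in> borel_measurable borel"
    using borel_measurable_integrable[OF f] borel_measurable_integrable[OF g(1)] by simp_all
  have "(\<integral>x. norm (f (x + t) - f x) \<partial>lborel) < e" if t: "norm t < d" for t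
  proof -
    have ifg: "integrable lborel (\<lambda>x. norm (f x - g x))" using f g(1) by auto
    have ifgt: "integrable lborel (\<lambda>x. norm (f (x + t) - g (x + t)))"
      using integrable_shift[of "\<lambda>x. norm (f x - g x)" t] ifg by simp
    have "(\<integral>x. norm (f (x + t) - f x) \<partial>lborel) \<le>
        (\<integral>x. norm (f (x + t) - g (x + t)) + norm (g (x + t) - g x) + norm (f x - g x) \<partial>lborel)"
    proof (rule integral_mono)
      show "integrable lborel (\<lambda>x. norm (f (x + t) - f x))"
        by (intro integrable_norm integrable_shift_diff f)
      show "integrable lborel (\<lambda>x. norm (f (x + t) - g (x + t)) + norm (g (x + t) - g x) + norm (f x - g x))"
        by (intro Bochner_Integration.integrable_add ifg ifgt integrable_norm integrable_shift_diff g)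
      show "norm (f (x + t) - f x) \<le> norm (f (x + t) - g (x + t)) + norm (g (x + t) - g x) + norm (f x - g x)" for x
        using norm_triangle_ineq[of "f (x + t) - g (x + t)" "(g (x + t) - g x) - (f x - g x)"]
          norm_triangle_ineq4[of "g (x + t) - g x" "f x - g x"] by simp
    qed
    also have "\<dots> = (\<integral>x. norm (f (x + t) - g (x + t)) \<partial>lborel) + (\<integral>x. norm (g (x + t) - g x) \<partial>lborel) +
        (\<integral>x. norm (f x - g x) \<partial>lborel)"
      using ifg ifgt integrable_shift_diff[OF g(1), of t] by simp
    also have "(\<integral>x. norm (f (x + t) - g (x + t)) \<partial>lborel) = (\<integral>x. norm (f x - g x) \<partial>lborel)"
      by (rule integral_shift) measurable
    finally show ?thesis using fg gd[OF t] by linarith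
  qed
  with d show "\<exists>d>0. \<forall>t. norm t < d \<longrightarrow> (\<integral>x. norm (f (x + t) - f x) \<partial>lborel) < e" by blast
qed

text \<open>Openness gives convergence of the shifted indicator at the points of \<open>U\<close>,
  but boundary points may fail. Translation invariance removes them: the L1 distance is twice the
  integral of \<open>indicator U x - indicator U x * indicator U (x + s)\<close>, whose integrand
  lives on \<open>U\<close> and is dominated by its indicator.\<close>

lemma L1_translation_continuous_open:
  fixes U :: "'a::euclidean_space set"
  assumes U: "open U" "emeasure lborel U < \<infinity>"
  shows "L1_translation_continuous (indicator U :: 'a \<Rightarrow> real)"
proof (rule ccontr)
  assume "\<not> L1_translation_continuous (indicator U :: 'a \<Rightarrow> real)"
  then obtain e where e: "e > 0"
    "\<And>d. d > 0 \<Longrightarrow> \<exists>t. norm t < d \<and> (\<integral>x. norm (indicator U (x + t) - indicator U x :: real) \<partial>lborel) \<ge> e"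
    unfolding L1_translation_continuous_def by (meson not_less)
  have "\<exists>t. norm t < 1 / Suc n \<and> (\<integral>x. norm (indicator U (x + t) - indicator U x :: real) \<partial>lborel) \<ge> e" for n
    by (rule e(2)) simp
  then obtain t where t: "\<And>n. norm (t n) < 1 / Suc n"
    "\<And>n. (\<integral>x. norm (indicator U (x + t n) - indicator U x :: real) \<partial>lborel) \<ge> e" by metis
  have t0: "t \<longlonglongrightarrow> 0"
    by (rule Lim_null_comparison[OF _ LIMSEQ_Suc[OF lim_1_over_n]]) (use t(1) in \<open>auto intro!: always_eventually less_imp_le simp del: of_nat_Suc\<close>)
  have [measurable]: "U \<in> sets borel" using U by auto
  have iU: "integrable lborel (indicator U :: 'a \<Rightarrow> real)" using U by simp
  have iUt: "integrable lborel (\<lambda>x. indicator U (x + s) :: real)" for s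
    using integrable_shift[of "indicator U :: 'a \<Rightarrow> real" s] iU by simp
  have iUU: "integrable lborel (\<lambda>x. indicator U x * indicator U (x + s) :: real)" for s
    by (rule Bochner_Integration.integrable_bound[OF iU]) (auto split: split_indicator)
  have eq: "(\<integral>x. norm (indicator U (x + s) - indicator U x :: real) \<partial>lborel) =
      2 * (\<integral>x. indicator U x - indicator U x * indicator U (x + s) \<partial>lborel)" for s
  proof -
    have "(\<integral>x. norm (indicator U (x + s) - indicator U x :: real) \<partial>lborel) =
       (\<integral>x. indicator U (x + s) + indicator U x - 2 * (indicator U x * indicator U (x + s)) \<partial>lborel)"
      by (intro Bochner_Integration.integral_cong refl) (auto split: split_indicator)
    also have "\<dots> = (\<integral>x. indicator U (x + s) \<partial>lborel) + (\<integral>x. indicator U x \<partial>lborel) -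
        2 * (\<integral>x. indicator U x * indicator U (x + s) \<partial>lborel)"
      using iU iUt iUU by simp
    also have "(\<integral>x. indicator U (x + s) \<partial>lborel) = (\<integral>x. indicator U x \<partial>lborel :: real)"
      by (rule integral_shift) measurable
    finally show ?thesis using iU iUU by simp
  qed
  have "(\<lambda>n. \<integral>x. indicator U x - indicator U x * indicator U (x + t n) \<partial>lborel) \<longlonglongrightarrow> integral\<^sup>L lborel (\<lambda>x::'a. 0::real)"
  proof (rule integral_dominated_convergence[where w="indicator U"])
    show "AE x in lborel. (\<lambda>n. indicator U x - indicator U x * indicator U (x + t n) :: real) \<longlonglongrightarrow> 0"
    proof (rule AE_I2)
      fix x
      show "(\<lambda>n. indicator U x - indicator U x * indicator U (x + t n) :: real) \<longlonglongrightarrow> 0"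
      proof (cases "x \<in> U")
        case True
        have "(\<lambda>n. x + t n) \<longlonglongrightarrow> x" using tendsto_add[OF tendsto_const[of x] t0] by simp
        then have "\<forall>\<^sub>F n in sequentially. x + t n \<in> U" by (rule topological_tendstoD) (use U True in auto)
        then have "\<forall>\<^sub>F n in sequentially. (indicator U x - indicator U x * indicator U (x + t n) :: real) = 0"
          by eventually_elim (use True in simp)
        then show ?thesis by (rule tendsto_eventually)
      qed simp
    qed
  qed (use iU in \<open>auto split: split_indicator\<close>)
  from tendsto_mult_left[OF this, of 2]
  have "(\<lambda>n. \<integral>x. norm (indicator U (x + t n) - indicator U x :: real) \<partial>lborel) \<longlonglongrightarrow> 0"
    by (simp only: eq) simp
  then have "e \<le> 0" using t(2) by (intro LIMSEQ_le_const) auto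
  with e(1) show False by simp
qed

text \<open>The tolerance by which a factor \<open>c\<close> is absorbed; the summand 1 admits
  \<open>c = 0\<close>.\<close>

lemma divide_succ_mult_less:
  fixes e c :: real
  assumes "0 < e" "0 \<le> c"
  shows "0 < e / (c + 1)" "e / (c + 1) * c < e"
proof -
  have c: "0 < c + 1" using assms(2) by linarith
  then show "0 < e / (c + 1)" using assms(1) by (rule divide_pos_pos[rotated])
  show "e / (c + 1) * c < e" using c assms(1) by (simp add: pos_divide_less_eq distrib_left)
qed

text \<open>Outer regularity replaces a Borel set of finite measure by an open one at small cost in
  L1; sums and dominated limits then reach all integrable functions.\<close>

theorem integrable_L1_translation_continuous:
  fixes f :: "'a::euclidean_space \<Rightarrow> 'b::{banach, second_countable_topology}"
  assumes "integrable lborel f"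
  shows "L1_translation_continuous f"
  using assms
proof (induction f rule: integrable_induct)
  case (base A c)
  then have A[measurable]: "A \<in> sets borel" by simp
  show ?case
  proof (rule L1_translation_continuous_approx)
    show "integrable lborel (\<lambda>x. indicator A x *\<^sub>R c)" using base by simp
    fix e :: real assume "e > 0"
    define e' where "e' = e / (norm c + 1)"
    have e': "e' > 0" "e' * norm c < e"
      using divide_succ_mult_less[OF \<open>e > 0\<close> norm_ge_zero[of c]] by (auto simp: e'_def)
    obtain U where U: "open U" "A \<subseteq> U" "U - A \<in> lmeasurable" "emeasure lebesgue (U - A) < ennreal e'"
      by (rule sets_lebesgue_outer_open[of A e']) (use e'(1) A in auto)
    have [measurable]: "U \<in> sets borel" using U by auto
    have em: "emeasure lborel (U - A) < ennreal e'" using U(4) by simp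
    have "emeasure lborel U \<le> emeasure lborel A + emeasure lborel (U - A)"
      using emeasure_subadditive[of A lborel "U - A"] U(2) by (simp add: Un_absorb1)
    also have "\<dots> < \<infinity>" using base em order_less_trans[OF em ennreal_less_top] by (simp add: less_top[symmetric])
    finally have Ufin: "emeasure lborel U < \<infinity>" .
    have iU: "integrable lborel (indicator U :: 'a \<Rightarrow> real)" using Ufin by simp
    show "\<exists>g. integrable lborel g \<and> L1_translation_continuous g \<and> (\<integral>x. norm (indicator A x *\<^sub>R c - g x) \<partial>lborel) < e"
    proof (intro exI[of _ "\<lambda>x. indicator U x *\<^sub>R c"] conjI)
      show "integrable lborel (\<lambda>x. indicator U x *\<^sub>R c)" using Ufin by simp
      show "L1_translation_continuous (\<lambda>x. indicator U x *\<^sub>R c)"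
        unfolding L1_translation_continuous_def
      proof (intro allI impI)
        fix s :: real assume "s > 0"
        define s' where "s' = s / (norm c + 1)"
        have s': "s' > 0" "s' * norm c < s"
          using divide_succ_mult_less[OF \<open>s > 0\<close> norm_ge_zero[of c]] by (auto simp: s'_def)
        then obtain d where d: "d > 0"
          "\<And>t. norm t < d \<Longrightarrow> (\<integral>x. norm (indicator U (x + t) - indicator U x :: real) \<partial>lborel) < s'"
          using L1_translation_continuous_open[OF U(1) Ufin] unfolding L1_translation_continuous_def by blast
        have "(\<integral>x. norm (indicator U (x + t) *\<^sub>R c - indicator U x *\<^sub>R c) \<partial>lborel) < s" if "norm t < d" for t
        proof -
          have "(\<integral>x. norm (indicator U (x + t) *\<^sub>R c - indicator U x *\<^sub>R c) \<partial>lborel) =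
              (\<integral>x. norm (indicator U (x + t) - indicator U x :: real) * norm c \<partial>lborel)"
            by (simp add: scaleR_left_diff_distrib[symmetric])
          also have "\<dots> = (\<integral>x. norm (indicator U (x + t) - indicator U x :: real) \<partial>lborel) * norm c" by simp
          also have "\<dots> \<le> s' * norm c" using d(2)[OF that] by (intro mult_right_mono) auto
          finally show ?thesis using s'(2) by simp
        qed
        with d(1) show "\<exists>d>0. \<forall>t. norm t < d \<longrightarrow> (\<integral>x. norm (indicator U (x + t) *\<^sub>R c - indicator U x *\<^sub>R c) \<partial>lborel) < s" by blast
      qed
      have "(\<integral>x. norm (indicator A x *\<^sub>R c - indicator U x *\<^sub>R c) \<partial>lborel) = (\<integral>x. indicator (U - A) x * norm c \<partial>lborel)"
        using U(2) by (intro Bochner_Integration.integral_cong refl) (auto split: split_indicator)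
      also have "\<dots> = measure lborel (U - A) * norm c" by simp
      also have "\<dots> \<le> e' * norm c"
        using em e'(1) by (intro mult_right_mono) (auto simp: measure_def enn2real_leI less_imp_le)
      finally show "(\<integral>x. norm (indicator A x *\<^sub>R c - indicator U x *\<^sub>R c) \<partial>lborel) < e" using e'(2) by simp
    qed
  qed
next
  case (add f g)
  show ?case unfolding L1_translation_continuous_def
  proof (intro allI impI)
    fix e :: real assume "e > 0"
    then have e: "e / 2 > 0" by simp
    obtain d1 where d1: "d1 > 0" "\<And>t. norm t < d1 \<Longrightarrow> (\<integral>x. norm (f (x + t) - f x) \<partial>lborel) < e / 2"
      using add.IH(1) e unfolding L1_translation_continuous_def by blast
    obtain d2 where d2: "d2 > 0" "\<And>t. norm t < d2 \<Longrightarrow> (\<integral>x. norm (g (x + t) - g x) \<partial>lborel) < e / 2"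
      using add.IH(2) e unfolding L1_translation_continuous_def by blast
    have "(\<integral>x. norm ((f (x + t) + g (x + t)) - (f x + g x)) \<partial>lborel) < e" if t: "norm t < min d1 d2" for t
    proof -
      have "(\<integral>x. norm ((f (x + t) + g (x + t)) - (f x + g x)) \<partial>lborel) \<le>
         (\<integral>x. norm (f (x + t) - f x) + norm (g (x + t) - g x) \<partial>lborel)"
      proof (rule integral_mono)
        show "integrable lborel (\<lambda>x. norm ((f (x + t) + g (x + t)) - (f x + g x)))"
          using integrable_shift_diff[OF Bochner_Integration.integrable_add[OF add.hyps(1,2)], of t] by (rule integrable_norm)
        show "integrable lborel (\<lambda>x. norm (f (x + t) - f x) + norm (g (x + t) - g x))"
          by (intro Bochner_Integration.integrable_add integrable_norm integrable_shift_diff add.hyps)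
        show "norm ((f (x + t) + g (x + t)) - (f x + g x)) \<le> norm (f (x + t) - f x) + norm (g (x + t) - g x)" for x
          using norm_triangle_ineq[of "f (x + t) - f x" "g (x + t) - g x"] by (simp add: algebra_simps)
      qed
      also have "\<dots> = (\<integral>x. norm (f (x + t) - f x) \<partial>lborel) + (\<integral>x. norm (g (x + t) - g x) \<partial>lborel)"
        using integrable_shift_diff[OF add.hyps(1), of t] integrable_shift_diff[OF add.hyps(2), of t] by simp
      finally show ?thesis using d1(2)[of t] d2(2)[of t] t by simp
    qed
    with d1(1) d2(1) show "\<exists>d>0. \<forall>t. norm t < d \<longrightarrow> (\<integral>x. norm ((f (x + t) + g (x + t)) - (f x + g x)) \<partial>lborel) < e"
      by (intro exI[of _ "min d1 d2"]) auto
  qed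
next
  case (lim f s)
  show ?case
  proof (rule L1_translation_continuous_approx[OF lim.hyps(4)])
    fix e :: real assume e: "e > 0"
    have [measurable]: "f \<in> borel_measurable borel" "s i \<in> borel_measurable borel" for i
      using borel_measurable_integrable[OF lim.hyps(4)] borel_measurable_integrable[OF lim.hyps(1)] by simp_all
    have "(\<lambda>i. \<integral>x. norm (f x - s i x) \<partial>lborel) \<longlonglongrightarrow> integral\<^sup>L lborel (\<lambda>x::'a. 0::real)"
    \<comment> \<open>The approximants satisfy \<open>norm (s i x) \<le> 2 * norm (f x)\<close>,
      hence the factor 3.\<close>
    proof (rule integral_dominated_convergence[where w="\<lambda>x. 3 * norm (f x)"])
      show "AE x in lborel. (\<lambda>i. norm (f x - s i x)) \<longlonglongrightarrow> 0"
      proof (rule AE_I2)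
        fix x
        show "(\<lambda>i. norm (f x - s i x)) \<longlonglongrightarrow> 0"
          using tendsto_norm[OF tendsto_diff[OF tendsto_const[of "f x"] lim.hyps(2)[of x]]] by simp
      qed
      show "AE x in lborel. norm (norm (f x - s i x)) \<le> 3 * norm (f x)" for i
      proof (rule AE_I2)
        fix x
        show "norm (norm (f x - s i x)) \<le> 3 * norm (f x)"
          using norm_triangle_ineq4[of "f x" "s i x"] lim.hyps(3)[of x i] by simp
      qed
    qed (use lim.hyps(4) in auto)
    then have "\<forall>\<^sub>F i in sequentially. (\<integral>x. norm (f x - s i x) \<partial>lborel) < e"
      using e by (intro order_tendstoD(2)) auto
    then obtain i where "(\<integral>x. norm (f x - s i x) \<partial>lborel) < e" by (auto simp: eventually_sequentially)
    with lim.hyps(1) lim.IH show "\<exists>g. integrable lborel g \<and> L1_translation_continuous g \<and> (\<integral>x. norm (f x - g x) \<partial>lborel) < e"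
      by blast
  qed
qed

section \<open>The Fourier transform of Borel functions\<close>

definition ft :: "('a::euclidean_space \<Rightarrow> complex) \<Rightarrow> 'a \<Rightarrow> complex" where
  "ft f \<xi> = (\<integral>x. f x * exp (- \<i> * of_real (\<xi> \<bullet> x)) \<partial>lborel)"

lemma norm_character [simp]: "norm (exp (- \<i> * of_real t)) = 1" "norm (exp (- (\<i> * of_real t))) = 1" "norm (exp (\<i> * of_real t)) = 1"
  by (auto simp: norm_exp_eq_Re)

lemma integrable_ft:
  assumes "integrable lborel f"
  shows "integrable lborel (\<lambda>x. f x * exp (- \<i> * of_real (\<xi> \<bullet> x)))"
  by (rule Bochner_Integration.integrable_bound[OF assms])
     (use borel_measurable_integrable[OF assms] in \<open>auto simp: norm_mult\<close>)

lemma ft_measurable [measurable]: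
  assumes [measurable]: "f \<in> borel_measurable borel"
  shows "ft f \<in> borel_measurable borel"
  unfolding ft_def[abs_def] by measurable

lemma norm_ft_le: "norm (ft f \<xi>) \<le> (\<integral>x. norm (f x) \<partial>lborel)"
  unfolding ft_def by (rule order_trans[OF integral_norm_bound]) (simp add: norm_mult)

lemma Im_ft_hermitian:
  assumes f: "integrable lborel f" and herm: "\<And>x. f (- x) = cnj (f x)"
  shows "Im (ft f \<xi>) = 0"
proof -
  have [measurable]: "f \<in> borel_measurable borel" using borel_measurable_integrable[OF f] by simp
  have "cnj (ft f \<xi>) = (\<integral>x. cnj (f x * exp (- \<i> * of_real (\<xi> \<bullet> x))) \<partial>lborel)"
    unfolding ft_def by (rule Bochner_Integration.integral_cnj[symmetric])
  also have "\<dots> = (\<integral>x. f (- x) * exp (- \<i> * of_real (\<xi> \<bullet> (- x))) \<partial>lborel)"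
    by (simp add: herm exp_cnj)
  also have "\<dots> = ft f \<xi>"
    unfolding ft_def using integral_reflect[of "\<lambda>x. f x * exp (- \<i> * of_real (\<xi> \<bullet> x))" 0] by simp
  finally show ?thesis by (metis complex_cnj_cancel_iff cnj.simps(2) equal_neg_zero)
qed

text \<open>A shift by \<open>(pi / (\<xi> \<bullet> \<xi>)) *\<^sub>R \<xi>\<close> changes the
  sign of the character at \<open>\<xi>\<close>, so twice the transform of \<open>f\<close> is the
  transform of \<open>f\<close> minus its shift. The shift has length
  \<open>pi / norm \<xi>\<close>, and continuity of translations in L1 finishes the
  argument.\<close>

theorem Riemann_Lebesgue:
  assumes f: "integrable lborel f" and e: "e > 0"
  shows "\<exists>R>0. \<forall>\<xi>. norm \<xi> \<ge> R \<longrightarrow> norm (ft f \<xi>) < e"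
proof -
  have [measurable]: "f \<in> borel_measurable borel" using borel_measurable_integrable[OF f] by simp
  obtain d where d: "d > 0" "\<And>t. norm t < d \<Longrightarrow> (\<integral>x. norm (f (x + t) - f x) \<partial>lborel) < e"
    using integrable_L1_translation_continuous[OF f] e unfolding L1_translation_continuous_def by blast
  have "norm (ft f \<xi>) < e" if \<xi>: "norm \<xi> \<ge> pi / d + 1" for \<xi>
  proof -
    have \<xi>0: "norm \<xi> > pi / d" "norm \<xi> > 0" using \<xi> divide_pos_pos[OF pi_gt_zero d(1)] by linarith+
    define t where "t = (pi / (\<xi> \<bullet> \<xi>)) *\<^sub>R \<xi>"
    have "norm t = pi / norm \<xi>"
      using \<xi>0 by (simp add: t_def power2_norm_eq_inner[symmetric] power2_eq_square)
    moreover have "pi / norm \<xi> < d"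
      using \<xi>0 d(1) by (simp add: pos_divide_less_eq mult.commute)
    ultimately have t: "norm t < d" by simp
    have xt: "\<xi> \<bullet> t = pi" using \<xi>0 by (simp add: t_def)
    have "ft f \<xi> = (\<integral>x. f (x + t) * exp (- \<i> * of_real (\<xi> \<bullet> (x + t))) \<partial>lborel)"
      unfolding ft_def by (rule integral_shift[symmetric]) measurable
    also have "\<dots> = (\<integral>x. - (f (x + t) * exp (- \<i> * of_real (\<xi> \<bullet> x))) \<partial>lborel)"
    proof (intro Bochner_Integration.integral_cong refl)
      fix x
      have "- \<i> * of_real (\<xi> \<bullet> (x + t)) = - \<i> * of_real (\<xi> \<bullet> x) - \<i> * of_real pi"
        by (simp add: inner_add_right xt algebra_simps)
      then have "exp (- \<i> * of_real (\<xi> \<bullet> (x + t))) = - exp (- \<i> * of_real (\<xi> \<bullet> x))"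
        by (simp only: exp_diff exp_pi_i') simp
      then show "f (x + t) * exp (- \<i> * of_real (\<xi> \<bullet> (x + t))) = - (f (x + t) * exp (- \<i> * of_real (\<xi> \<bullet> x)))"
        by simp
    qed
    also have "\<dots> = - (\<integral>x. f (x + t) * exp (- \<i> * of_real (\<xi> \<bullet> x)) \<partial>lborel)" by simp
    finally have e1: "ft f \<xi> = - (\<integral>x. f (x + t) * exp (- \<i> * of_real (\<xi> \<bullet> x)) \<partial>lborel)" .
    have ift: "integrable lborel (\<lambda>x. f (x + t))" using integrable_shift[of f t] f by simp
    have "2 * ft f \<xi> = (\<integral>x. f x * exp (- \<i> * of_real (\<xi> \<bullet> x)) \<partial>lborel) -
         (\<integral>x. f (x + t) * exp (- \<i> * of_real (\<xi> \<bullet> x)) \<partial>lborel)"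
      using e1 by (simp add: ft_def)
    also have "\<dots> = (\<integral>x. f x * exp (- \<i> * of_real (\<xi> \<bullet> x)) - f (x + t) * exp (- \<i> * of_real (\<xi> \<bullet> x)) \<partial>lborel)"
      by (rule Bochner_Integration.integral_diff[symmetric]) (intro integrable_ft f ift)+
    finally have "norm (2 * ft f \<xi>) = norm (\<integral>x. (f x - f (x + t)) * exp (- \<i> * of_real (\<xi> \<bullet> x)) \<partial>lborel)"
      by (simp add: left_diff_distrib)
    also have "\<dots> \<le> (\<integral>x. norm (f (x + t) - f x) \<partial>lborel)"
      by (rule order_trans[OF integral_norm_bound]) (simp add: norm_mult norm_minus_commute)
    also have "\<dots> < e" by (rule d(2)[OF t])
    finally have "2 * norm (ft f \<xi>) < e" by (simp add: norm_mult)
    then show ?thesis using norm_ge_zero[of "ft f \<xi>"] by linarith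
  qed
  then show ?thesis using d(1) by (intro exI[of _ "pi / d + 1"]) (auto intro: add_pos_pos)
qed

section \<open>Compactness of convolution after a cutoff\<close>

text \<open>For positive \<open>\<eta>\<close> this is the lower corner of the half-open cube of
  side \<open>\<eta>\<close> in the grid that contains \<open>y\<close>.\<close>

definition grid_point :: "real \<Rightarrow> 'a::euclidean_space \<Rightarrow> 'a" where
  "grid_point \<eta> y = (\<Sum>b\<in>Basis. (\<eta> * of_int \<lfloor>(y \<bullet> b) / \<eta>\<rfloor>) *\<^sub>R b)"

lemma grid_point_measurable [measurable]: "grid_point \<eta> \<in> borel_measurable borel"
  unfolding grid_point_def[abs_def] by measurable

lemma norm_diff_grid_point:
  fixes y :: "'a::euclidean_space"
  assumes "\<eta> > 0"
  shows "norm (grid_point \<eta> y - y) \<le> \<eta> * DIM('a)"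
proof -
  have "norm (grid_point \<eta> y - y) \<le> (\<Sum>b\<in>(Basis::'a set). \<bar>(grid_point \<eta> y - y) \<bullet> b\<bar>)" by (rule norm_le_l1)
  also have "\<dots> \<le> (\<Sum>b\<in>(Basis::'a set). \<eta>)"
  proof (rule sum_mono)
    fix b :: 'a assume b: "b \<in> Basis"
    have "grid_point \<eta> y \<bullet> b = \<eta> * of_int \<lfloor>(y \<bullet> b) / \<eta>\<rfloor>"
      unfolding grid_point_def using b by simp
    moreover have "\<eta> * of_int \<lfloor>(y \<bullet> b) / \<eta>\<rfloor> \<le> \<eta> * ((y \<bullet> b) / \<eta>)" "\<eta> * ((y \<bullet> b) / \<eta>) \<le> \<eta> * (of_int \<lfloor>(y \<bullet> b) / \<eta>\<rfloor> + 1)"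
      using assms by (intro mult_left_mono; linarith)+
    ultimately show "\<bar>(grid_point \<eta> y - y) \<bullet> b\<bar> \<le> \<eta>"
      using assms by (simp add: inner_diff_left distrib_left)
  qed
  finally show ?thesis by (simp add: mult.commute)
qed

lemma finite_grid_point_image:
  fixes B :: "'a::euclidean_space set"
  assumes "\<eta> > 0" "bounded B"
  shows "finite (grid_point \<eta> ` B)"
proof -
  obtain R where R: "\<And>y. y \<in> B \<Longrightarrow> norm y \<le> R" using assms(2) by (auto simp: bounded_iff)
  define K where "K = \<lceil>R / \<eta>\<rceil> + 1"
  let ?S = "Pi\<^sub>E (Basis::'a set) (\<lambda>_. {-K..K})"
  have "grid_point \<eta> ` B \<subseteq> (\<lambda>g. \<Sum>b\<in>Basis. (\<eta> * of_int (g b)) *\<^sub>R b) ` ?S"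
  proof
    fix p assume "p \<in> grid_point \<eta> ` B"
    then obtain y where y: "y \<in> B" "p = grid_point \<eta> y" by auto
    have "\<lfloor>(y \<bullet> b) / \<eta>\<rfloor> \<in> {-K..K}" if "b \<in> Basis" for b
    proof -
      have "\<bar>y \<bullet> b\<bar> \<le> R" using Basis_le_norm[OF that, of y] R[OF y(1)] by linarith
      then have "\<bar>(y \<bullet> b) / \<eta>\<bar> \<le> R / \<eta>" using assms(1) by (simp add: divide_right_mono)
      then show ?thesis unfolding K_def by (auto; linarith)
    qed
    then show "p \<in> (\<lambda>g. \<Sum>b\<in>Basis. (\<eta> * of_int (g b)) *\<^sub>R b) ` ?S"
      unfolding y(2) grid_point_def
      by (intro image_eqI[where x="restrict (\<lambda>b. \<lfloor>(y \<bullet> b) / \<eta>\<rfloor>) Basis"] sum.cong) auto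
  qed
  moreover have "finite ?S" by (intro finite_PiE) auto
  ultimately show ?thesis by (meson finite_imageI finite_subset)
qed

lemma sq_int_indicator:
  assumes [measurable]: "S \<in> sets borel" and "emeasure lborel S < \<infinity>"
  shows "sq_int (\<lambda>x. indicator S x * c)"
  by (rule sq_int_bound[where g="\<lambda>x. (norm c)\<^sup>2 * indicator S x"])
     (use assms(2) in \<open>auto split: split_indicator simp: power_mult_distrib norm_mult\<close>)

lemma indicator_mult_integrable:
  assumes S[measurable]: "S \<in> sets borel" and "emeasure lborel S < \<infinity>" and u: "sq_int u"
  shows "integrable lborel (\<lambda>x. indicator S x * u x)"
proof (rule Bochner_Integration.integrable_bound)
  show "integrable lborel (\<lambda>x. norm (indicator S x * 1 :: complex) * norm (u x))"
    by (intro sq_int_mult sq_int_indicator assms)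
  show "(\<lambda>x. indicator S x * u x) \<in> borel_measurable lborel" using u by measurable
qed (auto simp: norm_mult)

lemma emeasure_bounded_lt_top: "bounded S \<Longrightarrow> S \<in> sets borel \<Longrightarrow> emeasure lborel (S :: 'a::euclidean_space set) < \<infinity>"
  using emeasure_bounded_finite by auto

text \<open>Testing against the two real multiples \<open>1\<close> and \<open>\<i>\<close> of an indicator function controls
  the complex integral although the inner product is only the real part.\<close>

lemma integral_eq_0_of_orthogonal:
  assumes S[measurable]: "S \<in> sets borel" and fin: "emeasure lborel S < \<infinity>"
    and orth: "\<And>c. c \<in> {1, \<i>} \<Longrightarrow> u \<bullet> abs_l2 (\<lambda>x. indicator S x * c) = 0"
  shows "(\<integral>x. indicator S x * rep_l2 u x \<partial>lborel) = 0"
proof -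
  have int: "integrable lborel (\<lambda>x. indicator S x * rep_l2 u x)"
    by (intro indicator_mult_integrable fin) simp_all
  have "(\<integral>x. indicator S x * rep_l2 u x \<partial>lborel) \<bullet> c = 0" if "c \<in> {1, \<i>}" for c
  proof -
    have "u \<bullet> abs_l2 (\<lambda>x. indicator S x * c) = (\<integral>x. (indicator S x * rep_l2 u x) \<bullet> c \<partial>lborel)"
      unfolding inner_l2_def
    proof (rule integral_cong_AE)
      show "AE x in lborel. rep_l2 u x \<bullet> rep_l2 (abs_l2 (\<lambda>x. indicator S x * c)) x = (indicator S x * rep_l2 u x) \<bullet> c"
        using rep_abs_l2[OF sq_int_indicator[OF S fin, of c]]
        by eventually_elim (auto split: split_indicator)
    qed measurable
    also have "\<dots> = (\<integral>x. indicator S x * rep_l2 u x \<partial>lborel) \<bullet> c"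
      by (rule integral_inner_left) (use int in simp)
    finally show ?thesis using orth[OF that] by simp
  qed
  from this[of 1] this[of \<i>] show ?thesis by (simp add: inner_complex_def complex_eq_iff)
qed

text \<open>Different cells have disjoint supports, and on a single cell the multipliers 1 and
  \<open>\<i>\<close> are orthogonal for the real inner product.\<close>

lemma cell_indicators_orthogonal:
  assumes S[measurable]: "\<And>p. S p \<in> sets borel" and fin: "\<And>p. emeasure lborel (S p) < \<infinity>"
    and disj: "\<And>p q x. x \<in> S p \<Longrightarrow> x \<in> S q \<Longrightarrow> p = q"
  shows "pairwise orthogonal ((\<lambda>(p, c). abs_l2 (\<lambda>x. indicator (S p) x * c)) ` (P \<times> {1, \<i>}))"
proof -
  have ip: "abs_l2 (\<lambda>x. indicator (S p) x * c) \<bullet> abs_l2 (\<lambda>x. indicator (S q) x * d) = (\<integral>x. (indicator (S p) x * c) \<bullet> (indicator (S q) x * d) \<partial>lborel)" for p q c d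
    unfolding inner_l2_def
  proof (rule integral_cong_AE)
    show "AE x in lborel. rep_l2 (abs_l2 (\<lambda>x. indicator (S p) x * c)) x \<bullet> rep_l2 (abs_l2 (\<lambda>x. indicator (S q) x * d)) x = (indicator (S p) x * c) \<bullet> (indicator (S q) x * d)"
      using rep_abs_l2[OF sq_int_indicator[OF S fin, of p c]] rep_abs_l2[OF sq_int_indicator[OF S fin, of q d]]
      by eventually_elim simp
  qed measurable
  show ?thesis
  proof (rule pairwiseI)
    fix f g assume f: "f \<in> (\<lambda>(p, c). abs_l2 (\<lambda>x. indicator (S p) x * c)) ` (P \<times> {1, \<i>})"
      and g: "g \<in> (\<lambda>(p, c). abs_l2 (\<lambda>x. indicator (S p) x * c)) ` (P \<times> {1, \<i>})" and "f \<noteq> g"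
    obtain p c where f': "c \<in> {1, \<i>}" "f = abs_l2 (\<lambda>x. indicator (S p) x * c)" using f by auto
    obtain q d where g': "d \<in> {1, \<i>}" "g = abs_l2 (\<lambda>x. indicator (S q) x * d)" using g by auto
    have "p \<noteq> q \<or> c \<noteq> d" using \<open>f \<noteq> g\<close> f' g' by auto
    then have "(indicator (S p) x * c) \<bullet> (indicator (S q) x * d) = 0" for x
      using disj[of x p q] f'(1) g'(1) by (auto split: split_indicator simp: inner_complex_def)
    then show "orthogonal f g" by (simp add: orthogonal_def f' g' ip)
  qed
qed

text \<open>The kernel is approximated by one of finite rank. With \<open>g\<close> a truncation of
  \<open>a\<close> and \<open>c y\<close> a grid point near \<open>y\<close>, the cut off kernel is
  \<open>k1 + k2 + indicator B y * g (x - c y)\<close>. Schur's test makes the first two small; the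
  last depends on \<open>y\<close> only through finitely many cells, so it annihilates every vector
  orthogonal to their indicators.\<close>

theorem conv_cutoff_compact:
  fixes a :: "'a::euclidean_space \<Rightarrow> complex"
  assumes a: "integrable lborel a" and B: "bounded B" and [measurable]: "B \<in> sets borel" and \<delta>: "\<delta> > 0"
  shows "\<exists>F. finite F \<and> pairwise orthogonal F \<and> (\<forall>u. (\<forall>f\<in>F. u \<bullet> f = 0) \<longrightarrow>
     norm (kernel_op (\<lambda>x y. a (x - y)) (mult_op (indicator B) u)) \<le> \<delta> * norm u)"
proof -
  have [measurable]: "a \<in> borel_measurable borel" using borel_measurable_integrable[OF a] by simp
  have Bfin: "emeasure lborel B < \<infinity>" by (rule emeasure_bounded_lt_top) (use B in auto)
  \<comment> \<open>Truncation of the values of \<open>a\<close>: the bounded \<open>g\<close>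
    obtained from it gives \<open>k2\<close> bounded rows, at a cost of less than
    \<open>\<delta> / 2\<close> in L1.\<close>
  define a' where "a' M x = (if norm (a x) \<le> real M then a x else 0)" for M x
  have [measurable]: "a' M \<in> borel_measurable borel" for M unfolding a'_def[abs_def] by measurable
  have "(\<lambda>M. \<integral>x. norm (a x - a' M x) \<partial>lborel) \<longlonglongrightarrow> integral\<^sup>L lborel (\<lambda>x::'a. 0::real)"
  proof (rule integral_dominated_convergence[where w="\<lambda>x. norm (a x)"])
    show "AE x in lborel. (\<lambda>M. norm (a x - a' M x)) \<longlonglongrightarrow> 0"
    proof (rule AE_I2)
      fix x
      have "\<forall>\<^sub>F M in sequentially. norm (a x) \<le> real M"
        using filterlim_real_sequentially by (simp add: filterlim_at_top)
      then have "\<forall>\<^sub>F M in sequentially. norm (a x - a' M x) = 0"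
        by eventually_elim (simp add: a'_def)
      then show "(\<lambda>M. norm (a x - a' M x)) \<longlonglongrightarrow> 0" by (rule tendsto_eventually)
    qed
  qed (use a in \<open>auto simp: a'_def\<close>)
  then have "\<forall>\<^sub>F M in sequentially. (\<integral>x. norm (a x - a' M x) \<partial>lborel) < \<delta> / 2"
    using \<delta> by (intro order_tendstoD(2)) auto
  then obtain M where M: "(\<integral>x. norm (a x - a' M x) \<partial>lborel) < \<delta> / 2" by (auto simp: eventually_sequentially)
  define g where "g = a' M"
  have [measurable]: "g \<in> borel_measurable borel" by (simp add: g_def)
  have gM: "norm (g x) \<le> real M" for x by (simp add: g_def a'_def)
  have g: "integrable lborel g"
    by (rule Bochner_Integration.integrable_bound[OF a]) (auto simp: g_def a'_def)
  \<comment> \<open>A row of \<open>k2\<close> is supported in \<open>B\<close> and bounded by twice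
    the level \<open>M\<close>, so its integral is at most \<open>m\<close>. Its columns compare
    \<open>g\<close> with a small translate and are made smaller than \<open>\<omega>\<close>; the
    choice of \<open>\<omega>\<close> gives
    \<open>sqrt (m * \<omega>) \<le> \<delta> / 2\<close>.\<close>
  define m where "m = 2 * real M * measure lborel B"
  have m: "m \<ge> 0" by (simp add: m_def)
  define \<omega> where "\<omega> = (\<delta> / 2)\<^sup>2 / (m + 1)"
  have \<omega>: "\<omega> > 0" "\<omega> * m < (\<delta> / 2)\<^sup>2"
    using divide_succ_mult_less[OF _ m, of "(\<delta> / 2)\<^sup>2"] \<delta> by (auto simp: \<omega>_def)
  obtain d where d: "d > 0" "\<And>t. norm t < d \<Longrightarrow> (\<integral>x. norm (g (x + t) - g x) \<partial>lborel) < \<omega>"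
    using integrable_L1_translation_continuous[OF g] \<omega>(1) unfolding L1_translation_continuous_def by blast
  define \<eta> where "\<eta> = d / (real DIM('a) + 1)"
  have \<eta>: "\<eta> > 0" "\<eta> * DIM('a) < d"
    using divide_succ_mult_less[OF d(1), of "real DIM('a)"] by (auto simp: \<eta>_def)
  define c :: "'a \<Rightarrow> 'a" where "c = grid_point \<eta>"
  have [measurable]: "c \<in> borel_measurable borel" by (simp add: c_def)
  have c: "norm (c y - y) < d" for y
    using norm_diff_grid_point[OF \<eta>(1), of y] \<eta>(2) by (simp add: c_def)
  define k1 where "k1 x y = indicator B y * (a (x - y) - g (x - y))" for x y
  define k2 where "k2 x y = indicator B y * (g (x - y) - g (x - c y))" for x y
  define \<epsilon> where "\<epsilon> = (\<integral>x. norm (a x - g x) \<partial>lborel)"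
  have \<epsilon>: "0 \<le> \<epsilon>" "\<epsilon> < \<delta> / 2" using M by (auto simp: \<epsilon>_def g_def intro: integral_nonneg_AE)
  have nn\<epsilon>: "(\<integral>\<^sup>+x. ennreal (norm (a x - g x)) \<partial>lborel) = ennreal \<epsilon>"
    unfolding \<epsilon>_def using a g by (intro nn_integral_eq_integral) auto
  have k1: "schur_kernel k1 \<epsilon> \<epsilon>"
    unfolding schur_kernel_def
  proof (intro conjI allI \<epsilon>(1))
    show "(\<lambda>(x, y). k1 x y) \<in> borel_measurable (borel \<Otimes>\<^sub>M borel)" unfolding k1_def by measurable
    fix x :: 'a
    have "(\<integral>\<^sup>+y. ennreal (norm (k1 x y)) \<partial>lborel) \<le> (\<integral>\<^sup>+y. ennreal (norm (a (x - y) - g (x - y))) \<partial>lborel)"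
      by (intro nn_integral_mono) (auto simp: k1_def norm_mult split: split_indicator)
    also have "\<dots> = ennreal \<epsilon>"
      unfolding nn\<epsilon>[symmetric] by (rule nn_integral_reflect) measurable
    finally show "(\<integral>\<^sup>+y. ennreal (norm (k1 x y)) \<partial>lborel) \<le> ennreal \<epsilon>" .
    have "(\<integral>\<^sup>+y. ennreal (norm (k1 y x)) \<partial>lborel) \<le> (\<integral>\<^sup>+y. ennreal (norm (a (y + (- x)) - g (y + (- x)))) \<partial>lborel)"
      by (intro nn_integral_mono) (auto simp: k1_def norm_mult split: split_indicator)
    also have "\<dots> = ennreal \<epsilon>"
      unfolding nn\<epsilon>[symmetric] by (rule nn_integral_shift) measurable
    finally show "(\<integral>\<^sup>+y. ennreal (norm (k1 y x)) \<partial>lborel) \<le> ennreal \<epsilon>" .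
  qed
  have k2: "schur_kernel k2 m \<omega>"
    unfolding schur_kernel_def
  proof (intro conjI allI m)
    show "0 \<le> \<omega>" using \<omega> by simp
    show "(\<lambda>(x, y). k2 x y) \<in> borel_measurable (borel \<Otimes>\<^sub>M borel)" unfolding k2_def by measurable
    fix x :: 'a
    have "(\<integral>\<^sup>+y. ennreal (norm (k2 x y)) \<partial>lborel) \<le> (\<integral>\<^sup>+y. ennreal (2 * real M) * indicator B y \<partial>lborel)"
    proof (intro nn_integral_mono)
      fix y
      show "ennreal (norm (k2 x y)) \<le> ennreal (2 * real M) * indicator B y"
        using norm_triangle_ineq4[of "g (x - y)" "g (x - c y)"] gM[of "x - y"] gM[of "x - c y"]
        by (auto simp: k2_def norm_mult split: split_indicator intro!: ennreal_leI)
    qed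
    also have "\<dots> = ennreal (2 * real M) * emeasure lborel B" by (simp add: nn_integral_cmult_indicator)
    also have "\<dots> = ennreal m"
      using Bfin by (simp add: m_def ennreal_mult emeasure_eq_ennreal_measure)
    finally show "(\<integral>\<^sup>+y. ennreal (norm (k2 x y)) \<partial>lborel) \<le> ennreal m" .
    have "(\<integral>\<^sup>+y. ennreal (norm (k2 y x)) \<partial>lborel) \<le> (\<integral>\<^sup>+y. ennreal (norm (g (y - x) - g (y - c x))) \<partial>lborel)"
      by (intro nn_integral_mono) (auto simp: k2_def norm_mult split: split_indicator)
    also have "\<dots> = (\<integral>\<^sup>+y. ennreal (norm (g (y + (c x - x)) - g y)) \<partial>lborel)"
      using nn_integral_shift[of "\<lambda>y. ennreal (norm (g (y - x) - g (y - c x)))" "c x"]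
      by (simp add: algebra_simps)
    also have "\<dots> = ennreal (\<integral>y. norm (g (y + (c x - x)) - g y) \<partial>lborel)"
      using integrable_shift_diff[OF g, of "c x - x"] by (intro nn_integral_eq_integral) auto
    also have "\<dots> \<le> ennreal \<omega>" using d(2)[OF c[of x]] by (intro ennreal_leI) simp
    finally show "(\<integral>\<^sup>+y. ennreal (norm (k2 y x)) \<partial>lborel) \<le> ennreal \<omega>" .
  qed
  define P where "P = c ` B"
  have P: "finite P" unfolding P_def c_def by (rule finite_grid_point_image[OF \<eta>(1) B])
  define S where "S p = B \<inter> c -` {p}" for p
  have S[measurable]: "S p \<in> sets borel" for p
    unfolding S_def using measurable_sets[of c borel borel "{p}"] by (intro sets.Int) auto
  have Sfin: "emeasure lborel (S p) < \<infinity>" for p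
    by (rule le_less_trans[OF emeasure_mono Bfin]) (auto simp: S_def)
  define F where "F = (\<lambda>(p, c). abs_l2 (\<lambda>x. indicator (S p) x * c)) ` (P \<times> {1, \<i>})"
  have "finite F" using P by (simp add: F_def)
  moreover have "pairwise orthogonal F" unfolding F_def
    by (rule cell_indicators_orthogonal[OF S Sfin]) (auto simp: S_def)
  moreover have "norm (kernel_op (\<lambda>x y. a (x - y)) (mult_op (indicator B) u)) \<le> \<delta> * norm u"
    if orth: "\<forall>f\<in>F. u \<bullet> f = 0" for u
  proof -
    have mb: "norm (indicator B x :: complex) \<le> 1" for x by (auto split: split_indicator)
    have Sz: "(\<integral>x. indicator (S p) x * rep_l2 u x \<partial>lborel) = 0" if "p \<in> P" for p
    proof (rule integral_eq_0_of_orthogonal[OF S Sfin])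
      fix e :: complex assume "e \<in> {1, \<i>}"
      then have "abs_l2 (\<lambda>x. indicator (S p) x * e) \<in> F" using that unfolding F_def by (intro image_eqI[where x="(p, e)"]) auto
      with orth show "u \<bullet> abs_l2 (\<lambda>x. indicator (S p) x * e) = 0" by blast
    qed
    have iS: "integrable lborel (\<lambda>y. indicator (S p) y * rep_l2 u y)" for p
      by (intro indicator_mult_integrable Sfin) simp_all
    \<comment> \<open>The finite rank structure: on the cell \<open>S p\<close> the sampled kernel
      is the function \<open>g (x - p)\<close> of \<open>x\<close> alone, so integrating over
      \<open>y\<close> leaves only the integrals of \<open>u\<close> over the cells.\<close>
    have split: "indicator B y * g (x - c y) * rep_l2 u y = (\<Sum>p\<in>P. g (x - p) * (indicator (S p) y * rep_l2 u y))" for x y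
    proof (cases "y \<in> B")
      case True
      then have "(\<Sum>p\<in>P. g (x - p) * (indicator (S p) y * rep_l2 u y)) =
         (\<Sum>p\<in>P. if p = c y then g (x - c y) * rep_l2 u y else 0)"
        by (intro sum.cong) (auto simp: S_def split: split_indicator)
      then show ?thesis using True P by (simp add: P_def)
    next
      case False
      then have "indicator (S p) y = (0::complex)" for p by (auto simp: S_def)
      then show ?thesis using False by simp
    qed
    have "AE x in lborel. rep_l2 (kernel_op (\<lambda>x y. a (x - y)) (mult_op (indicator B) u)) x = rep_l2 (kernel_op k1 u + kernel_op k2 u) x"
      using rep_kernel_op[OF schur_kernel_conv[OF a], of "mult_op (indicator B) u"] rep_kernel_op[OF k1, of u] rep_kernel_op[OF k2, of u]
        rep_plus_l2[of "kernel_op k1 u" "kernel_op k2 u"]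
        schur_AE_integrable[OF k1 sq_int_rep, of u] schur_AE_integrable[OF k2 sq_int_rep, of u]
    proof eventually_elim
      case (elim x)
      have i3: "integrable lborel (\<lambda>y. indicator B y * g (x - c y) * rep_l2 u y)"
        unfolding split by (intro Bochner_Integration.integrable_sum integrable_mult_right iS)
      have z3: "(\<integral>y. indicator B y * g (x - c y) * rep_l2 u y \<partial>lborel) = 0"
        unfolding split by (subst Bochner_Integration.integral_sum) (auto simp: iS Sz)
      have "rep_l2 (kernel_op (\<lambda>x y. a (x - y)) (mult_op (indicator B) u)) x =
         (\<integral>y. (k1 x y * rep_l2 u y + k2 x y * rep_l2 u y) + indicator B y * g (x - c y) * rep_l2 u y \<partial>lborel)"
        unfolding elim(1)
      proof (rule integral_cong_AE)
        show "AE y in lborel. a (x - y) * rep_l2 (mult_op (indicator B) u) y =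
          (k1 x y * rep_l2 u y + k2 x y * rep_l2 u y) + indicator B y * g (x - c y) * rep_l2 u y"
          using rep_mult_op[of "indicator B" 1 u, OF _ mb]
          by (auto elim!: eventually_mono simp: k1_def k2_def algebra_simps)
      qed (simp_all add: k1_def k2_def)
      also have "\<dots> = (\<integral>y. k1 x y * rep_l2 u y \<partial>lborel) + (\<integral>y. k2 x y * rep_l2 u y \<partial>lborel)"
        using elim(5,6) i3 z3 by simp
      finally show ?case using elim by simp
    qed
    then have "kernel_op (\<lambda>x y. a (x - y)) (mult_op (indicator B) u) = kernel_op k1 u + kernel_op k2 u" by (rule l2_eqI)
    then have "norm (kernel_op (\<lambda>x y. a (x - y)) (mult_op (indicator B) u)) \<le> norm (kernel_op k1 u) + norm (kernel_op k2 u)"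
      using norm_triangle_ineq by metis
    also have "norm (kernel_op k1 u) \<le> \<epsilon> * norm u" using norm_kernel_op[OF k1, of u] \<epsilon> by simp
    also have "\<epsilon> * norm u \<le> \<delta> / 2 * norm u" using \<epsilon> by (intro mult_right_mono) auto
    also have "norm (kernel_op k2 u) \<le> sqrt (m * \<omega>) * norm u" by (rule norm_kernel_op[OF k2])
    also have "\<dots> \<le> \<delta> / 2 * norm u"
    proof (rule mult_right_mono[OF _ norm_ge_zero])
      show "sqrt (m * \<omega>) \<le> \<delta> / 2" by (rule real_le_lsqrt) (use \<omega> \<delta> m in \<open>auto simp: mult.commute\<close>)
    qed
    finally show ?thesis by simp
  qed
  ultimately show ?thesis by blast
qed

section \<open>The lower bound for the convolution form\<close>

lemma
  fixes f :: "'a::euclidean_space \<Rightarrow> real \<Rightarrow> 'b::{real_normed_field, banach, second_countable_topology}"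
  assumes f: "\<And>b. b \<in> Basis \<Longrightarrow> integrable lborel (f b)"
  shows integral_lborel_prod: "(\<integral>x. (\<Prod>b\<in>Basis. f b (x \<bullet> b)) \<partial>lborel) = (\<Prod>b\<in>Basis. \<integral>t. f b t \<partial>lborel)"
    and integrable_lborel_prod: "integrable lborel (\<lambda>x. \<Prod>b\<in>Basis. f b (x \<bullet> b))"
proof -
  interpret product_sigma_finite "\<lambda>_::'a. lborel :: real measure" by standard
  have [measurable]: "f b \<in> borel_measurable borel" if "b \<in> Basis" for b
    using borel_measurable_integrable[OF f[OF that]] by simp
  have m1: "(\<lambda>x. \<Prod>b\<in>Basis. f b (x \<bullet> b)) \<in> borel_measurable borel" by measurable
  have m2: "(\<lambda>g. \<Sum>b\<in>Basis. g b *\<^sub>R b) \<in> (\<Pi>\<^sub>M b\<in>(Basis::'a set). lborel) \<rightarrow>\<^sub>M borel" by measurable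
  have e: "(\<Prod>b\<in>Basis. f b ((\<Sum>c\<in>Basis. g c *\<^sub>R c) \<bullet> b)) = (\<Prod>b\<in>(Basis::'a set). f b (g b))" for g
    by (intro prod.cong refl) simp
  show "(\<integral>x. (\<Prod>b\<in>Basis. f b (x \<bullet> b)) \<partial>lborel) = (\<Prod>b\<in>Basis. \<integral>t. f b t \<partial>lborel)"
    by (subst lborel_eq, subst integral_distr[OF m2 m1], subst e) (rule product_integral_prod[OF finite_Basis f])
  show "integrable lborel (\<lambda>x. \<Prod>b\<in>Basis. f b (x \<bullet> b))"
    by (subst lborel_eq, subst integrable_distr_eq[OF m2 m1], subst e) (rule product_integrable_prod[OF finite_Basis f])
qed

lemma borel_measurable_cnj [measurable (raw)]:
  "f \<in> borel_measurable M \<Longrightarrow> (\<lambda>x. cnj (f x)) \<in> borel_measurable M"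
  by (rule measurable_compose[OF _ borel_measurable_continuous_onI]) (auto intro: continuous_intros)

lemma sum_neg_half_squares:
  "(\<Sum>b\<in>Basis. - (x \<bullet> b)\<^sup>2 / 2) = - (norm (x::'a::euclidean_space))\<^sup>2 / 2"
proof -
  have "(norm x)\<^sup>2 = (\<Sum>b\<in>Basis. (x \<bullet> b)\<^sup>2)"
    unfolding power2_norm_eq_inner by (subst euclidean_inner) (simp add: power2_eq_square)
  then show ?thesis by (simp only: sum_negf[symmetric] sum_divide_distrib)
qed

section \<open>Gaussian summation and correlations\<close>

definition gauss :: "'a::euclidean_space \<Rightarrow> real" where
  "gauss x = (\<Prod>b\<in>Basis. std_normal_density (x \<bullet> b))"

lemma gauss_nonneg [simp]: "0 \<le> gauss x"
  by (simp add: gauss_def prod_nonneg)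

lemma gauss_measurable [measurable]: "gauss \<in> borel_measurable borel"
  unfolding gauss_def[abs_def] by measurable

lemma integrable_gauss: "integrable lborel (gauss :: 'a::euclidean_space \<Rightarrow> real)"
  unfolding gauss_def[abs_def] by (rule integrable_lborel_prod) (rule integrable_normal_density, simp)

lemma integral_gauss: "(\<integral>x. gauss (x::'a::euclidean_space) \<partial>lborel) = 1"
  unfolding gauss_def by (subst integral_lborel_prod) (auto intro: integrable_normal_density simp: integral_normal_density)

lemma gauss_exp: "exp (- (norm x)\<^sup>2 / 2) = sqrt (2 * pi) ^ DIM('a) * gauss (x::'a::euclidean_space)"
proof -
  have "gauss x = (\<Prod>b\<in>(Basis::'a set). 1 / sqrt (2 * pi)) * exp (\<Sum>b\<in>(Basis::'a set). - (x \<bullet> b)\<^sup>2 / 2)"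
    by (simp only: gauss_def std_normal_density_def prod.distrib exp_sum[OF finite_Basis])
  also note sum_neg_half_squares
  finally show ?thesis by (simp add: power_one_over[symmetric] power_mult_distrib[symmetric])
qed

text \<open>The integral factors over the coordinates, and each factor is the characteristic
  function of the standard normal distribution.\<close>

lemma gauss_character_integral:
  fixes s :: "'a::euclidean_space"
  shows "(\<integral>x. of_real (gauss x) * exp (- \<i> * of_real (x \<bullet> s)) \<partial>lborel) = complex_of_real (exp (- (norm s)\<^sup>2 / 2))"
proof -
  let ?f = "\<lambda>b t. complex_of_real (std_normal_density t) * exp (- \<i> * of_real (t * (s \<bullet> b)))"
  have int: "integrable lborel (?f b)" for b :: 'a
    by (rule Bochner_Integration.integrable_bound[OF integrable_normal_density[of 1 0]]) (auto simp: norm_mult)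
  have "of_real (gauss x) * exp (- \<i> * of_real (x \<bullet> s)) = (\<Prod>b\<in>Basis. ?f b (x \<bullet> b))" for x
  proof -
    have "- \<i> * of_real (x \<bullet> s) = (\<Sum>b\<in>(Basis::'a set). - \<i> * of_real ((x \<bullet> b) * (s \<bullet> b)))"
      by (subst euclidean_inner) (simp add: sum_distrib_left sum_negf)
    then show ?thesis by (simp only: exp_sum[OF finite_Basis] gauss_def of_real_prod prod.distrib)
  qed
  then have "(\<integral>x. of_real (gauss x) * exp (- \<i> * of_real (x \<bullet> s)) \<partial>lborel) = (\<Prod>b\<in>Basis. \<integral>t. ?f b t \<partial>lborel)"
    by (simp only: integral_lborel_prod[OF int])
  also have "\<dots> = (\<Prod>b\<in>Basis. complex_of_real (exp (- (s \<bullet> b)\<^sup>2 / 2)))"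
  proof (intro prod.cong refl)
    fix b :: 'a
    have "(\<integral>t. ?f b t \<partial>lborel) = (\<integral>t. std_normal_density t *\<^sub>R exp (\<i> * of_real ((- (s \<bullet> b)) * t)) \<partial>lborel)"
      by (intro Bochner_Integration.integral_cong refl) (simp add: scaleR_conv_of_real mult_ac)
    also have "\<dots> = char std_normal_distribution (- (s \<bullet> b))"
      unfolding char_def by (subst integral_density) auto
    also have "\<dots> = complex_of_real (exp (- (s \<bullet> b)\<^sup>2 / 2))" by (simp add: char_std_normal_distribution)
    finally show "(\<integral>t. ?f b t \<partial>lborel) = complex_of_real (exp (- (s \<bullet> b)\<^sup>2 / 2))" .
  qed
  also have "\<dots> = complex_of_real (exp (\<Sum>b\<in>(Basis::'a set). - (s \<bullet> b)\<^sup>2 / 2))"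
    by (simp only: exp_sum[OF finite_Basis] of_real_prod)
  also note sum_neg_half_squares
  finally show ?thesis .
qed

lemma integral_affine:
  fixes h :: "'a::euclidean_space \<Rightarrow> complex"
  assumes [measurable]: "h \<in> borel_measurable borel" and c: "c \<noteq> 0"
  shows "(\<integral>x. h x \<partial>lborel) = of_real (\<bar>c\<bar> ^ DIM('a)) * (\<integral>x. h (c *\<^sub>R x) \<partial>lborel)"
proof -
  have "(\<integral>x. h x \<partial>lborel) = (\<integral>x. h x \<partial>density (distr lborel borel (\<lambda>x. 0 + c *\<^sub>R x)) (\<lambda>_. \<bar>c\<bar>^DIM('a)))"
    by (subst lborel_affine[OF c, of 0]) simp
  also have "\<dots> = (\<integral>x. \<bar>c\<bar>^DIM('a) *\<^sub>R h x \<partial>distr lborel borel (\<lambda>x. 0 + c *\<^sub>R x))"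
    by (subst integral_density) auto
  also have "\<dots> = (\<integral>x. \<bar>c\<bar>^DIM('a) *\<^sub>R h (c *\<^sub>R x) \<partial>lborel)"
    by (subst integral_distr) auto
  finally show ?thesis by (simp add: scaleR_conv_of_real)
qed

text \<open>The cross-correlation. Its value at 0 is the complex inner product of \<open>f\<close>
  and \<open>w\<close>, and its transform is \<open>ft f\<close> times the conjugate of
  \<open>ft w\<close>, so Fourier inversion at 0 plays the part of Parseval's identity.\<close>

definition corr :: "('a::euclidean_space \<Rightarrow> complex) \<Rightarrow> ('a \<Rightarrow> complex) \<Rightarrow> 'a \<Rightarrow> complex" where
  "corr f w s = (\<integral>x. f (x + s) * cnj (w x) \<partial>lborel)"

context
  fixes f w :: "'a::euclidean_space \<Rightarrow> complex"
  assumes f: "integrable lborel f" and w: "integrable lborel w"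
begin

lemma corr_factors_measurable [measurable]: "f \<in> borel_measurable borel" "w \<in> borel_measurable borel"
  using borel_measurable_integrable[OF f] borel_measurable_integrable[OF w] by simp_all

lemma corr_pair_integrable:
  assumes [measurable]: "g \<in> borel_measurable borel" and g: "\<And>s. norm (g s) \<le> 1"
  shows "integrable (lborel \<Otimes>\<^sub>M lborel) (\<lambda>(x, s). f (x + s) * cnj (w x) * g s)"
proof (rule lborel_pair.Fubini_integrable)
  show "(\<lambda>(x, s). f (x + s) * cnj (w x) * g s) \<in> borel_measurable (lborel \<Otimes>\<^sub>M lborel)" by measurable
  have fx: "integrable lborel (\<lambda>s. f (x + s))" for x
    using integrable_shift[of f x] f by (simp add: add.commute)
  have i1: "integrable lborel (\<lambda>s. f (x + s) * cnj (w x) * g s)" for x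
    by (rule Bochner_Integration.integrable_bound[of _ "\<lambda>s. f (x + s) * cnj (w x)"])
       (use fx g in \<open>auto simp: norm_mult mult_left_le\<close>)
  then show "AE x in lborel. integrable lborel (\<lambda>s. case (x, s) of (x, s) \<Rightarrow> f (x + s) * cnj (w x) * g s)" by auto
  show "integrable lborel (\<lambda>x. \<integral>s. norm (case (x, s) of (x, s) \<Rightarrow> f (x + s) * cnj (w x) * g s) \<partial>lborel)"
  proof (rule Bochner_Integration.integrable_bound)
    show "integrable lborel (\<lambda>x. (\<integral>s. norm (f s) \<partial>lborel) * norm (w x))" using w by auto
    show "AE x in lborel. norm (\<integral>s. norm (case (x, s) of (x, s) \<Rightarrow> f (x + s) * cnj (w x) * g s) \<partial>lborel)
       \<le> norm ((\<integral>s. norm (f s) \<partial>lborel) * norm (w x))"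
    proof (rule AE_I2)
      fix x
      have "(\<integral>s. norm (f (x + s) * cnj (w x) * g s) \<partial>lborel) \<le> (\<integral>s. norm (f (x + s)) * norm (w x) \<partial>lborel)"
        using integrable_norm[OF i1[of x]] fx[of x] g
        by (intro integral_mono) (auto simp: norm_mult mult_left_le simp del: integrable_mult_right_iff)
      also have "\<dots> = (\<integral>s. norm (f s) \<partial>lborel) * norm (w x)"
        using integral_shift[of "\<lambda>s. norm (f s)" x] by (simp add: add.commute)
      finally show "norm (\<integral>s. norm (case (x, s) of (x, s) \<Rightarrow> f (x + s) * cnj (w x) * g s) \<partial>lborel)
         \<le> norm ((\<integral>s. norm (f s) \<partial>lborel) * norm (w x))"
        by (simp add: integral_nonneg_AE)
    qed
  qed measurable
qed

lemma integrable_corr: "integrable lborel (corr f w)"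
  using lborel_pair.integrable_snd[OF corr_pair_integrable[of "\<lambda>_. 1"]] by (simp add: corr_def[abs_def])

lemma ft_corr: "ft (corr f w) \<xi> = ft f \<xi> * cnj (ft w \<xi>)"
proof -
  let ?g = "\<lambda>s. exp (- \<i> * of_real (\<xi> \<bullet> s))"
  have "ft (corr f w) \<xi> = (\<integral>s. (\<integral>x. f (x + s) * cnj (w x) * ?g s \<partial>lborel) \<partial>lborel)"
    unfolding ft_def corr_def by simp
  also have "\<dots> = (\<integral>x. (\<integral>s. f (x + s) * cnj (w x) * ?g s \<partial>lborel) \<partial>lborel)"
    using lborel_pair.Fubini_integral[OF corr_pair_integrable[of ?g]] by simp
  also have "\<dots> = (\<integral>x. ft f \<xi> * cnj (w x * ?g x) \<partial>lborel)"
  proof (intro Bochner_Integration.integral_cong refl)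
    fix x
    have "(\<integral>s. f (x + s) * cnj (w x) * ?g s \<partial>lborel) = (\<integral>s. f (s + x) * ?g (s + x) * cnj (w x * ?g x) \<partial>lborel)"
      by (intro Bochner_Integration.integral_cong refl)
         (simp add: exp_cnj inner_add_right algebra_simps exp_diff exp_minus)
    also have "\<dots> = (\<integral>s. f (s + x) * ?g (s + x) \<partial>lborel) * cnj (w x * ?g x)" by simp
    also have "(\<integral>s. f (s + x) * ?g (s + x) \<partial>lborel) = ft f \<xi>"
      unfolding ft_def by (rule integral_shift) measurable
    finally show "(\<integral>s. f (x + s) * cnj (w x) * ?g s \<partial>lborel) = ft f \<xi> * cnj (w x * ?g x)" .
  qed
  also have "\<dots> = ft f \<xi> * cnj (ft w \<xi>)"
    unfolding ft_def by (simp only: Bochner_Integration.integral_cnj integral_mult_right_zero)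
  finally show ?thesis .
qed

text \<open>Boundedness of \<open>w\<close> turns the L1 continuity of translations of
  \<open>f\<close> into continuity of the correlation, and bounds the correlation itself. Inversion
  at 0 asks for both.\<close>

lemma corr_diff_le:
  assumes M: "\<And>x. norm (w x) \<le> M"
  shows "norm (corr f w s - corr f w t) \<le> M * (\<integral>x. norm (f (x + (s - t)) - f x) \<partial>lborel)"
    and "norm (corr f w s) \<le> M * (\<integral>x. norm (f x) \<partial>lborel)"
proof -
  have ft: "integrable lborel (\<lambda>x. f (x + t))" for t
    using integrable_shift[of f t] f by simp
  have i: "integrable lborel (\<lambda>x. f (x + t) * cnj (w x))" for t
    by (rule Bochner_Integration.integrable_bound[of _ "\<lambda>x. M * norm (f (x + t))"])
       (use ft[of t] M order_trans[OF norm_ge_zero M] in \<open>auto simp: norm_mult mult.commute[of M] intro!: mult_left_mono\<close>)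
  have "norm (corr f w s) \<le> (\<integral>x. norm (f (x + s) * cnj (w x)) \<partial>lborel)"
    unfolding corr_def by (rule integral_norm_bound)
  also have "\<dots> \<le> (\<integral>x. M * norm (f (x + s)) \<partial>lborel)"
    using integrable_norm[OF i[of s]] ft[of s] M
    by (intro integral_mono) (auto simp: norm_mult mult.commute[of M] intro!: mult_left_mono)
  also have "\<dots> = M * (\<integral>x. norm (f x) \<partial>lborel)"
    using integral_shift[of "\<lambda>x. norm (f x)" s] by simp
  finally show "norm (corr f w s) \<le> M * (\<integral>x. norm (f x) \<partial>lborel)" .
  have "norm (corr f w s - corr f w t) = norm (\<integral>x. (f (x + s) - f (x + t)) * cnj (w x) \<partial>lborel)"
    unfolding corr_def using i by (simp add: left_diff_distrib)
  also have "\<dots> \<le> (\<integral>x. norm ((f (x + s) - f (x + t)) * cnj (w x)) \<partial>lborel)" by (rule integral_norm_bound)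
  also have "\<dots> \<le> (\<integral>x. M * norm (f (x + s) - f (x + t)) \<partial>lborel)"
  proof (rule integral_mono)
    show "integrable lborel (\<lambda>x. norm ((f (x + s) - f (x + t)) * cnj (w x)))"
      using Bochner_Integration.integrable_diff[OF i[of s] i[of t]] by (simp add: left_diff_distrib)
  qed (use ft M in \<open>auto simp: norm_mult mult.commute[of M] intro!: mult_left_mono\<close>)
  also have "\<dots> = M * (\<integral>x. norm (f (x + (s - t)) - f x) \<partial>lborel)"
    using integral_shift[of "\<lambda>x. norm (f (x + (s - t)) - f x)" t] by (simp add: algebra_simps)
  finally show "norm (corr f w s - corr f w t) \<le> M * (\<integral>x. norm (f (x + (s - t)) - f x) \<partial>lborel)" .
qed

end

text \<open>Fubini moves the transform from \<open>B\<close> to the Gaussian, which is its own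
  transform up to a factor; rescaling the variable then turns a wide Gaussian in frequency into
  averages of \<open>B\<close> at scale \<open>1 / c\<close>.\<close>

lemma gauss_ft_integral:
  fixes B :: "'a::euclidean_space \<Rightarrow> complex"
  assumes B: "integrable lborel B" and c: "c > 0"
  shows "of_real (c ^ DIM('a)) * (\<integral>\<zeta>. of_real (gauss \<zeta>) * ft B (c *\<^sub>R \<zeta>) \<partial>lborel) =
     of_real (sqrt (2 * pi) ^ DIM('a)) * (\<integral>t. of_real (gauss t) * B ((1 / c) *\<^sub>R t) \<partial>lborel)"
proof -
  have [measurable]: "B \<in> borel_measurable borel" using borel_measurable_integrable[OF B] by simp
  let ?E = "\<lambda>\<zeta> s. exp (- \<i> * of_real ((c *\<^sub>R \<zeta>) \<bullet> s))"
  have pair: "integrable (lborel \<Otimes>\<^sub>M lborel) (\<lambda>(\<zeta>::'a, s). of_real (gauss \<zeta>) * (B s * ?E \<zeta> s))"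
  proof (rule lborel_pair.Fubini_integrable)
    show "(\<lambda>(\<zeta>, s). of_real (gauss \<zeta>) * (B s * ?E \<zeta> s)) \<in> borel_measurable (lborel \<Otimes>\<^sub>M lborel)" by measurable
    show "AE \<zeta> in lborel. integrable lborel (\<lambda>s. case (\<zeta>, s) of (\<zeta>, s) \<Rightarrow> of_real (gauss \<zeta>) * (B s * ?E \<zeta> s))"
      by (rule AE_I2, simp only: prod.case, intro integrable_mult_right integrable_ft B)
    show "integrable lborel (\<lambda>\<zeta>. \<integral>s. norm (case (\<zeta>, s) of (\<zeta>, s) \<Rightarrow> of_real (gauss \<zeta>) * (B s * ?E \<zeta> s)) \<partial>lborel)"
      using integrable_mult_left[OF integrable_gauss, of "\<integral>s. norm (B s) \<partial>lborel"]
      by (simp add: norm_mult)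
  qed
  have "(\<integral>\<zeta>. of_real (gauss \<zeta>) * ft B (c *\<^sub>R \<zeta>) \<partial>lborel) = (\<integral>\<zeta>. (\<integral>s. of_real (gauss \<zeta>) * (B s * ?E \<zeta> s) \<partial>lborel) \<partial>lborel)"
    unfolding ft_def by simp
  also have "\<dots> = (\<integral>s. (\<integral>\<zeta>. of_real (gauss \<zeta>) * (B s * ?E \<zeta> s) \<partial>lborel) \<partial>lborel)"
    by (rule lborel_pair.Fubini_integral[OF pair, symmetric])
  also have "\<dots> = (\<integral>s. B s * of_real (sqrt (2 * pi) ^ DIM('a) * gauss (c *\<^sub>R s)) \<partial>lborel)"
  proof (intro Bochner_Integration.integral_cong refl)
    fix s
    have "(\<integral>\<zeta>. of_real (gauss \<zeta>) * (B s * ?E \<zeta> s) \<partial>lborel) = B s * (\<integral>\<zeta>. of_real (gauss \<zeta>) * exp (- \<i> * of_real (\<zeta> \<bullet> (c *\<^sub>R s))) \<partial>lborel)"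
      by (subst integral_mult_right_zero[symmetric]) (simp add: mult_ac)
    then show "(\<integral>\<zeta>. of_real (gauss \<zeta>) * (B s * ?E \<zeta> s) \<partial>lborel) = B s * of_real (sqrt (2 * pi) ^ DIM('a) * gauss (c *\<^sub>R s))"
      by (simp only: gauss_character_integral gauss_exp)
  qed
  also have "\<dots> = of_real ((1 / c) ^ DIM('a)) * (\<integral>t. B ((1 / c) *\<^sub>R t) * of_real (sqrt (2 * pi) ^ DIM('a) * gauss t) \<partial>lborel)"
    by (subst integral_affine[of _ "1 / c"]) (use c in auto)
  also have "(\<integral>t. B ((1 / c) *\<^sub>R t) * of_real (sqrt (2 * pi) ^ DIM('a) * gauss t) \<partial>lborel) =
     of_real (sqrt (2 * pi) ^ DIM('a)) * (\<integral>t. of_real (gauss t) * B ((1 / c) *\<^sub>R t) \<partial>lborel)"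
    by (subst integral_mult_right_zero[symmetric]) (simp add: mult_ac)
  finally show ?thesis using c
    by (simp add: mult.assoc[symmetric] of_real_mult[symmetric] power_mult_distrib[symmetric] del: of_real_mult of_real_power)
qed

text \<open>After the change of variables the left-hand side integrates \<open>ft B\<close> against
  a Gaussian of width n + 1. By the preceding identity it is an average of \<open>B\<close>
  concentrating at 0, where dominated convergence applies.\<close>

lemma gauss_inversion:
  fixes B :: "'a::euclidean_space \<Rightarrow> complex"
  assumes B: "integrable lborel B" and bd: "\<And>s. norm (B s) \<le> K" and lim: "(B \<longlongrightarrow> B 0) (at 0)"
  shows "(\<lambda>n. of_real (real (Suc n) ^ DIM('a)) * (\<integral>\<zeta>. of_real (gauss \<zeta>) * ft B (real (Suc n) *\<^sub>R \<zeta>) \<partial>lborel))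
     \<longlonglongrightarrow> of_real (sqrt (2 * pi) ^ DIM('a)) * B 0"
proof -
  have [measurable]: "B \<in> borel_measurable borel" using borel_measurable_integrable[OF B] by simp
  have "(\<lambda>n. (\<integral>t. of_real (gauss t) * B ((1 / real (Suc n)) *\<^sub>R t) \<partial>lborel)) \<longlonglongrightarrow> (\<integral>t. of_real (gauss (t::'a)) * B 0 \<partial>lborel)"
  proof (rule integral_dominated_convergence[where w="\<lambda>t::'a. K * gauss t"])
    show "integrable lborel (\<lambda>t::'a. K * gauss t)" using integrable_gauss by auto
    show "AE t in lborel. (\<lambda>n. of_real (gauss t) * B ((1 / real (Suc n)) *\<^sub>R t)) \<longlonglongrightarrow> of_real (gauss t) * B 0"
    proof (rule AE_I2, rule tendsto_mult_left)
      fix t :: 'a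
      have B': "isCont B 0" using lim by (simp add: isCont_def)
      have "(\<lambda>n. (1 / real (Suc n)) *\<^sub>R t) \<longlonglongrightarrow> 0 *\<^sub>R t"
        by (intro tendsto_scaleR tendsto_const LIMSEQ_Suc[OF lim_1_over_n])
      then have "(\<lambda>n. (1 / real (Suc n)) *\<^sub>R t) \<longlonglongrightarrow> 0" by simp
      then show "(\<lambda>n. B ((1 / real (Suc n)) *\<^sub>R t)) \<longlonglongrightarrow> B 0" by (rule isCont_tendsto_compose[OF B'])
    qed
    show "AE t in lborel. norm (of_real (gauss t) * B ((1 / real (Suc n)) *\<^sub>R t)) \<le> K * gauss t" for n
      using bd by (auto simp: norm_mult mult.commute[of K] intro!: AE_I2 mult_left_mono)
  qed measurable
  also have "(\<integral>t. of_real (gauss (t::'a)) * B 0 \<partial>lborel) = of_real (\<integral>t. gauss (t::'a) \<partial>lborel) * B 0"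
    by (simp only: integral_mult_left_zero integral_complex_of_real)
  finally have "(\<lambda>n. (\<integral>t. of_real (gauss t) * B ((1 / real (Suc n)) *\<^sub>R t) \<partial>lborel)) \<longlonglongrightarrow> B 0"
    by (simp add: integral_gauss)
  from tendsto_mult_left[OF this, of "of_real (sqrt (2 * pi) ^ DIM('a))"]
  show ?thesis by (subst gauss_ft_integral[OF B]) auto
qed

lemma corr_tendsto:
  assumes f: "integrable lborel f" and w: "integrable lborel w" and M: "\<And>x. norm (w x) \<le> M"
  shows "(corr f w \<longlongrightarrow> corr f w 0) (at 0)"
proof (rule LIM_I)
  fix e :: real assume e: "e > 0"
  have M0: "M \<ge> 0" using order_trans[OF norm_ge_zero M] .
  define e' where "e' = e / (M + 1)"
  have e': "e' > 0" "e' * M < e" using divide_succ_mult_less[OF e M0] by (auto simp: e'_def)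
  obtain d where d: "d > 0" "\<And>t. norm t < d \<Longrightarrow> (\<integral>x. norm (f (x + t) - f x) \<partial>lborel) < e'"
    using integrable_L1_translation_continuous[OF f] e'(1) unfolding L1_translation_continuous_def by blast
  have "norm (corr f w s - corr f w 0) < e" if "norm s < d" for s
  proof -
    have "norm (corr f w s - corr f w 0) \<le> M * (\<integral>x. norm (f (x + (s - 0)) - f x) \<partial>lborel)"
      by (rule corr_diff_le(1)[OF f w M])
    also have "\<dots> \<le> M * e'" using d(2)[OF that] M0 by (intro mult_left_mono) auto
    finally show ?thesis using e'(2) by (simp add: mult.commute)
  qed
  with d(1) show "\<exists>d>0. \<forall>s. s \<noteq> 0 \<and> norm (s - 0) < d \<longrightarrow> norm (corr f w s - corr f w 0) < e" by auto
qed

text \<open>The form is the correlation at 0 of the convolution of \<open>a\<close> and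
  \<open>w\<close> with \<open>w\<close>, and the transform of that correlation is
  \<open>ft a\<close> times the squared modulus of \<open>ft w\<close>. Hence the pointwise bound
  \<open>m \<le> Re (ft a \<xi>)\<close> gives an inequality between the Gaussian integrals of two
  transforms, and the limit turns it into one between the values at 0.\<close>

lemma conv_form_lower_bound_bounded:
  fixes a w :: "'a::euclidean_space \<Rightarrow> complex"
  assumes a: "integrable lborel a" and w: "integrable lborel w" and M: "\<And>x. norm (w x) \<le> M"
    and low: "\<And>\<xi>. m \<le> Re (ft a \<xi>)"
  shows "m * (\<integral>x. (norm (w x))\<^sup>2 \<partial>lborel) \<le> Re (\<integral>x. (\<integral>y. a (x - y) * w y \<partial>lborel) * cnj (w x) \<partial>lborel)"
proof -
  have [measurable]: "a \<in> borel_measurable borel" "w \<in> borel_measurable borel"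
    using borel_measurable_integrable[OF a] borel_measurable_integrable[OF w] by simp_all
  \<comment> \<open>The reflected conjugate makes the convolution of \<open>a\<close> with
    \<open>w\<close> itself a correlation, \<open>corr a w'\<close>, so the formula for the
    transform of a correlation can be applied twice.\<close>
  define w' where "w' x = cnj (w (- x))" for x
  have w': "integrable lborel w'"
    using integrable_reflect[of "\<lambda>x. cnj (w x)" 0] w by (simp add: w'_def[abs_def])
  define f where "f = corr a w'"
  have f: "integrable lborel f" unfolding f_def by (rule integrable_corr[OF a w'])
  have fc: "f x = (\<integral>y. a (x - y) * w y \<partial>lborel)" for x
    using integral_reflect[of "\<lambda>y. a (x - y) * w y" 0] by (simp add: f_def corr_def w'_def add.commute)
  have ftw': "ft w' \<xi> = cnj (ft w \<xi>)" for \<xi>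
  proof -
    have "ft w' \<xi> = (\<integral>x. w' (0 - x) * exp (- \<i> * of_real (\<xi> \<bullet> (0 - x))) \<partial>lborel)"
      unfolding ft_def by (rule integral_reflect[symmetric]) (simp add: w'_def[abs_def])
    also have "\<dots> = (\<integral>x. cnj (w x * exp (- \<i> * of_real (\<xi> \<bullet> x))) \<partial>lborel)"
      by (simp add: w'_def exp_cnj)
    finally show ?thesis by (simp only: ft_def Bochner_Integration.integral_cnj)
  qed
  let ?N = "\<lambda>n. real (Suc n)"
  let ?I = "\<lambda>B n. of_real (?N n ^ DIM('a)) * (\<integral>\<zeta>. of_real (gauss \<zeta>) * ft B (?N n *\<^sub>R \<zeta>) \<partial>lborel)"
  have 1: "?I (corr f w) \<longlonglongrightarrow> of_real (sqrt (2 * pi) ^ DIM('a)) * corr f w 0"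
    by (rule gauss_inversion[OF integrable_corr[OF f w] corr_diff_le(2)[OF f w M] corr_tendsto[OF f w M]])
  have 2: "?I (corr w w) \<longlonglongrightarrow> of_real (sqrt (2 * pi) ^ DIM('a)) * corr w w 0"
    by (rule gauss_inversion[OF integrable_corr[OF w w] corr_diff_le(2)[OF w w M] corr_tendsto[OF w w M]])
  have gi: "integrable lborel (\<lambda>\<zeta>::'a. of_real (gauss \<zeta>) * ft B (c *\<^sub>R \<zeta>))" if "integrable lborel B" for B :: "'a \<Rightarrow> complex" and c
  proof (rule Bochner_Integration.integrable_bound)
    have [measurable]: "B \<in> borel_measurable borel" using borel_measurable_integrable[OF that] by simp
    show "integrable lborel (\<lambda>\<zeta>::'a. (\<integral>x. norm (B x) \<partial>lborel) * gauss \<zeta>)" using integrable_gauss by auto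
    show "(\<lambda>\<zeta>::'a. of_real (gauss \<zeta>) * ft B (c *\<^sub>R \<zeta>)) \<in> borel_measurable lborel" by measurable
    show "AE \<zeta> in lborel. norm (of_real (gauss \<zeta>) * ft B (c *\<^sub>R \<zeta>)) \<le> norm ((\<integral>x. norm (B x) \<partial>lborel) * gauss \<zeta>)"
      using norm_ft_le[of B] by (auto simp: norm_mult mult.commute intro!: mult_left_mono)
  qed
  have Re_of_real_mult: "Re (of_real c * z) = c * Re z" for c z by simp
  have Re_I: "Re (?I B n) = ?N n ^ DIM('a) * (\<integral>\<zeta>. gauss \<zeta> * Re (ft B (?N n *\<^sub>R \<zeta>)) \<partial>lborel)"
    if "integrable lborel B" for B :: "'a \<Rightarrow> complex" and n
  proof -
    have "Re (?I B n) = ?N n ^ DIM('a) * Re (\<integral>\<zeta>. of_real (gauss \<zeta>) * ft B (?N n *\<^sub>R \<zeta>) \<partial>lborel)"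
      using Re_of_real_mult .
    also have "Re (\<integral>\<zeta>. of_real (gauss \<zeta>) * ft B (?N n *\<^sub>R \<zeta>) \<partial>lborel) = (\<integral>\<zeta>. Re (of_real (gauss \<zeta>) * ft B (?N n *\<^sub>R \<zeta>)) \<partial>lborel)"
      by (rule integral_Re[symmetric, OF gi[OF that]])
    finally show ?thesis by simp
  qed
  have giR: "integrable lborel (\<lambda>\<zeta>::'a. gauss \<zeta> * Re (ft B (c *\<^sub>R \<zeta>)))" if "integrable lborel B" for B :: "'a \<Rightarrow> complex" and c
    using integrable_Re[OF gi[OF that, of c]] by simp
  have le: "m * Re (?I (corr w w) n) \<le> Re (?I (corr f w) n)" for n
  proof -
    have "m * (\<integral>\<zeta>. gauss \<zeta> * Re (ft (corr w w) (?N n *\<^sub>R \<zeta>)) \<partial>lborel) = (\<integral>\<zeta>. m * (gauss \<zeta> * Re (ft (corr w w) (?N n *\<^sub>R \<zeta>))) \<partial>lborel)"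
      by simp
    also have "\<dots> \<le> (\<integral>\<zeta>. gauss \<zeta> * Re (ft (corr f w) (?N n *\<^sub>R \<zeta>)) \<partial>lborel)"
    proof (rule integral_mono)
      show "integrable lborel (\<lambda>\<zeta>. m * (gauss \<zeta> * Re (ft (corr w w) (?N n *\<^sub>R \<zeta>))))"
        by (intro integrable_mult_right giR integrable_corr w)
      show "integrable lborel (\<lambda>\<zeta>. gauss \<zeta> * Re (ft (corr f w) (?N n *\<^sub>R \<zeta>)))"
        by (intro giR integrable_corr f w)
      fix \<zeta> :: 'a
      let ?\<xi> = "?N n *\<^sub>R \<zeta>"
      have ww: "ft (corr w w) ?\<xi> = of_real ((norm (ft w ?\<xi>))\<^sup>2)"
        by (simp only: ft_corr[OF w w] complex_norm_square)
      have "ft (corr f w) ?\<xi> = ft a ?\<xi> * of_real ((norm (ft w ?\<xi>))\<^sup>2)"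
        unfolding ft_corr[OF f w]
        by (simp only: f_def ft_corr[OF a w'] ftw' complex_cnj_cnj complex_norm_square mult.assoc)
      then have fw: "Re (ft (corr f w) ?\<xi>) = Re (ft a ?\<xi>) * (norm (ft w ?\<xi>))\<^sup>2" by simp
      have "m * (norm (ft w ?\<xi>))\<^sup>2 \<le> Re (ft a ?\<xi>) * (norm (ft w ?\<xi>))\<^sup>2"
        by (intro mult_right_mono low) simp
      from mult_left_mono[OF this gauss_nonneg[of \<zeta>]]
      show "m * (gauss \<zeta> * Re (ft (corr w w) ?\<xi>)) \<le> gauss \<zeta> * Re (ft (corr f w) ?\<xi>)"
        by (simp only: ww fw Re_complex_of_real mult.left_commute)
    qed
    finally have "?N n ^ DIM('a) * (m * (\<integral>\<zeta>. gauss \<zeta> * Re (ft (corr w w) (?N n *\<^sub>R \<zeta>)) \<partial>lborel)) \<le>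
       ?N n ^ DIM('a) * (\<integral>\<zeta>. gauss \<zeta> * Re (ft (corr f w) (?N n *\<^sub>R \<zeta>)) \<partial>lborel)"
      by (intro mult_left_mono) auto
    then show ?thesis by (simp only: Re_I[OF integrable_corr[OF w w]] Re_I[OF integrable_corr[OF f w]] mult.left_commute)
  qed
  have "m * Re (of_real (sqrt (2 * pi) ^ DIM('a)) * corr w w 0) \<le> Re (of_real (sqrt (2 * pi) ^ DIM('a)) * corr f w 0)"
    by (rule LIMSEQ_le[OF tendsto_mult_left[OF tendsto_Re[OF 2]] tendsto_Re[OF 1]]) (use le in blast)
  then have "sqrt (2 * pi) ^ DIM('a) * (m * Re (corr w w 0)) \<le> sqrt (2 * pi) ^ DIM('a) * Re (corr f w 0)"
    by (simp add: mult.left_commute del: of_real_power)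
  then have "m * Re (corr w w 0) \<le> Re (corr f w 0)" by (subst (asm) mult_le_cancel_left_pos) auto
  moreover have "corr w w 0 = of_real (\<integral>x. (norm (w x))\<^sup>2 \<partial>lborel)"
    by (simp only: corr_def add_0_right complex_norm_square[symmetric] integral_complex_of_real)
  moreover have "corr f w 0 = (\<integral>x. (\<integral>y. a (x - y) * w y \<partial>lborel) * cnj (w x) \<partial>lborel)"
    by (simp add: corr_def fc)
  ultimately show ?thesis by simp
qed

text \<open>Truncations of \<open>u\<close> converge to \<open>u\<close> in L2, and both sides are
  continuous there because the operator is bounded.\<close>

theorem conv_form_lower_bound:
  fixes a :: "'a::euclidean_space \<Rightarrow> complex"
  assumes a: "integrable lborel a" and low: "\<And>\<xi>. m \<le> Re (ft a \<xi>)"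
  shows "m * (u \<bullet> u) \<le> kernel_op (\<lambda>x y. a (x - y)) u \<bullet> u"
proof -
  let ?A = "kernel_op (\<lambda>x y. a (x - y))"
  interpret A: bounded_linear ?A by (rule bounded_linear_kernel_op[OF schur_kernel_conv[OF a]])
  \<comment> \<open>Cutting off in space as well as in size makes the truncated function both
    integrable and bounded, as the previous bound demands.\<close>
  define S where "S n = {x. norm x \<le> real n \<and> norm (rep_l2 u x) \<le> real n}" for n
  have S[measurable]: "S n \<in> sets borel" for n unfolding S_def by measurable
  have fin: "emeasure lborel (S n) < \<infinity>" for n
    by (rule emeasure_bounded_lt_top) (auto simp: S_def intro: bounded_subset[OF bounded_cball[of 0 "real n"]])
  have mb: "norm (indicator (S n) x :: complex) \<le> 1" for n x by (auto split: split_indicator)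
  define w where "w n = mult_op (indicator (S n)) u" for n
  define W where "W n x = indicator (S n) x * rep_l2 u x" for n x
  have W[measurable]: "W n \<in> borel_measurable borel" for n unfolding W_def[abs_def] by measurable
  have rw: "AE x in lborel. rep_l2 (w n) x = W n x" for n
    unfolding w_def W_def by (rule rep_mult_op[of _ 1]) (use mb in auto)
  have Wint: "integrable lborel (W n)" for n
    unfolding W_def[abs_def] by (intro indicator_mult_integrable fin) simp_all
  have WM: "norm (W n x) \<le> real n" for n x by (auto simp: W_def S_def split: split_indicator)
  have le: "m * (w n \<bullet> w n) \<le> ?A (w n) \<bullet> w n" for n
  proof -
    have "w n \<bullet> w n = (\<integral>x. (norm (W n x))\<^sup>2 \<partial>lborel)"
      unfolding power2_norm_eq_inner[symmetric] norm2_l2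
      by (rule integral_cong_AE) (use rw[of n] in \<open>auto elim!: eventually_mono\<close>)
    moreover have "?A (w n) \<bullet> w n = Re (\<integral>x. (\<integral>y. a (x - y) * W n y \<partial>lborel) * cnj (W n x) \<partial>lborel)"
    proof -
      have [measurable]: "a \<in> borel_measurable borel" using borel_measurable_integrable[OF a] by simp
      have Wsq: "sq_int (W n)" unfolding W_def[abs_def] by (intro sq_int_mult_bounded[where C=1]) (use mb in auto)
      have csq: "sq_int (\<lambda>x. \<integral>y. a (x - y) * W n y \<partial>lborel)" by (rule schur_sq_int(1)[OF schur_kernel_conv[OF a] Wsq])
      have ic: "integrable lborel (\<lambda>x. (\<integral>y. a (x - y) * W n y \<partial>lborel) * cnj (W n x))"
        by (rule Bochner_Integration.integrable_bound[OF sq_int_mult[OF csq Wsq]]) (auto simp: norm_mult)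
      have "?A (w n) \<bullet> w n = (\<integral>x. Re ((\<integral>y. a (x - y) * W n y \<partial>lborel) * cnj (W n x)) \<partial>lborel)"
        unfolding inner_l2_def
      proof (rule integral_cong_AE)
        have e: "(\<integral>y. a (x - y) * rep_l2 (w n) y \<partial>lborel) = (\<integral>y. a (x - y) * W n y \<partial>lborel)" for x
          by (rule integral_cong_AE) (use rw[of n] in \<open>auto elim!: eventually_mono\<close>)
        show "AE x in lborel. rep_l2 (?A (w n)) x \<bullet> rep_l2 (w n) x = Re ((\<integral>y. a (x - y) * W n y \<partial>lborel) * cnj (W n x))"
          using rep_kernel_op[OF schur_kernel_conv[OF a], of "w n"] rw[of n]
          by eventually_elim (simp add: e inner_complex_def)
      qed measurable
      also have "\<dots> = Re (\<integral>x. (\<integral>y. a (x - y) * W n y \<partial>lborel) * cnj (W n x) \<partial>lborel)"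
        by (rule integral_Re[OF ic])
      finally show ?thesis .
    qed
    ultimately show ?thesis using conv_form_lower_bound_bounded[OF a Wint WM low] by simp
  qed
  have "(\<lambda>n. (norm (w n - u))\<^sup>2) \<longlonglongrightarrow> integral\<^sup>L lborel (\<lambda>x::'a. 0::real)"
  proof -
    have "(norm (w n - u))\<^sup>2 = (\<integral>x. (norm (W n x - rep_l2 u x))\<^sup>2 \<partial>lborel)" for n
      unfolding norm2_l2
    proof (rule integral_cong_AE)
      show "AE x in lborel. (norm (rep_l2 (w n - u) x))\<^sup>2 = (norm (W n x - rep_l2 u x))\<^sup>2"
        using rw[of n] rep_minus_l2[of "w n" u] by eventually_elim simp
    qed measurable
    moreover have "(\<lambda>n. \<integral>x. (norm (W n x - rep_l2 u x))\<^sup>2 \<partial>lborel) \<longlonglongrightarrow> integral\<^sup>L lborel (\<lambda>x::'a. 0::real)"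
    proof (rule integral_dominated_convergence[where w="\<lambda>x. (norm (rep_l2 u x))\<^sup>2"])
      show "AE x in lborel. (\<lambda>n. (norm (W n x - rep_l2 u x))\<^sup>2) \<longlonglongrightarrow> 0"
      proof (rule AE_I2)
        fix x
        have "\<forall>\<^sub>F n in sequentially. norm x \<le> real n" "\<forall>\<^sub>F n in sequentially. norm (rep_l2 u x) \<le> real n"
          using filterlim_real_sequentially by (simp_all add: filterlim_at_top)
        then have "\<forall>\<^sub>F n in sequentially. (norm (W n x - rep_l2 u x))\<^sup>2 = 0"
          by eventually_elim (simp add: W_def S_def)
        then show "(\<lambda>n. (norm (W n x - rep_l2 u x))\<^sup>2) \<longlonglongrightarrow> 0" by (rule tendsto_eventually)
      qed
    qed (auto intro!: sq_int_norm simp: W_def split: split_indicator)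
    ultimately show ?thesis by simp
  qed
  then have "(\<lambda>n. sqrt ((norm (w n - u))\<^sup>2)) \<longlonglongrightarrow> sqrt 0" by (intro tendsto_real_sqrt) simp
  then have "(\<lambda>n. norm (w n - u)) \<longlonglongrightarrow> 0" by simp
  then have wu: "w \<longlonglongrightarrow> u" by (intro LIM_zero_cancel[of w] tendsto_norm_zero_cancel[of "\<lambda>n. w n - u"])
  show ?thesis
    by (rule LIMSEQ_le[of "\<lambda>n. m * (w n \<bullet> w n)" _ "\<lambda>n. ?A (w n) \<bullet> w n"])
       (use le in \<open>auto intro!: tendsto_intros A.tendsto wu\<close>)
qed

section \<open>The form modulo finitely many directions\<close>

theorem conv_mult_form_bounded_below_mod_finite:
  fixes a h :: "'a::euclidean_space \<Rightarrow> complex"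
  assumes a: "integrable lborel a" and herm: "\<And>x. a (- x) = cnj (a x)"
    and [measurable]: "h \<in> borel_measurable borel" and hC: "\<And>x. norm (h x) \<le> C"
    and h0: "\<And>e. e > 0 \<Longrightarrow> \<exists>R>0. \<forall>x. norm x \<ge> R \<longrightarrow> norm (h x) < e"
    and am: "\<And>\<xi>. m \<le> Re (ft a \<xi>)" and hm: "\<And>x. m \<le> Re (h x)" and d: "d > 0"
  shows "\<exists>F. finite F \<and> pairwise orthogonal F \<and> (\<forall>u. (\<forall>f\<in>F. u \<bullet> f = 0) \<longrightarrow>
     (kernel_op (\<lambda>x y. a (x - y)) u + mult_op h u - m *\<^sub>R u) \<bullet> u \<ge> - d * (u \<bullet> u))"
proof -
  let ?A = "kernel_op (\<lambda>x y. a (x - y))"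
  note k = schur_kernel_conv[OF a]
  interpret A: bounded_linear ?A by (rule bounded_linear_kernel_op[OF k])
  \<comment> \<open>Three errors of size \<open>e\<close> occur: two from terms containing
    \<open>?A v\<close>, one from the potential outside the ball.\<close>
  define e where "e = d / 3"
  have e: "e > 0" using d by (simp add: e_def)
  obtain R where R: "\<And>x. norm x \<ge> R \<Longrightarrow> norm (h x) < e" using h0[OF e] by blast
  define B where "B = ball (0::'a) R"
  have [measurable]: "B \<in> sets borel" by (simp add: B_def)
  obtain F where F: "finite F" "pairwise orthogonal F"
    "\<And>u. (\<forall>f\<in>F. u \<bullet> f = 0) \<Longrightarrow> norm (?A (mult_op (indicator B) u)) \<le> e * norm u"
    using conv_cutoff_compact[OF a _ _ e, of B] by (auto simp: B_def)
  have "(?A u + mult_op h u - m *\<^sub>R u) \<bullet> u \<ge> - d * (u \<bullet> u)" if u: "\<forall>f\<in>F. u \<bullet> f = 0" for u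
  proof -
    define v where "v = mult_op (indicator B) u"
    define w where "w = mult_op (indicator (- B)) u"
    have vb: "norm (indicator S x :: complex) \<le> 1" for x :: 'a and S by (auto split: split_indicator)
    have rv: "AE x in lborel. rep_l2 v x = indicator B x * rep_l2 u x"
      unfolding v_def by (rule rep_mult_op[of _ 1]) (use vb in auto)
    have rw: "AE x in lborel. rep_l2 w x = indicator (- B) x * rep_l2 u x"
      unfolding w_def by (rule rep_mult_op[of _ 1]) (use vb in auto)
    have "AE x in lborel. rep_l2 u x = rep_l2 (v + w) x"
      using rv rw rep_plus_l2[of v w] by eventually_elim (auto split: split_indicator)
    then have uvw: "u = v + w" by (rule l2_eqI)
    have "v \<bullet> w = integral\<^sup>L lborel (\<lambda>x::'a. 0 * norm x)" unfolding inner_l2_def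
    proof (rule integral_cong_AE)
      show "AE x in lborel. rep_l2 v x \<bullet> rep_l2 w x = 0 * norm x"
        using rv rw by eventually_elim (auto split: split_indicator)
    qed measurable
    then have vw: "v \<bullet> w = 0" by simp
    have uu: "u \<bullet> u = v \<bullet> v + w \<bullet> w" unfolding uvw using vw by (simp add: inner_simps inner_commute)
    have Av: "norm (?A v) \<le> e * norm u" using F(3)[OF u] by (simp add: v_def)
    have wn: "norm w \<le> norm u" unfolding w_def using norm_mult_op[of "indicator (- B)" 1 u] vb by simp
    have "\<bar>?A v \<bullet> u\<bar> \<le> norm (?A v) * norm u" by (rule Cauchy_Schwarz_ineq2)
    also have "\<dots> \<le> (e * norm u) * norm u" by (intro mult_right_mono Av) auto
    finally have 1: "\<bar>?A v \<bullet> u\<bar> \<le> e * (u \<bullet> u)" by (simp add: power2_norm_eq_inner[symmetric] power2_eq_square)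
    have "\<bar>?A v \<bullet> w\<bar> \<le> norm (?A v) * norm w" by (rule Cauchy_Schwarz_ineq2)
    also have "\<dots> \<le> (e * norm u) * norm u" using e by (intro mult_mono Av wn) auto
    finally have 2: "\<bar>?A v \<bullet> w\<bar> \<le> e * (u \<bullet> u)" by (simp add: power2_norm_eq_inner[symmetric] power2_eq_square)
    \<comment> \<open>Self-adjointness puts every mixed term into the form of an inner product with
      \<open>?A v\<close>, which is small by the choice of \<open>F\<close>; only
      \<open>?A w \<bullet> w\<close> is left without a factor \<open>?A v\<close>.\<close>
    have "?A w \<bullet> v = w \<bullet> ?A v"
      by (rule kernel_op_self_adjoint[OF k]) (metis herm minus_diff_eq)
    then have 3: "?A u \<bullet> u = ?A v \<bullet> u + ?A v \<bullet> w + ?A w \<bullet> w"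
      unfolding uvw by (simp add: A.add inner_simps inner_commute)
    have 4: "m * (w \<bullet> w) \<le> ?A w \<bullet> w" by (rule conv_form_lower_bound[OF a am])
    have 5: "m * (v \<bullet> v) - e * (u \<bullet> u) \<le> mult_op h u \<bullet> u"
    proof -
      have iu: "integrable lborel (\<lambda>x. (norm (rep_l2 u x))\<^sup>2)" by (rule sq_int_norm) simp
      have iB: "integrable lborel (\<lambda>x. indicator B x * (norm (rep_l2 u x))\<^sup>2 :: real)"
        by (rule Bochner_Integration.integrable_bound[OF iu]) (auto split: split_indicator)
      have "v \<bullet> v = (\<integral>x. indicator B x * (norm (rep_l2 u x))\<^sup>2 \<partial>lborel)"
        unfolding inner_l2_def
      proof (rule integral_cong_AE)
        show "AE x in lborel. rep_l2 v x \<bullet> rep_l2 v x = indicator B x * (norm (rep_l2 u x))\<^sup>2"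
          using rv by eventually_elim (auto split: split_indicator simp: power2_norm_eq_inner)
      qed measurable
      moreover have "u \<bullet> u = (\<integral>x. (norm (rep_l2 u x))\<^sup>2 \<partial>lborel)"
        by (simp add: inner_l2_def power2_norm_eq_inner)
      ultimately have "m * (v \<bullet> v) - e * (u \<bullet> u) =
          (\<integral>x. m * (indicator B x * (norm (rep_l2 u x))\<^sup>2) - e * (norm (rep_l2 u x))\<^sup>2 \<partial>lborel)"
        using iu iB by simp
      also have "\<dots> \<le> (\<integral>x. (h x * rep_l2 u x) \<bullet> rep_l2 u x \<partial>lborel)"
      proof (rule integral_mono)
        show "integrable lborel (\<lambda>x. m * (indicator B x * (norm (rep_l2 u x))\<^sup>2) - e * (norm (rep_l2 u x))\<^sup>2)"
          using iu iB by simp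
        show "integrable lborel (\<lambda>x. (h x * rep_l2 u x) \<bullet> rep_l2 u x)"
          by (intro sq_int_inner sq_int_mult_bounded[where C=C] hC) auto
        fix x
        have eq: "(h x * rep_l2 u x) \<bullet> rep_l2 u x = Re (h x) * (norm (rep_l2 u x))\<^sup>2"
          unfolding inner_complex_def cmod_power2 by (simp add: power2_eq_square algebra_simps)
        \<comment> \<open>Inside the ball the potential is at least \<open>m\<close>, outside it
          exceeds \<open>- e\<close>. Thus the potential supplies \<open>m * (v \<bullet> v)\<close>
          and the convolution \<open>m * (w \<bullet> w)\<close>, which together cancel
          \<open>m * (u \<bullet> u)\<close>.\<close>
        have "m * indicator B x - e \<le> Re (h x)"
        proof (cases "x \<in> B")
          case True
          then show ?thesis using hm[of x] e by simp
        next
          case False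
          then have "norm (h x) < e" by (intro R) (auto simp: B_def)
          then show ?thesis using False abs_Re_le_cmod[of "h x"] by simp
        qed
        from mult_right_mono[OF this, of "(norm (rep_l2 u x))\<^sup>2"]
        show "m * (indicator B x * (norm (rep_l2 u x))\<^sup>2) - e * (norm (rep_l2 u x))\<^sup>2 \<le> (h x * rep_l2 u x) \<bullet> rep_l2 u x"
          unfolding eq by (simp add: left_diff_distrib mult.assoc)
      qed
      also have "\<dots> = mult_op h u \<bullet> u" by (rule inner_mult_op[symmetric]) (use hC in auto)
      finally show ?thesis .
    qed
    have "(?A u + mult_op h u - m *\<^sub>R u) \<bullet> u = ?A u \<bullet> u + mult_op h u \<bullet> u - m * (u \<bullet> u)"
      by (simp add: inner_simps)
    also have "\<dots> \<ge> - (3 * e) * (u \<bullet> u)"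
      using 1 2 3 4 5 by (simp add: uu distrib_left abs_le_iff)
    finally show ?thesis by (simp add: e_def)
  qed
  with F(1,2) show ?thesis by blast
qed

section \<open>Finite differences\<close>

text \<open>A direction together with a signed step. Dividing by the signed step makes forward and
  backward quotients approximate the same derivative, and a list may mix the two.\<close>

definition difference_step :: "'a::real_vector \<times> real \<Rightarrow> ('a \<Rightarrow> 'b::real_vector) \<Rightarrow> 'a \<Rightarrow> 'b" where
  "difference_step p f x = (f (x + snd p *\<^sub>R fst p) - f x) /\<^sub>R snd p"

definition finite_diff :: "('a::real_vector \<times> real) list \<Rightarrow> ('a \<Rightarrow> 'b::real_vector) \<Rightarrow> 'a \<Rightarrow> 'b" where
  "finite_diff l = foldr difference_step l"

lemma finite_diff_Nil [simp]: "finite_diff [] f = f"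
  by (simp add: finite_diff_def)

lemma finite_diff_Cons:
  "finite_diff (p # l) f x = (finite_diff l f (x + snd p *\<^sub>R fst p) - finite_diff l f x) /\<^sub>R snd p"
  by (simp add: finite_diff_def difference_step_def)

lemma finite_diff_append: "finite_diff (l @ l') f = finite_diff l (finite_diff l' f)"
  by (simp add: finite_diff_def)

text \<open>Difference steps commute for arbitrary functions, so all reordering of directions is
  done on differences, before any derivative is taken.\<close>

lemma finite_diff_perm:
  assumes "mset l = mset l'"
  shows "finite_diff l = finite_diff l'"
proof -
  have "difference_step p \<circ> difference_step q = difference_step q \<circ> difference_step p" for p q :: "'a \<times> real"
    by (intro ext) (simp add: difference_step_def algebra_simps)
  then have "fold difference_step (rev l) = fold difference_step (rev l')"
    using assms by (intro fold_multiset_equiv) auto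
  then show ?thesis by (simp add: finite_diff_def foldr_conv_fold)
qed

lemma finite_diff_linear:
  assumes "linear g"
  shows "g (finite_diff l f x) = finite_diff l (\<lambda>x. g (f x)) x"
  by (induction l arbitrary: x)
     (simp_all add: finite_diff_Cons linear_scale[OF assms] linear_diff[OF assms])

lemma finite_diff_shift: "finite_diff l (\<lambda>x. f (x + t)) x = finite_diff l f (x + t)"
  by (induction l arbitrary: x) (simp_all add: finite_diff_Cons add_ac)

lemma finite_diff_scale: "finite_diff l (\<lambda>x. c *\<^sub>R f x) x = c *\<^sub>R finite_diff l f x"
  using finite_diff_linear[of "\<lambda>y. c *\<^sub>R y" l f x] by (simp add: linear_scale_self)

definition reverse_steps :: "('a \<times> real) list \<Rightarrow> ('a \<times> real) list" where
  "reverse_steps l = map (\<lambda>p. (fst p, - snd p)) l"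

text \<open>A step forward in \<open>w\<close> is a step backward in \<open>z - w\<close>, and
  dividing by the reversed step changes the sign once per step. This is the origin of the sign
  \<open>(- 1) ^ mi_abs m\<close> in the matrix of the form.\<close>

lemma finite_diff_reflect:
  "finite_diff l (\<lambda>w. f (z - w)) w = (- 1) ^ length l *\<^sub>R finite_diff (reverse_steps l) f (z - w)"
proof (induction l arbitrary: w)
  case (Cons p l)
  have "finite_diff (p # l) (\<lambda>w. f (z - w)) w =
    ((- 1) ^ length l *\<^sub>R (finite_diff (reverse_steps l) f (z - w + (- snd p) *\<^sub>R fst p) - finite_diff (reverse_steps l) f (z - w))) /\<^sub>R snd p"
    by (simp add: finite_diff_Cons Cons scaleR_right_diff_distrib diff_diff_add)
  then show ?case
    by (simp add: reverse_steps_def finite_diff_Cons algebra_simps)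
qed (simp add: reverse_steps_def)

text \<open>A bound that asks for no regularity: each step costs a factor \<open>2 / h\<close>, and
  only values within \<open>length l\<close> steps of \<open>x\<close> enter. It serves the
  potential, which is only known to be small near \<open>x0\<close>.\<close>

lemma norm_finite_diff_le:
  fixes f :: "'a::real_normed_vector \<Rightarrow> 'b::real_normed_vector"
  assumes "\<And>p. p \<in> set l \<Longrightarrow> norm (fst p) = 1 \<and> \<bar>snd p\<bar> = h" and h: "h > 0"
    and "\<And>y. norm (y - x) \<le> real (length l) * h \<Longrightarrow> norm (f y) \<le> K"
  shows "norm (finite_diff l f x) \<le> (2 / h) ^ length l * K"
  using assms(1,3)
proof (induction l arbitrary: x)
  case Nil
  then show ?case using h by simp
next
  case (Cons p l)
  have p: "norm (fst p) = 1" "\<bar>snd p\<bar> = h" using Cons.prems(1)[of p] by auto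
  have 1: "norm (finite_diff l f x) \<le> (2 / h) ^ length l * K"
  proof (rule Cons.IH)
    fix y assume "norm (y - x) \<le> real (length l) * h"
    then show "norm (f y) \<le> K" using h by (intro Cons.prems(2)) (simp add: distrib_right)
  qed (use Cons.prems(1) in auto)
  have 2: "norm (finite_diff l f (x + snd p *\<^sub>R fst p)) \<le> (2 / h) ^ length l * K"
  proof (rule Cons.IH)
    fix y assume y: "norm (y - (x + snd p *\<^sub>R fst p)) \<le> real (length l) * h"
    have "norm (y - x) \<le> norm (y - (x + snd p *\<^sub>R fst p)) + norm (snd p *\<^sub>R fst p)"
      using norm_triangle_ineq[of "y - (x + snd p *\<^sub>R fst p)" "snd p *\<^sub>R fst p"] by simp
    then show "norm (f y) \<le> K" using y p by (intro Cons.prems(2)) (simp add: distrib_right)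
  qed (use Cons.prems(1) in auto)
  have "norm (finite_diff (p # l) f x) = norm (finite_diff l f (x + snd p *\<^sub>R fst p) - finite_diff l f x) / h"
    by (simp add: finite_diff_Cons p divide_inverse mult.commute)
  also have "\<dots> \<le> (2 * ((2 / h) ^ length l * K)) / h"
    using norm_triangle_ineq4[of "finite_diff l f (x + snd p *\<^sub>R fst p)" "finite_diff l f x"] 1 2 h
    by (intro divide_right_mono) auto
  finally show ?case by simp
qed

lemma finite_diff_integral:
  fixes F :: "'a::real_vector \<Rightarrow> 'c \<Rightarrow> 'b::{banach, second_countable_topology}"
  assumes "\<And>z. integrable M (F z)"
  shows "integrable M (\<lambda>p. finite_diff l (\<lambda>z. F z p) x)"
    and "finite_diff l (\<lambda>z. \<integral>p. F z p \<partial>M) x = (\<integral>p. finite_diff l (\<lambda>z. F z p) x \<partial>M)"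
proof -
  have "integrable M (\<lambda>p. finite_diff l (\<lambda>z. F z p) x) \<and>
    finite_diff l (\<lambda>z. \<integral>p. F z p \<partial>M) x = (\<integral>p. finite_diff l (\<lambda>z. F z p) x \<partial>M)" for x
    by (induction l arbitrary: x) (use assms in \<open>auto simp: finite_diff_Cons\<close>)
  then show "integrable M (\<lambda>p. finite_diff l (\<lambda>z. F z p) x)"
    and "finite_diff l (\<lambda>z. \<integral>p. F z p \<partial>M) x = (\<integral>p. finite_diff l (\<lambda>z. F z p) x \<partial>M)" by blast+
qed

definition total_step :: "('a \<times> real) list \<Rightarrow> real" where
  "total_step l = (\<Sum>p\<leftarrow>l. \<bar>snd p\<bar>)"

lemma total_step_simps [simp]: "total_step [] = 0" "total_step (p # l) = \<bar>snd p\<bar> + total_step l"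
  by (simp_all add: total_step_def)

lemma finite_diff_has_vector_derivative:
  fixes f :: "'a::real_normed_vector \<Rightarrow> 'b::real_normed_vector"
  assumes "\<And>y. norm y < \<rho> \<Longrightarrow> ((\<lambda>t. f (y + t *\<^sub>R e)) has_vector_derivative f' y) (at 0)"
    and "norm x + total_step l < \<rho>" and "\<And>p. p \<in> set l \<Longrightarrow> norm (fst p) = 1"
  shows "((\<lambda>t. finite_diff l f (x + t *\<^sub>R e)) has_vector_derivative finite_diff l f' x) (at 0)"
  using assms(2,3)
proof (induction l arbitrary: x)
  case Nil
  then show ?case using assms(1) by simp
next
  case (Cons p l)
  have "norm (x + snd p *\<^sub>R fst p) \<le> norm x + \<bar>snd p\<bar>"
    using norm_triangle_ineq[of x "snd p *\<^sub>R fst p"] Cons.prems(2)[of p] by simp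
  then have "((\<lambda>t. finite_diff l f ((x + snd p *\<^sub>R fst p) + t *\<^sub>R e)) has_vector_derivative finite_diff l f' (x + snd p *\<^sub>R fst p)) (at 0)"
    using Cons.prems by (intro Cons.IH) auto
  moreover have "((\<lambda>t. finite_diff l f (x + t *\<^sub>R e)) has_vector_derivative finite_diff l f' x) (at 0)"
    using Cons.prems by (intro Cons.IH) auto
  ultimately have "((\<lambda>t. (finite_diff l f ((x + snd p *\<^sub>R fst p) + t *\<^sub>R e) - finite_diff l f (x + t *\<^sub>R e)) /\<^sub>R snd p)
    has_vector_derivative (finite_diff l f' (x + snd p *\<^sub>R fst p) - finite_diff l f' x) /\<^sub>R snd p) (at 0)"
    by (intro has_vector_derivative_scaleR[where f="\<lambda>_. inverse (snd p)" and f'=0, simplified] has_vector_derivative_diff) auto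
  then show ?case by (simp add: finite_diff_Cons add_ac)
qed

text \<open>The mean value inequality for \<open>g t - t *\<^sub>R c\<close>, whose derivative is
  small. The hypotheses cover the interval symmetric about 0, so \<open>s\<close> may have either
  sign.\<close>

lemma difference_quotient_bound:
  fixes g :: "real \<Rightarrow> 'b::real_normed_vector"
  assumes der: "\<And>t. \<bar>t\<bar> \<le> \<bar>s\<bar> \<Longrightarrow> (g has_vector_derivative g' t) (at t)"
    and bd: "\<And>t. \<bar>t\<bar> \<le> \<bar>s\<bar> \<Longrightarrow> norm (g' t - c) \<le> \<epsilon>" and s: "s \<noteq> 0"
  shows "norm ((g s - g 0) /\<^sub>R s - c) \<le> \<epsilon>"
proof -
  let ?G = "\<lambda>t. g t - t *\<^sub>R c"
  let ?S = "{-\<bar>s\<bar>..\<bar>s\<bar>}"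
  have "norm (?G s - ?G 0) \<le> \<epsilon> * norm (s - 0)"
  proof (rule differentiable_bound)
    show "convex ?S" by simp
    fix t assume "t \<in> ?S"
    then have t: "\<bar>t\<bar> \<le> \<bar>s\<bar>" by auto
    have "(?G has_vector_derivative (g' t - c)) (at t within ?S)"
      by (auto intro!: derivative_eq_intros has_vector_derivative_at_within[OF der[OF t]])
    then show "(?G has_derivative (\<lambda>x. x *\<^sub>R (g' t - c))) (at t within ?S)"
      by (simp add: has_vector_derivative_def)
    show "onorm (\<lambda>x. x *\<^sub>R (g' t - c)) \<le> \<epsilon>"
      using bd[OF t] by (intro onorm_le) (auto simp: mult.commute[of \<epsilon>] intro!: mult_left_mono)
  qed auto
  then have "norm (g s - g 0 - s *\<^sub>R c) \<le> \<epsilon> * \<bar>s\<bar>" by (simp add: algebra_simps)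
  moreover have "(g s - g 0) /\<^sub>R s - c = (g s - g 0 - s *\<^sub>R c) /\<^sub>R s"
    using s by (simp add: scaleR_right_diff_distrib)
  moreover have "norm (g s - g 0 - s *\<^sub>R c) / \<bar>s\<bar> \<le> \<epsilon>"
    using calculation(1) s by (simp add: pos_divide_le_eq)
  ultimately show ?thesis by (simp add: divide_inverse mult.commute)
qed

section \<open>Difference quotients and iterated partial derivatives\<close>

definition axis_steps :: "('n \<times> real) list \<Rightarrow> ((real ^ 'n) \<times> real) list" where
  "axis_steps k = map (\<lambda>p. (axis (fst p) 1, snd p)) k"

lemma axis_steps_simps [simp]:
  "axis_steps [] = []" "axis_steps (p # k) = (axis (fst p) 1, snd p) # axis_steps k"
  "total_step (axis_steps k) = (\<Sum>p\<leftarrow>k. \<bar>snd p\<bar>)" "length (axis_steps k) = length k"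
  by (simp_all add: axis_steps_def total_step_def o_def)

lemma partials_has_vector_derivative:
  assumes "C_infinity_on S f" "x \<in> S"
  shows "((\<lambda>t. partials js f (x + t *\<^sub>R axis i 1)) has_vector_derivative partials (i # js) f x) (at 0)"
  using assms by (auto simp: C_infinity_on_def partials_def partial_def vector_derivative_works[symmetric])

text \<open>Differentiation commutes with differences, so the mean value inequality trades one difference
  for one derivative at a time; the order of the derivatives is reversed.\<close>

lemma finite_diff_partials_bound:
  fixes f :: "real ^ 'n \<Rightarrow> complex"
  assumes f: "C_infinity_on S f" and S: "ball 0 \<rho> \<subseteq> S"
    and bd: "\<And>y. norm y < \<rho> \<Longrightarrow> norm (partials (rev (map fst k) @ js) f y - c) \<le> \<epsilon>"
    and x: "norm x + (\<Sum>p\<leftarrow>k. \<bar>snd p\<bar>) < \<rho>" and nz: "\<And>p. p \<in> set k \<Longrightarrow> snd p \<noteq> 0"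
  shows "norm (finite_diff (axis_steps k) (partials js f) x - c) \<le> \<epsilon>"
  using bd x nz
proof (induction k arbitrary: js x)
  case Nil
  then show ?case by simp
next
  case (Cons p k)
  obtain i s where p: "p = (i, s)" by force
  have s: "s \<noteq> 0" using Cons.prems(3)[of p] by (simp add: p)
  have xs: "norm x + \<bar>s\<bar> + (\<Sum>p\<leftarrow>k. \<bar>snd p\<bar>) < \<rho>" using Cons.prems(2) by (simp add: p)
  let ?e = "axis i 1 :: real ^ 'n"
  let ?g = "\<lambda>t. finite_diff (axis_steps k) (partials js f) (x + t *\<^sub>R ?e)"
  \<comment> \<open>The derivative of \<open>?g\<close>: the remaining differences applied to one
    further partial derivative. The induction hypothesis for \<open>i # js\<close> keeps it close to
    \<open>c\<close> all along the segment.\<close>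
  let ?g' = "\<lambda>t. finite_diff (axis_steps k) (partials (i # js) f) (x + t *\<^sub>R ?e)"
  have xt: "norm (x + t *\<^sub>R ?e) + (\<Sum>p\<leftarrow>k. \<bar>snd p\<bar>) < \<rho>" if "\<bar>t\<bar> \<le> \<bar>s\<bar>" for t
    using norm_triangle_ineq[of x "t *\<^sub>R ?e"] that xs by (simp add: norm_axis_1)
  have "norm ((?g s - ?g 0) /\<^sub>R s - c) \<le> \<epsilon>"
  proof (rule difference_quotient_bound[OF _ _ s])
    fix t assume t: "\<bar>t\<bar> \<le> \<bar>s\<bar>"
    have "((\<lambda>u. finite_diff (axis_steps k) (partials js f) ((x + t *\<^sub>R ?e) + u *\<^sub>R ?e)) has_vector_derivative ?g' t) (at 0)"
    proof (rule finite_diff_has_vector_derivative)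
      show "((\<lambda>t. partials js f (y + t *\<^sub>R ?e)) has_vector_derivative partials (i # js) f y) (at 0)" if "norm y < \<rho>" for y
        using S that by (intro partials_has_vector_derivative[OF f]) auto
      show "norm (x + t *\<^sub>R ?e) + total_step (axis_steps k) < \<rho>" using xt[OF t] by simp
      show "norm (fst q) = 1" if "q \<in> set (axis_steps k)" for q using that by (auto simp: axis_steps_def norm_axis_1)
    qed
    then have d: "((\<lambda>u. ?g (t + u)) has_vector_derivative ?g' t) (at 0)" by (simp add: scaleR_left_distrib add_ac)
    have "((\<lambda>u. ?g (t + u)) \<circ> (\<lambda>v. v - t) has_vector_derivative (1 *\<^sub>R ?g' t)) (at t)"
      by (rule vector_diff_chain_at) (use d in \<open>auto intro!: derivative_eq_intros\<close>)
    then show "(?g has_vector_derivative ?g' t) (at t)" by (simp add: o_def)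
    show "norm (?g' t - c) \<le> \<epsilon>"
      by (rule Cons.IH) (use Cons.prems xt[OF t] in \<open>auto simp: p\<close>)
  qed
  then show ?case by (simp add: p finite_diff_Cons)
qed

text \<open>Prescribes the order of the directions while every step length travels with its own
  direction.\<close>

lemma mset_map_eq_reorder:
  assumes "mset (map g k) = mset l"
  shows "\<exists>k'. mset k' = mset k \<and> map g k' = l"
  using assms
proof (induction l arbitrary: k)
  case Nil
  then show ?case by auto
next
  case (Cons y l)
  then have "y \<in> set (map g k)" by (metis list.set_intros(1) mset_eq_setD)
  then obtain p where p: "p \<in> set k" "g p = y" by auto
  have "mset (map g (remove1 p k)) = mset l"
    using Cons.prems p by (simp add: image_mset_Diff)
  from Cons.IH[OF this] obtain k' where "mset k' = mset (remove1 p k)" "map g k' = l" by blast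
  then show ?case using p by (intro exI[of _ "p # k'"]) auto
qed

text \<open>Reordering the steps realises the order of differentiation given by \<open>js\<close>,
  and continuity of that one derivative gives the bound. The point \<open>x\<close> and the signed
  steps vary freely below \<open>\<rho>\<close>: smearing moves the point, and reflection produces
  steps of both signs.\<close>

lemma finite_diff_near_partials:
  fixes f :: "real ^ 'n \<Rightarrow> complex"
  assumes f: "C_infinity_on (open_cube r 0) f" and r: "r > 0" and \<epsilon>: "\<epsilon> > 0"
  shows "\<exists>\<rho>>0. \<forall>k x. mset (map fst k) = mset js \<longrightarrow> (\<forall>p\<in>set k. snd p \<noteq> 0) \<longrightarrow>
     norm x + (\<Sum>p\<leftarrow>k. \<bar>snd p\<bar>) < \<rho> \<longrightarrow> norm (finite_diff (axis_steps k) f x - partials js f 0) \<le> \<epsilon>"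
proof -
  let ?S = "open_cube r (0 :: real ^ 'n)"
  have 0: "0 \<in> ?S" using r by (simp add: open_cube_def)
  have "continuous_on ?S (partials js f)" using f by (simp add: C_infinity_on_def)
  then have "\<exists>d>0. \<forall>y\<in>?S. dist y 0 < d \<longrightarrow> dist (partials js f y) (partials js f 0) < \<epsilon>"
    using 0 \<epsilon> unfolding continuous_on_iff by blast
  then obtain d where d: "d > 0" "\<And>y. y \<in> ?S \<Longrightarrow> norm y < d \<Longrightarrow> norm (partials js f y - partials js f 0) < \<epsilon>"
    by (auto simp: dist_norm)
  define \<rho> where "\<rho> = min d (r / 2)"
  have \<rho>: "\<rho> > 0" using d r by (simp add: \<rho>_def)
  have S: "ball 0 \<rho> \<subseteq> ?S"
  proof
    fix y :: "real ^ 'n" assume "y \<in> ball 0 \<rho>"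
    then have "norm y < r / 2" by (simp add: \<rho>_def)
    then have "\<bar>y $ i\<bar> < r / 2" for i using component_le_norm_cart[of y i] by linarith
    then show "y \<in> ?S" by (simp add: open_cube_def)
  qed
  have "norm (finite_diff (axis_steps k) f x - partials js f 0) \<le> \<epsilon>"
    if k: "mset (map fst k) = mset js" "\<forall>p\<in>set k. snd p \<noteq> 0" and x: "norm x + (\<Sum>p\<leftarrow>k. \<bar>snd p\<bar>) < \<rho>" for k x
  proof -
    have "mset (map fst k) = mset (rev js)" using k(1) by simp
    \<comment> \<open>The directions are arranged as \<open>rev js\<close> because the conversion of
      differences into derivatives reverses their order.\<close>
    then obtain k' where k': "mset k' = mset k" "map fst k' = rev js" using mset_map_eq_reorder by blast
    have "mset (axis_steps k') = mset (axis_steps k)" using k'(1) by (simp add: axis_steps_def)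
    from finite_diff_perm[OF this, where ?'b = complex]
    have e: "finite_diff (axis_steps k) f = finite_diff (axis_steps k') f" by simp
    have s: "(\<Sum>p\<leftarrow>k'. \<bar>snd p\<bar>) = (\<Sum>p\<leftarrow>k. \<bar>snd p\<bar>)"
      by (simp only: sum_mset_sum_list[symmetric] mset_map k'(1))
    have "norm (finite_diff (axis_steps k') (partials [] f) x - partials js f 0) \<le> \<epsilon>"
    proof (rule finite_diff_partials_bound[OF f S])
      show "norm (partials (rev (map fst k') @ []) f y - partials js f 0) \<le> \<epsilon>" if "norm y < \<rho>" for y
        using d(2)[of y] that S by (auto simp: k' \<rho>_def intro: less_imp_le)
      show "norm x + (\<Sum>p\<leftarrow>k'. \<bar>snd p\<bar>) < \<rho>" using x s by simp
      show "snd p \<noteq> 0" if "p \<in> set k'" for p using k(2) that mset_eq_setD[OF k'(1)] by auto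
    qed
    then show ?thesis by (simp add: e partials_def)
  qed
  with \<rho> show ?thesis by blast
qed

section \<open>Sparse multi-indices and diagonal dominance\<close>

lemma coord_list: "distinct (coord_list :: 'n::finite list)" "set (coord_list :: 'n::finite list) = UNIV"
proof -
  have "\<exists>is::'n list. distinct is \<and> set is = UNIV" using finite_distinct_list[of "UNIV :: 'n set"] by auto
  from someI_ex[OF this] show "distinct (coord_list :: 'n list)" "set (coord_list :: 'n list) = UNIV"
    by (auto simp: coord_list_def)
qed

definition multi_list :: "('n::finite \<Rightarrow> nat) \<Rightarrow> 'n list" where
  "multi_list n = concat (map (\<lambda>i. replicate (n i) i) coord_list)"

lemma multi_partial_conv_partials: "multi_partial n f = partials (multi_list n) f"
  by (simp add: multi_partial_def multi_list_def)

text \<open>The list of a sum is only a rearrangement of the concatenated lists, so the identity is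
  stated for multisets; differences are insensitive to the order.\<close>

lemma mset_multi_list_add: "mset (multi_list (\<lambda>i. n i + m i)) = mset (multi_list n) + mset (multi_list m)"
proof -
  have "mset (concat (map (\<lambda>i. replicate (n i + m i) i) cs)) =
     mset (concat (map (\<lambda>i. replicate (n i) i) cs)) + mset (concat (map (\<lambda>i. replicate (m i) i) cs))" for cs :: "'a list"
    by (induction cs) (auto simp: replicate_add)
  then show ?thesis by (simp add: multi_list_def)
qed

lemma length_multi_list: "length (multi_list n) = mi_abs n"
proof -
  have "length (multi_list n) = (\<Sum>i\<leftarrow>coord_list. n i)"
    by (simp add: multi_list_def length_concat o_def)
  also have "\<dots> = (\<Sum>i\<in>set coord_list. n i)" by (rule sum_list_distinct_conv_sum_set[OF coord_list(1)])
  finally show ?thesis by (simp add: mi_abs_def coord_list(2))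
qed

section \<open>Ratios of factorials\<close>

definition central_ratio :: "nat \<Rightarrow> nat \<Rightarrow> real" where
  "central_ratio a b = (fact (a + b))\<^sup>2 / (fact (2 * a) * fact (2 * b))"

lemma central_ratio_pos: "central_ratio a b > 0"
  by (simp add: central_ratio_def)

text \<open>The ratio is a binomial coefficient of the row \<open>2 * (a + b)\<close> divided by the
  central one of that row, which is the largest.\<close>

lemma central_ratio_le_1: "central_ratio a b \<le> 1"
proof -
  have "(2 * (a + b)) choose (2 * a) \<le> (2 * (a + b)) choose (a + b)" by (rule binomial_maximum')
  then have "real ((2 * (a + b)) choose (2 * a)) \<le> real ((2 * (a + b)) choose (a + b))" by simp
  then have "fact (2 * (a + b)) / (fact (2 * a) * fact (2 * b)) \<le> (fact (2 * (a + b)) / (fact (a + b) * fact (a + b)) :: real)"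
    by (simp add: binomial_fact algebra_simps)
  then have "fact (2 * (a + b)) * ((fact (a + b))\<^sup>2 :: real) \<le> fact (2 * (a + b)) * (fact (2 * a) * fact (2 * b))"
    by (simp add: divide_simps power2_eq_square mult_ac split: if_splits)
  then have "((fact (a + b))\<^sup>2 :: real) \<le> fact (2 * a) * fact (2 * b)"
    by (subst (asm) mult_le_cancel_left_pos) auto
  then show ?thesis by (simp add: central_ratio_def)
qed

text \<open>For fixed \<open>a\<close> the quotient of consecutive terms tends to 1/4, and it is at
  most 1/2 as soon as \<open>b \<ge> 4 * a\<close>.\<close>

lemma central_ratio_tendsto_0: "central_ratio a \<longlonglongrightarrow> 0"
proof -
  have "summable (central_ratio a)"
  proof (rule summable_ratio_test)
    show "(1/2::real) < 1" by simp
    fix b :: nat assume b: "b \<ge> 4 * a"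
    have "central_ratio a (Suc b) = central_ratio a b * ((real a + real b + 1)\<^sup>2 / ((2 * real b + 1) * (2 * real b + 2)))"
      by (simp add: central_ratio_def power2_eq_square field_simps)
    also have "\<dots> \<le> central_ratio a b * (1/2)"
    proof (rule mult_left_mono)
      have "(real a + real b + 1)\<^sup>2 \<le> (5 / 4 * real b + 1)\<^sup>2" using b by (intro power_mono) auto
      also have "\<dots> = 25 / 16 * (real b * real b) + 5 / 2 * real b + 1" by (simp add: power2_eq_square algebra_simps)
      also have "\<dots> \<le> 2 * (real b * real b) + 3 * real b + 1"
        using mult_nonneg_nonneg[of "real b" "real b"] by linarith
      also have "\<dots> = 1 / 2 * ((2 * real b + 1) * (2 * real b + 2))" by (simp add: algebra_simps)
      finally have "(real a + real b + 1)\<^sup>2 \<le> 1 / 2 * ((2 * real b + 1) * (2 * real b + 2))" .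
      moreover have "(2 * real b + 1) * (2 * real b + 2) > 0" by (intro mult_pos_pos) auto
      ultimately show "(real a + real b + 1)\<^sup>2 / ((2 * real b + 1) * (2 * real b + 2)) \<le> 1 / 2"
        by (subst pos_divide_le_eq) auto
    qed (use central_ratio_pos[of a b] in simp)
    finally show "norm (central_ratio a (Suc b)) \<le> 1 / 2 * norm (central_ratio a b)"
      using central_ratio_pos[of a b] central_ratio_pos[of a "Suc b"] by simp
  qed
  then show ?thesis by (rule summable_LIMSEQ_zero)
qed

definition mi_ratio :: "('n::finite \<Rightarrow> nat) \<Rightarrow> ('n \<Rightarrow> nat) \<Rightarrow> real" where
  "mi_ratio n m = (\<Prod>i\<in>UNIV. central_ratio (n i) (m i))"

lemma mi_fact_pos: "mi_fact n > 0"
  by (simp add: mi_fact_def prod_pos)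

lemma mi_ratio_eq: "(mi_fact (\<lambda>i. n i + m i))\<^sup>2 = mi_ratio n m * (mi_fact (mi_double n) * mi_fact (mi_double m))"
  by (simp add: mi_fact_def mi_ratio_def mi_double_def central_ratio_def prod.distrib[symmetric] prod_power_distrib)

lemma mi_ratio_commute: "mi_ratio n m = mi_ratio m n"
  by (simp add: mi_ratio_def central_ratio_def add.commute mult.commute)

lemma mi_ratio_pos: "mi_ratio n m > 0"
  by (simp add: mi_ratio_def central_ratio_pos prod_pos)

text \<open>All factors are at most 1, so one large coordinate of \<open>m\<close> already pushes
  the product below \<open>\<tau>\<close>; the remaining multi-indices lie in a finite box.\<close>

lemma finite_mi_ratio_ge:
  assumes "\<tau> > 0"
  shows "finite {m :: 'n::finite \<Rightarrow> nat. mi_ratio n m \<ge> \<tau>}"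
proof -
  have "\<exists>b. \<forall>c\<ge>b. central_ratio (n i) c < \<tau>" for i
    using order_tendstoD(2)[OF central_ratio_tendsto_0 assms] by (auto simp: eventually_sequentially)
  then obtain b where b: "\<And>i c. c \<ge> b i \<Longrightarrow> central_ratio (n i) c < \<tau>" by metis
  have "{m. mi_ratio n m \<ge> \<tau>} \<subseteq> Pi\<^sub>E UNIV (\<lambda>i. {..<b i})"
  proof
    fix m assume "m \<in> {m. mi_ratio n m \<ge> \<tau>}"
    then have m: "mi_ratio n m \<ge> \<tau>" by simp
    have "m i < b i" for i
    proof (rule ccontr)
      assume "\<not> m i < b i"
      then have "central_ratio (n i) (m i) < \<tau>" by (intro b) simp
      moreover have "mi_ratio n m \<le> central_ratio (n i) (m i)"
      proof -
        have "(\<Prod>i\<in>UNIV - {i}. central_ratio (n i) (m i)) \<le> 1"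
          by (intro prod_le_1) (auto simp: central_ratio_le_1 less_imp_le central_ratio_pos)
        then show ?thesis
          using central_ratio_pos[of "n i" "m i"] by (simp add: mi_ratio_def prod.remove[of _ i] mult_left_le)
      qed
      ultimately show False using m by simp
    qed
    then show "m \<in> Pi\<^sub>E UNIV (\<lambda>i. {..<b i})" by auto
  qed
  then show ?thesis by (rule finite_subset) (intro finite_PiE, auto)
qed

text \<open>A greedy choice: each index chosen so far rules out only finitely many later ones, and
  \<open>I\<close> is infinite. Symmetry of the ratio covers both orders of a pair.\<close>

lemma sparse_subset:
  fixes I :: "('n::finite \<Rightarrow> nat) set"
  assumes I: "infinite I" and \<tau>: "\<tau> > 0"
  shows "\<exists>J\<subseteq>I. finite J \<and> card J = N \<and> (\<forall>n\<in>J. \<forall>m\<in>J. n \<noteq> m \<longrightarrow> mi_ratio n m < \<tau>)"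
proof (induction N)
  case 0
  show ?case by (intro exI[of _ "{}"]) auto
next
  case (Suc N)
  then obtain J where J: "J \<subseteq> I" "finite J" "card J = N" "\<And>n m. n \<in> J \<Longrightarrow> m \<in> J \<Longrightarrow> n \<noteq> m \<Longrightarrow> mi_ratio n m < \<tau>" by blast
  have "finite (J \<union> (\<Union>n\<in>J. {m. mi_ratio n m \<ge> \<tau>}))" using J(2) finite_mi_ratio_ge[OF \<tau>] by auto
  then have "infinite (I - (J \<union> (\<Union>n\<in>J. {m. mi_ratio n m \<ge> \<tau>})))" using I by (rule Diff_infinite_finite)
  then have "I - (J \<union> (\<Union>n\<in>J. {m. mi_ratio n m \<ge> \<tau>})) \<noteq> {}" by (rule infinite_imp_nonempty)
  then obtain m where m0: "m \<in> I - (J \<union> (\<Union>n\<in>J. {m. mi_ratio n m \<ge> \<tau>}))" by blast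
  then have m: "m \<in> I" "m \<notin> J" "\<And>n. n \<in> J \<Longrightarrow> mi_ratio n m < \<tau>" by (auto simp: not_le)
  have "mi_ratio k l < \<tau>" if "k \<in> insert m J" "l \<in> insert m J" "k \<noteq> l" for k l
    using that J(4)[of k l] m(3)[of k] m(3)[of l] mi_ratio_commute[of k l] by auto
  then show ?case
    using J(1-3) m(1,2) by (intro exI[of _ "insert m J"]) simp
qed

text \<open>Diagonal dominance after rescaling the variables by the square roots of the diagonal entries.\<close>

lemma negative_definite_of_small_off_diagonal:
  fixes M :: "'j \<Rightarrow> 'j \<Rightarrow> real"
  assumes J: "finite J" "J \<noteq> {}" and diag: "\<And>n. n \<in> J \<Longrightarrow> M n n < 0"
    and off: "\<And>n m. n \<in> J \<Longrightarrow> m \<in> J \<Longrightarrow> n \<noteq> m \<Longrightarrow> \<bar>M n m\<bar> < 1 / card J * sqrt (M n n * M m m)"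
    and z: "\<exists>n\<in>J. z n \<noteq> 0"
  shows "(\<Sum>n\<in>J. \<Sum>m\<in>J. z n * z m * M n m) < 0"
proof -
  define N where "N = real (card J)"
  have N: "N > 0" using J by (simp add: N_def card_gt_0_iff)
  define t where "t n = \<bar>z n\<bar> * sqrt (- M n n)" for n
  have t0: "t n \<ge> 0" if "n \<in> J" for n using diag[OF that] by (simp add: t_def)
  have tt: "(t n)\<^sup>2 = - (z n * z n * M n n)" if "n \<in> J" for n
    unfolding t_def power_mult_distrib power2_abs using diag[OF that] by (simp add: power2_eq_square[of "z n"])
  \<comment> \<open>The diagonal term is \<open>- (t n)^2\<close>, written as
    \<open>1 / N * (t n)^2\<close> minus \<open>(1 + 1 / N) * (t n)^2\<close>. The first parts
    complete the off-diagonal bounds to a full square, which Cauchy-Schwarz bounds by the sum of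
    squares, and a surplus of \<open>1 / N\<close> remains.\<close>
  have le: "z n * z m * M n m \<le> 1 / N * (t n * t m) - (if n = m then (1 + 1 / N) * (t n)\<^sup>2 else 0)"
    if nm: "n \<in> J" "m \<in> J" for n m
  proof (cases "n = m")
    case True
    then show ?thesis using tt[OF nm(1)] by (simp add: power2_eq_square algebra_simps)
  next
    case False
    have "z n * z m * M n m \<le> \<bar>z n\<bar> * \<bar>z m\<bar> * \<bar>M n m\<bar>" by (simp add: abs_mult[symmetric])
    also have "\<dots> \<le> \<bar>z n\<bar> * \<bar>z m\<bar> * (1 / N * sqrt (M n n * M m m))"
      using off[OF nm False] by (intro mult_left_mono) (auto simp: N_def)
    also have "sqrt (M n n * M m m) = sqrt (- M n n) * sqrt (- M m m)" by (simp add: real_sqrt_mult[symmetric])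
    finally show ?thesis using False by (simp add: t_def mult_ac)
  qed
  have "(\<Sum>n\<in>J. \<Sum>m\<in>J. z n * z m * M n m) \<le>
     (\<Sum>n\<in>J. \<Sum>m\<in>J. 1 / N * (t n * t m) - (if n = m then (1 + 1 / N) * (t n)\<^sup>2 else 0))"
    by (intro sum_mono le)
  also have "\<dots> = 1 / N * (\<Sum>n\<in>J. t n)\<^sup>2 - (1 + 1 / N) * (\<Sum>n\<in>J. (t n)\<^sup>2)"
  proof -
    have "(\<Sum>n\<in>J. \<Sum>m\<in>J. 1 / N * (t n * t m)) = 1 / N * (\<Sum>n\<in>J. t n)\<^sup>2"
      unfolding power2_eq_square sum_product by (simp only: sum_distrib_left)
    moreover have "(\<Sum>n\<in>J. \<Sum>m\<in>J. if n = m then (1 + 1 / N) * (t n)\<^sup>2 else 0) = (1 + 1 / N) * (\<Sum>n\<in>J. (t n)\<^sup>2)"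
      using J(1) by (simp add: sum_distrib_left)
    ultimately show ?thesis by (simp only: sum_subtractf)
  qed
  also have "\<dots> \<le> 1 / N * ((\<Sum>n\<in>J. (t n)\<^sup>2) * N) - (1 + 1 / N) * (\<Sum>n\<in>J. (t n)\<^sup>2)"
    using sum_squared_le_sum_of_squares[of t J] N by (intro diff_right_mono mult_left_mono) (auto simp: N_def)
  also have "\<dots> = - (1 / N * (\<Sum>n\<in>J. (t n)\<^sup>2))" using N by (simp add: algebra_simps)
  also have "\<dots> < 0"
  proof -
    obtain n where n: "n \<in> J" "z n \<noteq> 0" using z by blast
    have "(t n)\<^sup>2 > 0" using n diag[OF n(1)] by (simp add: t_def)
    then have "(\<Sum>n\<in>J. (t n)\<^sup>2) > 0" using J n by (intro sum_pos2[of J n]) auto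
    then show ?thesis using N by simp
  qed
  finally show ?thesis .
qed

section \<open>Test vectors\<close>

text \<open>The normalised indicator of a ball. A discontinuous bump is adequate because differences
  act on its position and end up on \<open>a\<close>, whose smoothness near 0 is what
  counts.\<close>

definition bump :: "real \<Rightarrow> 'a::euclidean_space \<Rightarrow> real" where
  "bump h x = indicator (ball 0 h) x / measure lborel (ball (0::'a) h)"

context
  fixes h :: real
  assumes h: "h > 0"
begin

lemma measure_ball_pos: "measure lborel (ball (0::'a::euclidean_space) h) > 0"
  using h by (simp add: content_ball)

lemma bump_measurable [measurable]: "bump h \<in> borel_measurable borel"
  unfolding bump_def[abs_def]
  by (intro borel_measurable_divide borel_measurable_indicator borel_measurable_const) simp

lemma
  fixes x :: "'a::euclidean_space"
  shows bump_nonneg: "0 \<le> bump h x" and bump_le: "bump h x \<le> 1 / measure lborel (ball (0::'a) h)"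
  using measure_ball_pos[where ?'a = 'a] by (auto simp: bump_def split: split_indicator)

lemma bump_eq_0: "h \<le> norm x \<Longrightarrow> bump h x = 0"
  by (simp add: bump_def)

lemma emeasure_ball_lt_top: "emeasure lborel (ball (0::'a::euclidean_space) h) < \<infinity>"
  by (rule emeasure_bounded_lt_top) auto

lemma integrable_bump: "integrable lborel (bump h :: 'a::euclidean_space \<Rightarrow> real)"
  unfolding bump_def[abs_def] using emeasure_ball_lt_top[where ?'a = 'a] by simp

lemma integral_bump: "(\<integral>x. bump h (x :: 'a::euclidean_space) \<partial>lborel) = 1"
  using measure_ball_pos[where ?'a = 'a] by (simp add: bump_def)

lemma integrable_bump_shift: "integrable lborel (\<lambda>x. bump h (x + t))" for t :: "'a::euclidean_space"
  by (subst integrable_shift) (auto intro: integrable_bump)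

lemma sq_int_bump: "sq_int (\<lambda>x. complex_of_real (bump h (x + t)))" for t :: "'a::euclidean_space"
proof (rule sq_int_bound)
  let ?K = "1 / measure lborel (ball (0::'a) h)"
  show "integrable lborel (\<lambda>x. ?K * bump h (x + t))" by (intro integrable_mult_right integrable_bump_shift)
  show "(cmod (complex_of_real (bump h (x + t))))\<^sup>2 \<le> ?K * bump h (x + t)" for x
    using mult_right_mono[OF bump_le bump_nonneg, of "x + t" "x + t"]
    by (simp add: norm_of_real power2_eq_square)
qed measurable

lemma bump_average:
  fixes f :: "'a::euclidean_space \<Rightarrow> real"
  assumes int: "integrable lborel (\<lambda>y. bump h y * f y)" and f: "\<And>y. norm y < h \<Longrightarrow> \<bar>f y - c\<bar> \<le> \<epsilon>"
  shows "\<bar>(\<integral>y. bump h y * f y \<partial>lborel) - c\<bar> \<le> \<epsilon>"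
proof -
  have ic: "integrable lborel (\<lambda>y::'a. bump h y * e)" for e using integrable_bump by auto
  have "(\<integral>y. bump h y * f y \<partial>lborel) - c = (\<integral>y. bump h y * f y \<partial>lborel) - (\<integral>y. bump h (y::'a) * c \<partial>lborel)"
    by (simp add: integral_bump)
  also have "\<dots> = (\<integral>y. bump h y * f y - bump h y * c \<partial>lborel)"
    by (rule Bochner_Integration.integral_diff[OF int ic, symmetric])
  finally have "\<bar>(\<integral>y. bump h y * f y \<partial>lborel) - c\<bar> \<le> (\<integral>y. \<bar>bump h y * f y - bump h y * c\<bar> \<partial>lborel)"
    by (simp add: integral_abs_bound)
  also have "\<dots> \<le> (\<integral>y. bump h (y::'a) * \<epsilon> \<partial>lborel)"
  proof (rule integral_mono)
    show "integrable lborel (\<lambda>y. \<bar>bump h y * f y - bump h y * c\<bar>)"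
      by (intro integrable_abs Bochner_Integration.integrable_diff int ic)
    show "\<bar>bump h y * f y - bump h y * c\<bar> \<le> bump h y * \<epsilon>" for y
    proof (cases "norm y < h")
      case True
      have "\<bar>bump h y * f y - bump h y * c\<bar> = bump h y * \<bar>f y - c\<bar>"
        by (simp add: right_diff_distrib[symmetric] abs_mult bump_nonneg)
      also have "\<dots> \<le> bump h y * \<epsilon>" by (intro mult_left_mono f True bump_nonneg)
      finally show ?thesis .
    qed (simp add: bump_eq_0)
  qed (rule ic)
  finally show ?thesis by (simp add: integral_bump)
qed

text \<open>The convolution form of two translated bumps as a function of the difference of their
  parameters; the real part comes from the real inner product.\<close>

definition smeared :: "('a::euclidean_space \<Rightarrow> complex) \<Rightarrow> 'a \<Rightarrow> real" where
  "smeared a t = (\<integral>x. bump h x * (\<integral>y. bump h y * Re (a (x - y + t)) \<partial>lborel) \<partial>lborel)"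

context
  fixes a :: "'a::euclidean_space \<Rightarrow> complex"
  assumes a: "integrable lborel a"
begin

lemma integrand_measurable [measurable]: "a \<in> borel_measurable borel"
  using borel_measurable_integrable[OF a] by simp

lemma smeared_inner_bound:
  shows "integrable lborel (\<lambda>y. bump h y * Re (a (x - y + t)))"
    and "\<bar>\<integral>y. bump h y * Re (a (x - y + t)) \<partial>lborel\<bar> \<le> 1 / measure lborel (ball (0::'a) h) * (\<integral>y. norm (a y) \<partial>lborel)"
proof -
  let ?K = "1 / measure lborel (ball (0::'a) h)"
  have ir: "integrable lborel (\<lambda>y. ?K * norm (a (x - y + t)))"
    using integrable_reflect[of "\<lambda>y. norm (a y)" "x + t"] a by (simp add: algebra_simps)
  have le: "\<bar>bump h y * Re (a (x - y + t))\<bar> \<le> ?K * norm (a (x - y + t))" for y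
    unfolding abs_mult abs_of_nonneg[OF bump_nonneg]
    by (intro mult_mono bump_le abs_Re_le_cmod) (auto simp: bump_nonneg)
  show i: "integrable lborel (\<lambda>y. bump h y * Re (a (x - y + t)))"
  proof (rule Bochner_Integration.integrable_bound[OF ir])
    show "AE y in lborel. norm (bump h y * Re (a (x - y + t))) \<le> norm (?K * norm (a (x - y + t)))"
      using le by (auto simp: abs_mult)
  qed measurable
  have "\<bar>\<integral>y. bump h y * Re (a (x - y + t)) \<partial>lborel\<bar> \<le> (\<integral>y. \<bar>bump h y * Re (a (x - y + t))\<bar> \<partial>lborel)"
    by (rule integral_abs_bound)
  also have "\<dots> \<le> (\<integral>y. ?K * norm (a (x - y + t)) \<partial>lborel)"
    by (rule integral_mono[OF integrable_abs[OF i] ir le])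
  also have "\<dots> = ?K * (\<integral>y. norm (a y) \<partial>lborel)"
    using integral_reflect[of "\<lambda>y. norm (a y)" "x + t"] by (simp add: algebra_simps)
  finally show "\<bar>\<integral>y. bump h y * Re (a (x - y + t)) \<partial>lborel\<bar> \<le> ?K * (\<integral>y. norm (a y) \<partial>lborel)" .
qed

lemma smeared_outer_integrable:
  "integrable lborel (\<lambda>x. bump h x * (\<integral>y. bump h y * Re (a (x - y + t)) \<partial>lborel))"
proof (rule Bochner_Integration.integrable_bound)
  let ?K = "1 / measure lborel (ball (0::'a) h) * (\<integral>y. norm (a y) \<partial>lborel)"
  show "integrable lborel (\<lambda>x::'a. bump h x * ?K)" using integrable_bump by auto
  show "AE x in lborel. norm (bump h x * (\<integral>y. bump h y * Re (a (x - y + t)) \<partial>lborel)) \<le> norm (bump h x * ?K)"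
  proof (rule AE_I2)
    fix x
    have "\<bar>bump h x\<bar> * \<bar>\<integral>y. bump h y * Re (a (x - y + t)) \<partial>lborel\<bar> \<le> \<bar>bump h x\<bar> * ?K"
      by (intro mult_left_mono smeared_inner_bound(2)) simp
    also have "\<dots> \<le> \<bar>bump h x\<bar> * \<bar>?K\<bar>" by (intro mult_left_mono) simp_all
    finally show "norm (bump h x * (\<integral>y. bump h y * Re (a (x - y + t)) \<partial>lborel)) \<le> norm (bump h x * ?K)"
      by (simp only: real_norm_def abs_mult)
  qed
qed measurable

text \<open>Differences commute with both averages, and the averages evaluate
  \<open>finite_diff k a\<close> only at differences of two points of the ball, hence within
  distance \<open>2 * h\<close> of 0.\<close>

lemma finite_diff_smeared:
  assumes "\<And>x. norm x < 2 * h \<Longrightarrow> \<bar>Re (finite_diff k a x) - c\<bar> \<le> \<epsilon>"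
  shows "\<bar>finite_diff k (smeared a) 0 - c\<bar> \<le> \<epsilon>"
proof -
  let ?G = "\<lambda>t x. \<integral>y. bump h y * Re (a (x - y + t)) \<partial>lborel"
  have Re: "finite_diff k (\<lambda>t. Re (a (s + t))) 0 = Re (finite_diff k a s)" for s
    using finite_diff_linear[of Re k a s] finite_diff_shift[of k "\<lambda>x. Re (a x)" s 0]
    by (simp add: linear_iff add.commute)
  have scale: "finite_diff k (\<lambda>t. c * g t) 0 = c * finite_diff k g (0::'a)" for c and g :: "'a \<Rightarrow> real"
    using finite_diff_scale[of k c g 0] by simp
  have G: "finite_diff k (\<lambda>t. ?G t x) 0 = (\<integral>y. bump h y * Re (finite_diff k a (x - y)) \<partial>lborel)" for x
    by (subst finite_diff_integral(2)[OF smeared_inner_bound(1)]) (simp only: scale Re)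
  have Gi: "integrable lborel (\<lambda>y. bump h y * Re (finite_diff k a (x - y)))" for x
    using finite_diff_integral(1)[of lborel "\<lambda>t y. bump h y * Re (a (x - y + t))" k 0, OF smeared_inner_bound(1)]
    by (simp only: scale Re)
  have S: "finite_diff k (smeared a) 0 = (\<integral>x. bump h x * (\<integral>y. bump h y * Re (finite_diff k a (x - y)) \<partial>lborel) \<partial>lborel)"
    unfolding smeared_def[abs_def]
    by (subst finite_diff_integral(2)[OF smeared_outer_integrable]) (simp only: scale G)
  have Si: "integrable lborel (\<lambda>x. bump h x * (\<integral>y. bump h y * Re (finite_diff k a (x - y)) \<partial>lborel))"
    using finite_diff_integral(1)[of lborel "\<lambda>t x. bump h x * ?G t x" k 0, OF smeared_outer_integrable]
    by (simp only: scale G)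
  show ?thesis unfolding S
  proof (rule bump_average[OF Si], rule bump_average[OF Gi])
    fix x y :: 'a assume "norm x < h" "norm y < h"
    then have "norm (x - y) < 2 * h" using norm_triangle_ineq4[of x y] by linarith
    then show "\<bar>Re (finite_diff k a (x - y)) - c\<bar> \<le> \<epsilon>" by (rule assms)
  qed
qed

end

definition bump_vec :: "'a::euclidean_space \<Rightarrow> 'a l2" where
  "bump_vec z = abs_l2 (\<lambda>x. complex_of_real (bump h (x + z)))"

lemma conv_form_bump_vec:
  fixes a :: "'a::euclidean_space \<Rightarrow> complex"
  assumes a: "integrable lborel a"
  shows "kernel_op (\<lambda>x y. a (x - y)) (bump_vec z) \<bullet> bump_vec w = smeared a (z - w)"
proof -
  note [measurable] = integrand_measurable[OF a]
  have "kernel_op (\<lambda>x y. a (x - y)) (bump_vec z) \<bullet> bump_vec w =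
    (\<integral>x. (\<integral>y. (a (x - y) * of_real (bump h (y + z))) \<bullet> of_real (bump h (x + w)) \<partial>lborel) \<partial>lborel)"
    unfolding bump_vec_def by (rule inner_kernel_op_abs[OF schur_kernel_conv[OF a] sq_int_bump sq_int_bump])
  \<comment> \<open>The argument \<open>x - y\<close> is written in terms of \<open>x + w\<close>
    and \<open>y + z\<close>, the arguments of the two bumps; translating both variables then leaves
    only \<open>z - w\<close>.\<close>
  also have "\<dots> = (\<integral>x. (\<integral>y. bump h (x + w) * (bump h (y + z) * Re (a ((x + w) - (y + z) + (z - w)))) \<partial>lborel) \<partial>lborel)"
    by (intro Bochner_Integration.integral_cong refl) (simp add: inner_complex_def mult_ac)
  also have "\<dots> = (\<integral>x. bump h (x + w) * (\<integral>y. bump h y * Re (a ((x + w) - y + (z - w))) \<partial>lborel) \<partial>lborel)"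
  proof (intro Bochner_Integration.integral_cong refl)
    fix x
    show "(\<integral>y. bump h (x + w) * (bump h (y + z) * Re (a ((x + w) - (y + z) + (z - w)))) \<partial>lborel) =
      bump h (x + w) * (\<integral>y. bump h y * Re (a ((x + w) - y + (z - w))) \<partial>lborel)"
      using integral_shift[of "\<lambda>y. bump h y * Re (a ((x + w) - y + (z - w)))" z]
      by (simp only: integral_mult_right_zero) simp
  qed
  also have "\<dots> = smeared a (z - w)"
    unfolding smeared_def
    by (rule integral_shift[of "\<lambda>x. bump h x * (\<integral>y. bump h y * Re (a (x - y + (z - w))) \<partial>lborel)"]) measurable
  finally show ?thesis .
qed

text \<open>On the support of one bump the potential is at most \<open>B\<close> and the bump at
  most its height; the other bump has integral 1.\<close>

lemma mult_form_bump_vec_bound: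
  fixes W :: "'a::euclidean_space \<Rightarrow> complex"
  assumes [measurable]: "W \<in> borel_measurable borel" and WC: "\<And>x. norm (W x) \<le> C"
    and B: "\<And>x. norm (x + z) < h \<Longrightarrow> norm (W x) \<le> B" "B \<ge> 0"
  shows "\<bar>mult_op W (bump_vec z) \<bullet> bump_vec w\<bar> \<le> B / measure lborel (ball (0::'a) h)"
proof -
  let ?K = "1 / measure lborel (ball (0::'a) h)"
  have "mult_op W (bump_vec z) \<bullet> bump_vec w =
     (\<integral>x. (W x * of_real (bump h (x + z))) \<bullet> of_real (bump h (x + w)) \<partial>lborel)"
    unfolding inner_mult_op[of W, OF _ WC, simplified]
  proof (rule integral_cong_AE)
    show "AE x in lborel. (W x * rep_l2 (bump_vec z) x) \<bullet> rep_l2 (bump_vec w) x =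
       (W x * of_real (bump h (x + z))) \<bullet> of_real (bump h (x + w))"
      using rep_abs_l2[OF sq_int_bump[of z]] rep_abs_l2[OF sq_int_bump[of w]]
      unfolding bump_vec_def by eventually_elim simp
  qed measurable
  also have "\<bar>\<dots>\<bar> \<le> (\<integral>x. \<bar>(W x * of_real (bump h (x + z))) \<bullet> of_real (bump h (x + w))\<bar> \<partial>lborel)"
    by (rule integral_abs_bound)
  also have "\<dots> \<le> (\<integral>x. B * ?K * bump h (x + w) \<partial>lborel)"
  proof (rule integral_mono)
    show "integrable lborel (\<lambda>x. \<bar>(W x * of_real (bump h (x + z))) \<bullet> of_real (bump h (x + w))\<bar>)"
      by (intro integrable_abs sq_int_inner sq_int_mult_bounded[where C=C] sq_int_bump WC) measurable
    show "integrable lborel (\<lambda>x. B * ?K * bump h (x + w))" by (intro integrable_mult_right integrable_bump_shift)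
    fix x
    have e: "\<bar>(W x * of_real (bump h (x + z))) \<bullet> of_real (bump h (x + w))\<bar> = \<bar>Re (W x)\<bar> * bump h (x + z) * bump h (x + w)"
      by (simp add: inner_complex_def abs_mult bump_nonneg)
    have "\<bar>Re (W x)\<bar> * bump h (x + z) \<le> B * ?K"
    proof (cases "norm (x + z) < h")
      case True
      then show ?thesis
        using B(1)[OF True] abs_Re_le_cmod[of "W x"] B(2) bump_le[of "x + z"] bump_nonneg[of "x + z"]
        by (intro mult_mono) auto
    next
      case False
      then show ?thesis using B(2) measure_ball_pos[where ?'a = 'a] by (simp add: bump_eq_0)
    qed
    then show "\<bar>(W x * of_real (bump h (x + z))) \<bullet> of_real (bump h (x + w))\<bar> \<le> B * ?K * bump h (x + w)"
      unfolding e by (intro mult_right_mono bump_nonneg)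
  qed
  also have "\<dots> = B * ?K"
    using integral_shift[of "bump h" w] by (simp add: integral_bump)
  finally show ?thesis by simp
qed

end

definition coord_steps :: "real \<Rightarrow> 'n list \<Rightarrow> ((real ^ 'n) \<times> real) list" where
  "coord_steps h is = axis_steps (map (\<lambda>i. (i, h)) is)"

text \<open>The base point is \<open>- x0\<close> because \<^term>\<open>bump_vec h z\<close> is centred at \<open>- z\<close>.\<close>

definition test_vec :: "real ^ 'n \<Rightarrow> real \<Rightarrow> 'n list \<Rightarrow> (real ^ 'n) l2" where
  "test_vec x0 h is = finite_diff (coord_steps h is) (bump_vec h) (- x0)"

lemma set_coord_steps: "p \<in> set (coord_steps h is) \<Longrightarrow> norm (fst p) = 1 \<and> snd p = h"
  by (auto simp: coord_steps_def axis_steps_def norm_axis_1)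

lemma length_coord_steps [simp]: "length (coord_steps h is) = length is"
  by (simp add: coord_steps_def)

lemma linear_form_finite_diff:
  assumes "linear G"
  shows "G (finite_diff l f x) \<bullet> finite_diff l' g y = finite_diff l (\<lambda>z. finite_diff l' (\<lambda>w. G (f z) \<bullet> g w) y) x"
proof -
  have 1: "linear (\<lambda>u. G u \<bullet> finite_diff l' g y)"
    using assms by (auto simp: linear_iff inner_add_left)
  have 2: "linear (\<lambda>v. G u \<bullet> v)" for u
    by (auto simp: linear_iff inner_add_right)
  show ?thesis by (subst finite_diff_linear[OF 1]) (simp only: finite_diff_linear[OF 2])
qed

text \<open>The differences in both parameters of \<open>smeared h a (z - w)\<close> combine into
  one difference at 0, with forward steps for \<open>is\<close> and, after reflection, backward
  steps for \<open>is'\<close>. Its directions are those of \<open>js\<close>, so it approaches the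
  derivative \<open>c\<close>.\<close>

lemma conv_form_test_vec_tendsto:
  fixes a :: "real ^ 'n \<Rightarrow> complex"
  assumes a: "integrable lborel a" and js: "mset js = mset is + mset is'"
    and near: "\<And>\<epsilon>. \<epsilon> > 0 \<Longrightarrow> \<exists>\<rho>>0. \<forall>k x. mset (map fst k) = mset js \<longrightarrow> (\<forall>p\<in>set k. snd p \<noteq> 0) \<longrightarrow>
       norm x + (\<Sum>p\<leftarrow>k. \<bar>snd p\<bar>) < \<rho> \<longrightarrow> norm (finite_diff (axis_steps k) a x - c) \<le> \<epsilon>"
  shows "((\<lambda>h. kernel_op (\<lambda>x y. a (x - y)) (test_vec x0 h is) \<bullet> test_vec x0 h is')
     \<longlongrightarrow> (- 1) ^ length is' * Re c) (at_right 0)"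
proof (rule tendstoI)
  fix e :: real assume e: "e > 0"
  then have "e / 2 > 0" by simp
  from near[OF this] obtain \<rho> where \<rho>: "\<rho> > 0"
    "\<And>k x. mset (map fst k) = mset js \<Longrightarrow> (\<forall>p\<in>set k. snd p \<noteq> 0) \<Longrightarrow>
       norm x + (\<Sum>p\<leftarrow>k. \<bar>snd p\<bar>) < \<rho> \<Longrightarrow> norm (finite_diff (axis_steps k) a x - c) \<le> e / 2" by blast
  \<comment> \<open>All steps together reach at most the number of steps times \<open>h\<close>, and
    smearing displaces the base point by less than \<open>2 * h\<close>.\<close>
  define q where "q = real (length is + length is') + 2"
  have q: "q > 0" by (simp add: q_def)
  have "dist (kernel_op (\<lambda>x y. a (x - y)) (test_vec x0 h is) \<bullet> test_vec x0 h is') ((- 1) ^ length is' * Re c) < e"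
    if h: "h > 0" "h < \<rho> / q" for h
  proof -
    define k where "k = map (\<lambda>i. (i, h)) is @ map (\<lambda>i. (i, - h)) is'"
    have k: "axis_steps k = coord_steps h is @ reverse_steps (coord_steps h is')"
      by (simp add: k_def coord_steps_def reverse_steps_def axis_steps_def)
    have A: "linear (kernel_op (\<lambda>x y. a (x - y)))"
      using bounded_linear_kernel_op[OF schur_kernel_conv[OF a]] by (rule bounded_linear.linear)
    have 0: "finite_diff (coord_steps h is') (\<lambda>w. smeared h a (z - w)) (- x0) =
       (- 1) ^ length is' *\<^sub>R finite_diff (reverse_steps (coord_steps h is')) (smeared h a) (z + x0)" for z
      using finite_diff_reflect[of "coord_steps h is'" "smeared h a" z "- x0"] by simp
    have "kernel_op (\<lambda>x y. a (x - y)) (test_vec x0 h is) \<bullet> test_vec x0 h is' =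
      finite_diff (coord_steps h is) (\<lambda>z. finite_diff (coord_steps h is') (\<lambda>w. smeared h a (z - w)) (- x0)) (- x0)"
      unfolding test_vec_def linear_form_finite_diff[OF A] conv_form_bump_vec[OF h(1) a] ..
    also have "\<dots> = (- 1) ^ length is' *\<^sub>R finite_diff (coord_steps h is)
       (\<lambda>z. finite_diff (reverse_steps (coord_steps h is')) (smeared h a) (z + x0)) (- x0)"
      unfolding 0 by (rule finite_diff_scale)
    also have "\<dots> = (- 1) ^ length is' * finite_diff (axis_steps k) (smeared h a) 0"
      using finite_diff_shift[of "coord_steps h is" "finite_diff (reverse_steps (coord_steps h is')) (smeared h a)" x0 "- x0"]
      by (simp add: k finite_diff_append)
    finally have eq: "kernel_op (\<lambda>x y. a (x - y)) (test_vec x0 h is) \<bullet> test_vec x0 h is' =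
      (- 1) ^ length is' * finite_diff (axis_steps k) (smeared h a) 0" .
    have "\<bar>finite_diff (axis_steps k) (smeared h a) 0 - Re c\<bar> \<le> e / 2"
    proof (rule finite_diff_smeared[OF h(1) a])
      fix x :: "real ^ 'n" assume x: "norm x < 2 * h"
      have "(\<Sum>p\<leftarrow>k. \<bar>snd p\<bar>) = real (length is + length is') * h"
        using h(1) by (simp add: k_def o_def sum_list_triv distrib_right)
      then have "norm x + (\<Sum>p\<leftarrow>k. \<bar>snd p\<bar>) < q * h" using x by (simp add: q_def distrib_right)
      also have "q * h < \<rho>" using h(2) q by (simp add: pos_less_divide_eq mult.commute)
      finally have "norm (finite_diff (axis_steps k) a x - c) \<le> e / 2"
        using h(1) js by (intro \<rho>(2)) (auto simp: k_def o_def)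
      then show "\<bar>Re (finite_diff (axis_steps k) a x) - Re c\<bar> \<le> e / 2"
        using abs_Re_le_cmod[of "finite_diff (axis_steps k) a x - c"] by simp
    qed
    then show ?thesis
      unfolding eq dist_real_def right_diff_distrib[symmetric] abs_mult using e by (simp add: power_abs)
  qed
  then show "\<forall>\<^sub>F h in at_right 0. dist (kernel_op (\<lambda>x y. a (x - y)) (test_vec x0 h is) \<bullet> test_vec x0 h is')
      ((- 1) ^ length is' * Re c) < e"
    unfolding eventually_at_right_field using \<rho>(1) q by (intro exI[of _ "\<rho> / q"]) auto
qed

text \<open>A count of powers of \<open>h\<close>: the differences cost one for each step, the
  height of the bump one for each dimension, and flatness of an order higher by one leaves a factor
  \<open>h\<close>.\<close>

lemma mult_form_test_vec_tendsto:
  fixes W :: "real ^ 'n \<Rightarrow> complex"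
  assumes [measurable]: "W \<in> borel_measurable borel" and WC: "\<And>x. norm (W x) \<le> C"
    and flat: "\<And>\<alpha>::real. \<alpha> > 0 \<Longrightarrow> \<exists>K>0. \<forall>\<^sub>F x in nhds x0. norm (W x) \<le> K * norm (x - x0) powr \<alpha>"
  shows "((\<lambda>h. mult_op W (test_vec x0 h is) \<bullet> test_vec x0 h is') \<longlongrightarrow> 0) (at_right 0)"
proof -
  let ?d = "CARD('n)"
  define p where "p = length is + length is'"
  \<comment> \<open>The parameter of the first bump wanders by at most \<open>length is\<close>
    steps from \<open>- x0\<close>, and the radius of the bump adds one more \<open>h\<close>.
    Bounding \<open>W\<close> on the support of this bump is enough for the product.\<close>
  define q where "q = real (length is) + 1"
  have q: "q > 0" by (simp add: q_def)
  \<comment> \<open>The total order of the differences plus the dimension is the loss to be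
    compensated; the 1 is the gain.\<close>
  define \<alpha> where "\<alpha> = real (p + ?d + 1)"
  obtain K where K: "K > 0" "\<forall>\<^sub>F x in nhds x0. norm (W x) \<le> K * norm (x - x0) powr \<alpha>"
    using flat[of \<alpha>] by (auto simp: \<alpha>_def)
  then obtain d where d: "d > 0" "\<And>x. dist x x0 < d \<Longrightarrow> norm (W x) \<le> K * norm (x - x0) powr \<alpha>"
    by (auto simp: eventually_nhds_metric)
  define v where "v = unit_ball_vol (real ?d)"
  have v: "v > 0" by (simp add: v_def)
  define D where "D = 2 ^ p * K * q powr \<alpha> / v"
  have "\<bar>mult_op W (test_vec x0 h is) \<bullet> test_vec x0 h is'\<bar> \<le> D * h" if h: "h > 0" "h < d / q" for h
  proof -
    have lin: "linear (mult_op W)"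
      by (rule bounded_linear.linear[OF bounded_linear_mult_op[OF _ WC]]) measurable
    define B where "B = K * (q * h) powr \<alpha>"
    have B: "B \<ge> 0" using K by (simp add: B_def)
    have vol: "measure lborel (ball (0 :: real ^ 'n) h) = v * h ^ ?d"
      using h by (simp add: content_ball v_def)
    have "norm (finite_diff (coord_steps h is) (\<lambda>z. finite_diff (coord_steps h is') (\<lambda>w. mult_op W (bump_vec h z) \<bullet> bump_vec h w) (- x0)) (- x0))
      \<le> (2 / h) ^ length (coord_steps h is) * ((2 / h) ^ length (coord_steps h is') * (B / (v * h ^ ?d)))"
    proof (rule norm_finite_diff_le[OF _ h(1)])
      show "norm (fst s) = 1 \<and> \<bar>snd s\<bar> = h" if "s \<in> set (coord_steps h is)" for s
        using set_coord_steps[OF that] h by auto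
      fix z :: "real ^ 'n" assume z: "norm (z - - x0) \<le> real (length (coord_steps h is)) * h"
      show "norm (finite_diff (coord_steps h is') (\<lambda>w. mult_op W (bump_vec h z) \<bullet> bump_vec h w) (- x0))
        \<le> (2 / h) ^ length (coord_steps h is') * (B / (v * h ^ ?d))"
      proof (rule norm_finite_diff_le[OF _ h(1)])
        show "norm (fst s) = 1 \<and> \<bar>snd s\<bar> = h" if "s \<in> set (coord_steps h is')" for s
          using set_coord_steps[OF that] h by auto
        fix w :: "real ^ 'n"
        have "\<bar>mult_op W (bump_vec h z) \<bullet> bump_vec h w\<bar> \<le> B / measure lborel (ball (0 :: real ^ 'n) h)"
        proof (rule mult_form_bump_vec_bound[OF h(1) _ WC _ B])
          fix x :: "real ^ 'n" assume x: "norm (x + z) < h"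
          have "norm (x - x0) \<le> norm (x + z) + norm (z - - x0)"
            using norm_triangle_ineq4[of "x + z" "z + x0"] by simp
          also have "\<dots> < q * h" using x z by (simp add: q_def distrib_right)
          finally have xq: "norm (x - x0) < q * h" .
          also have "q * h < d" using h(2) q by (simp add: pos_less_divide_eq mult.commute)
          finally have "norm (W x) \<le> K * norm (x - x0) powr \<alpha>" by (intro d(2)) (simp add: dist_norm)
          also have "\<dots> \<le> B" unfolding B_def
            using K xq by (intro mult_left_mono powr_mono2) (auto simp: \<alpha>_def)
          finally show "norm (W x) \<le> B" .
        qed measurable
        then show "norm (mult_op W (bump_vec h z) \<bullet> bump_vec h w) \<le> B / (v * h ^ ?d)" by (simp add: vol)
      qed
    qed
    also have "\<dots> = (2 / h) ^ p * (B / (v * h ^ ?d))"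
      by (simp add: p_def power_add)
    also have "B = K * q powr \<alpha> * h ^ (p + ?d + 1)"
    proof -
      have "h powr \<alpha> = h ^ (p + ?d + 1)" unfolding \<alpha>_def by (rule powr_realpow[OF h(1)])
      then show ?thesis using q h by (simp add: B_def powr_mult)
    qed
    also have "(2 / h) ^ p * (K * q powr \<alpha> * h ^ (p + ?d + 1) / (v * h ^ ?d)) = D * h"
      using h v by (simp add: D_def power_add power_divide field_simps)
    finally show ?thesis
      unfolding test_vec_def linear_form_finite_diff[OF lin] real_norm_def .
  qed
  then have "\<forall>\<^sub>F h in at_right 0. norm (mult_op W (test_vec x0 h is) \<bullet> test_vec x0 h is') \<le> D * h"
    unfolding eventually_at_right_field using d(1) q by (intro exI[of _ "d / q"]) auto
  moreover have "((\<lambda>h. D * h) \<longlongrightarrow> 0) (at_right 0)"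
    using tendsto_mult_right_zero[of "\<lambda>h. h" "at_right 0" D] tendsto_ident_at[of 0 "{0<..}"] by simp
  ultimately show ?thesis by (rule Lim_null_comparison)
qed

lemma finite_diff_cong:
  assumes "\<And>y. norm (y - x) \<le> total_step l \<Longrightarrow> f y = g y" and "\<And>p. p \<in> set l \<Longrightarrow> norm (fst p) = 1"
  shows "finite_diff l f x = finite_diff l g x"
  using assms
proof (induction l arbitrary: x)
  case (Cons p l)
  have "finite_diff l f x = finite_diff l g x"
    using Cons.prems by (intro Cons.IH) auto
  moreover have "finite_diff l f (x + snd p *\<^sub>R fst p) = finite_diff l g (x + snd p *\<^sub>R fst p)"
  proof (rule Cons.IH)
    fix y assume "norm (y - (x + snd p *\<^sub>R fst p)) \<le> total_step l"
    moreover have "norm (y - x) \<le> norm (y - (x + snd p *\<^sub>R fst p)) + norm (snd p *\<^sub>R fst p)"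
      using norm_triangle_ineq[of "y - (x + snd p *\<^sub>R fst p)" "snd p *\<^sub>R fst p"] by simp
    ultimately show "f y = g y" using Cons.prems(2)[of p] by (intro Cons.prems(1)) auto
  qed (use Cons.prems(2) in auto)
  ultimately show ?case by (simp add: finite_diff_Cons)
qed simp

text \<open>A central difference of even order is real because the list of its steps is invariant, up to
  order, under reversal of all steps.\<close>

lemma even_partial_real:
  fixes a :: "real ^ 'n \<Rightarrow> complex"
  assumes herm: "\<And>x. a (- x) = cnj (a x)" and js: "mset js = mset is + mset is"
    and near: "\<And>\<epsilon>. \<epsilon> > 0 \<Longrightarrow> \<exists>\<rho>>0. \<forall>k x. mset (map fst k) = mset js \<longrightarrow> (\<forall>p\<in>set k. snd p \<noteq> 0) \<longrightarrow>
       norm x + (\<Sum>p\<leftarrow>k. \<bar>snd p\<bar>) < \<rho> \<longrightarrow> norm (finite_diff (axis_steps k) a x - c) \<le> \<epsilon>"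
  shows "Im c = 0"
proof (rule ccontr)
  assume "Im c \<noteq> 0"
  then have "\<bar>Im c\<bar> / 2 > 0" by simp
  from near[OF this] obtain \<rho> where \<rho>: "\<rho> > 0"
    "\<And>k x. mset (map fst k) = mset js \<Longrightarrow> (\<forall>p\<in>set k. snd p \<noteq> 0) \<Longrightarrow>
       norm x + (\<Sum>p\<leftarrow>k. \<bar>snd p\<bar>) < \<rho> \<Longrightarrow> norm (finite_diff (axis_steps k) a x - c) \<le> \<bar>Im c\<bar> / 2" by blast
  \<comment> \<open>The summand 1 keeps \<open>q\<close> positive for the empty list, and
    \<open>h\<close> is then small enough that all steps together stay below
    \<open>\<rho>\<close>.\<close>
  define q where "q = 2 * real (length is) + 1"
  define h where "h = \<rho> / (2 * q)"
  have q: "q > 0" by (simp add: q_def)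
  have h: "h > 0" "q * h < \<rho>" using \<rho>(1) q by (simp_all add: h_def)
  define k where "k = map (\<lambda>i. (i, h)) is @ map (\<lambda>i. (i, - h)) is"
  have "(\<Sum>p\<leftarrow>k. \<bar>snd p\<bar>) \<le> q * h"
    using h(1) by (simp add: k_def o_def sum_list_triv q_def distrib_right)
  then have b: "norm (finite_diff (axis_steps k) a 0 - c) \<le> \<bar>Im c\<bar> / 2"
    using h js by (intro \<rho>(2)) (auto simp: k_def o_def)
  let ?D = "finite_diff (axis_steps k) a 0"
  have rev: "mset (reverse_steps (axis_steps k)) = mset (axis_steps k)"
    by (simp add: k_def reverse_steps_def axis_steps_def o_def)
  have "finite_diff (axis_steps k) (\<lambda>w. a (0 - w)) 0 = (- 1) ^ length k *\<^sub>R finite_diff (reverse_steps (axis_steps k)) a (0 - 0)"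
    using finite_diff_reflect[of "axis_steps k" a 0 0] by simp
  also have "\<dots> = ?D" using finite_diff_perm[OF rev, where ?'b = complex] by (simp add: k_def)
  finally have "finite_diff (axis_steps k) (\<lambda>w. cnj (a w)) 0 = ?D" by (simp add: herm)
  moreover have "linear cnj" by (simp add: linear_iff)
  ultimately have "cnj ?D = ?D" using finite_diff_linear[of cnj "axis_steps k" a 0] by simp
  then have "Im ?D = 0" by (metis cnj.simps(2) equal_neg_zero)
  then have "\<bar>Im c\<bar> \<le> norm (?D - c)" using abs_Im_le_cmod[of "?D - c"] by simp
  with b \<open>Im c \<noteq> 0\<close> show False by simp
qed

section \<open>From Lebesgue measurable data to Borel representatives\<close>

lemma continuous_AE_eq:
  fixes f g :: "'a::euclidean_space \<Rightarrow> 'b::real_normed_vector"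
  assumes S: "open S" and f: "continuous_on S f" and g: "continuous_on S g"
    and ae: "AE x in lborel. x \<in> S \<longrightarrow> f x = g x" and x: "x \<in> S"
  shows "f x = g x"
proof (rule ccontr)
  assume ne: "f x \<noteq> g x"
  let ?N = "{y \<in> S. f y - g y \<in> - {0}}"
  have "open (S \<inter> (\<lambda>y. f y - g y) -` (- {0}))"
    by (rule continuous_open_preimage) (auto intro!: continuous_intros f g S)
  then have op: "open ?N" by (simp add: vimage_def Int_def)
  have "AE y in lborel. y \<notin> ?N" using ae by eventually_elim auto
  then have "?N \<in> null_sets lborel" using op by (subst AE_iff_null_sets) auto
  then have "?N = {}" using op
    by (metis negligible_iff_null_sets null_sets_completionI open_not_negligible)
  with x ne show False by auto
qed

text \<open>Three demands have to be met at once: Borel measurability, the hermitian symmetry at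
  every point, and exact agreement with \<open>f\<close> on \<open>S\<close>, where derivatives are
  taken. So \<open>f\<close> is kept on \<open>S\<close>, any Borel version is used elsewhere, and
  the result is symmetrised; this leaves \<open>f\<close> unchanged on \<open>S\<close> because
  continuity promotes the symmetry there from almost every point to every point.\<close>

lemma hermitian_borel_representative:
  fixes f :: "'a::euclidean_space \<Rightarrow> complex"
  assumes f: "integrable lebesgue f" and herm: "AE x in lborel. f (- x) = cnj (f x)"
    and S: "open S" "continuous_on S f" and sym: "\<And>x. x \<in> S \<Longrightarrow> - x \<in> S"
  shows "\<exists>g. integrable lborel g \<and> (\<forall>x. g (- x) = cnj (g x)) \<and> (AE x in lborel. f x = g x) \<and> (\<forall>x\<in>S. g x = f x)"
proof -
  have fm: "f \<in> borel_measurable lebesgue" using f by auto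
  have "(\<lambda>x. Re (f x)) \<in> borel_measurable lebesgue" "(\<lambda>x. Im (f x)) \<in> borel_measurable lebesgue"
    using fm by measurable
  then obtain g1 g2 where g12[measurable]: "g1 \<in> borel_measurable lborel" "g2 \<in> borel_measurable lborel"
    and ae12: "AE x in lborel. Re (f x) = g1 x" "AE x in lborel. Im (f x) = g2 x"
    using completion_ex_borel_measurable_real by metis
  have [measurable]: "S \<in> sets borel" using S by auto
  have [measurable]: "(\<lambda>x. indicator S x *\<^sub>R f x) \<in> borel_measurable borel"
    by (rule borel_measurable_continuous_on_indicator) (use S in auto)
  define b where "b x = indicator S x *\<^sub>R f x + indicator (- S) x *\<^sub>R (of_real (g1 x) + \<i> * of_real (g2 x))" for x
  have [measurable]: "b \<in> borel_measurable borel" using g12 unfolding b_def[abs_def] by measurable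
  have fb: "AE x in lborel. f x = b x"
    using ae12 by eventually_elim (auto simp: b_def complex_eq_iff split: split_indicator)
  have fb': "AE x in lborel. f (- x) = b (- x)"
    using AE_reflect[OF fb, of "-1" 0] by simp
  have fS: "f (- x) = cnj (f x)" if "x \<in> S" for x
  proof (rule continuous_AE_eq[OF S(1) _ _ _ that])
    show "continuous_on S (\<lambda>x. f (- x))"
      by (rule continuous_on_compose2[OF S(2)]) (auto intro!: continuous_intros sym)
    show "continuous_on S (\<lambda>x. cnj (f x))" by (intro continuous_intros S)
    show "AE x in lborel. x \<in> S \<longrightarrow> f (- x) = cnj (f x)" using herm by eventually_elim simp
  qed
  define g where "g x = (b x + cnj (b (- x))) / 2" for x
  have [measurable]: "g \<in> borel_measurable borel" unfolding g_def[abs_def] by measurable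
  have fg: "AE x in lborel. f x = g x"
    using fb fb' herm by eventually_elim (simp add: g_def, metis complex_cnj_cnj)
  have gS: "g x = f x" if "x \<in> S" for x
    using that sym[OF that] fS[OF that] by (simp add: g_def b_def)
  have gl: "g \<in> borel_measurable lebesgue" by (rule measurable_completion) simp
  have "integrable lebesgue g"
    by (rule integrable_cong_AE_imp[OF f gl]) (use fg in \<open>auto simp: AE_completion_iff eq_commute\<close>)
  then have "integrable lborel g" by (simp add: integrable_completion)
  moreover have "g (- x) = cnj (g x)" for x by (simp add: g_def add.commute)
  ultimately show ?thesis using fg gS by blast
qed

lemma lebesgue_integral_AE_borel:
  fixes f g k :: "'a::euclidean_space \<Rightarrow> complex"
  assumes f: "f \<in> borel_measurable lebesgue" and [measurable]: "g \<in> borel_measurable borel" "k \<in> borel_measurable borel"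
    and ae: "AE x in lborel. f x = g x"
  shows "(\<integral>x. f x * k x \<partial>lebesgue) = (\<integral>x. g x * k x \<partial>lborel)"
proof -
  have k: "k \<in> borel_measurable lebesgue" by (rule measurable_completion) simp
  have gk: "(\<lambda>x. g x * k x) \<in> borel_measurable lborel" by measurable
  have "(\<integral>x. f x * k x \<partial>lebesgue) = (\<integral>x. g x * k x \<partial>lebesgue)"
  proof (rule integral_cong_AE)
    show "(\<lambda>x. f x * k x) \<in> borel_measurable lebesgue" using f k by measurable
    show "(\<lambda>x. g x * k x) \<in> borel_measurable lebesgue" using gk by (rule measurable_completion)
    show "AE x in lebesgue. f x * k x = g x * k x"
      using ae by (auto simp: AE_completion_iff elim!: eventually_mono)
  qed
  also have "\<dots> = (\<integral>x. g x * k x \<partial>lborel)" by (rule integral_completion[OF gk])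
  finally show ?thesis .
qed

lemma lebesgue_measurable_reflect:
  fixes f :: "'a::euclidean_space \<Rightarrow> complex"
  assumes "f \<in> borel_measurable lebesgue"
  shows "(\<lambda>y. f (x - y)) \<in> borel_measurable lebesgue"
proof -
  have "(\<lambda>y::'a. x + (\<Sum>j\<in>Basis. (-1 * (y \<bullet> j)) *\<^sub>R j)) \<in> lebesgue \<rightarrow>\<^sub>M lebesgue"
    by (rule lebesgue_affine_measurable) simp
  moreover have "x + (\<Sum>j\<in>Basis. (-1 * (y \<bullet> j)) *\<^sub>R j) = x - y" for y
    by (simp add: sum_negf euclidean_representation)
  ultimately show ?thesis using measurable_compose[OF _ assms] by simp
qed

section \<open>The convolution operator with a potential\<close>

lemma fourier_eq_ft:
  assumes f: "integrable lebesgue f" and g: "integrable lborel g" and ae: "AE x in lborel. f x = g x"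
  shows "fourier f = ft g"
proof
  fix x
  have [measurable]: "g \<in> borel_measurable borel" using borel_measurable_integrable[OF g] by simp
  show "fourier f x = ft g x"
    unfolding fourier_def ft_def
    by (rule lebesgue_integral_AE_borel[OF _ _ _ ae]) (use f in auto)
qed

text \<open>The operator of the statement integrates the Lebesgue measurable \<open>a\<close>
  itself. For every fixed \<open>x\<close> the functions \<open>a (x - y)\<close> and
  \<open>g (x - y)\<close> agree for almost every \<open>y\<close>, so the two convolutions coincide
  at each \<open>x\<close>.\<close>

lemma L2_eigenvalue_of_l2:
  fixes a V g :: "real ^ 'n \<Rightarrow> complex"
  assumes a: "integrable lebesgue a" and g: "integrable lborel g" and ae: "AE x in lborel. a x = g x"
    and Vm[measurable]: "V \<in> borel_measurable borel" and V: "\<And>x. norm (V x) \<le> C"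
    and u: "u \<noteq> 0" "kernel_op (\<lambda>x y. g (x - y)) u + mult_op V u = \<kappa> *\<^sub>R u"
  shows "L2_eigenvalue (conv_potential_op a V) (complex_of_real \<kappa>)"
  unfolding L2_eigenvalue_def
proof (intro bexI conjI)
  have [measurable]: "g \<in> borel_measurable borel" using borel_measurable_integrable[OF g] by simp
  have conv: "(\<integral>y. a (x - y) * rep_l2 u y \<partial>lebesgue) = (\<integral>y. g (x - y) * rep_l2 u y \<partial>lborel)" for x
  proof (rule lebesgue_integral_AE_borel)
    show "(\<lambda>y. a (x - y)) \<in> borel_measurable lebesgue" by (rule lebesgue_measurable_reflect) (use a in auto)
    show "AE y in lborel. a (x - y) = g (x - y)" using AE_reflect[OF ae, of "-1" x] by simp
  qed measurable
  have "AE x in lborel. conv_potential_op a V (rep_l2 u) x = complex_of_real \<kappa> * rep_l2 u x"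
    using rep_kernel_op[OF schur_kernel_conv[OF g], of u] rep_mult_op[OF Vm V, of u]
      rep_plus_l2[of "kernel_op (\<lambda>x y. g (x - y)) u" "mult_op V u"] rep_scaleR_l2[of \<kappa> u]
    unfolding u(2)
    by eventually_elim (simp add: conv_potential_op_def conv scaleR_conv_of_real)
  then show "AE x in lebesgue. conv_potential_op a V (rep_l2 u) x = complex_of_real \<kappa> * rep_l2 u x"
    by (simp add: AE_completion_iff)
  show "\<not> (AE x in lebesgue. rep_l2 u x = 0)"
  proof
    assume "AE x in lebesgue. rep_l2 u x = 0"
    then have "AE x in lborel. rep_l2 u x = 0" by (simp add: AE_completion_iff)
    then have "AE x in lborel. rep_l2 u x = rep_l2 0 x" using rep_zero_l2 by eventually_elim simp
    then show False using l2_eqI u(1) by blast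
  qed
  have "(\<lambda>x. (cmod (rep_l2 u x))\<^sup>2) \<in> borel_measurable lborel" by measurable
  then have "integrable lebesgue (\<lambda>x. (cmod (rep_l2 u x))\<^sup>2)"
    using sq_int_norm[OF sq_int_rep[of u]] by (simp add: integrable_completion)
  moreover have "rep_l2 u \<in> borel_measurable lebesgue" by (rule measurable_completion) simp
  ultimately show "rep_l2 u \<in> L2" by (simp add: L2_def)
qed

text \<open>The square of \<open>mi_fact\<close> at the sum of \<open>n\<close> and \<open>m\<close>
  is \<open>mi_ratio n m\<close> times the two diagonal factorials, so raising to the power
  \<open>\<gamma> / 2\<close> compares the upper growth bound with the geometric mean of the lower
  ones. The exponent \<open>2 / \<gamma>\<close> in the threshold cancels that power and leaves
  \<open>c1 / (c2 * N)\<close>.\<close>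

lemma off_diagonal_bound:
  fixes n m :: "'n::finite \<Rightarrow> nat"
  assumes pos: "\<gamma> > 0" "c1 > 0" "c2 > 0" "N > 0"
    and ratio: "mi_ratio n m < (c1 / (c2 * N)) powr (2 / \<gamma>)"
    and up: "x \<le> c2 * mi_fact (\<lambda>i. n i + m i) powr \<gamma>"
    and dn: "c1 * mi_fact (mi_double n) powr \<gamma> \<le> p" and dm: "c1 * mi_fact (mi_double m) powr \<gamma> \<le> q"
  shows "x < 1 / N * sqrt (p * q)"
proof -
  let ?F = "mi_fact (mi_double n) * mi_fact (mi_double m)"
  have F: "?F > 0" by (simp add: mi_fact_pos)
  have "mi_fact (\<lambda>i. n i + m i) powr \<gamma> = ((mi_fact (\<lambda>i. n i + m i))\<^sup>2) powr (\<gamma> / 2)"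
    using mi_fact_pos[of "\<lambda>i. n i + m i"] by (simp add: powr_powr powr_numeral[symmetric] del: powr_numeral)
  also have "\<dots> = mi_ratio n m powr (\<gamma> / 2) * ?F powr (\<gamma> / 2)"
    unfolding mi_ratio_eq using F mi_ratio_pos[of n m] by (simp only: powr_mult less_imp_le)
  also have "\<dots> < (c1 / (c2 * N)) * ?F powr (\<gamma> / 2)"
  proof (rule mult_strict_right_mono)
    have "mi_ratio n m powr (\<gamma> / 2) < ((c1 / (c2 * N)) powr (2 / \<gamma>)) powr (\<gamma> / 2)"
      using ratio pos mi_ratio_pos[of n m] by (intro powr_less_mono2) auto
    then show "mi_ratio n m powr (\<gamma> / 2) < c1 / (c2 * N)" using pos by (simp add: powr_powr)
    show "?F powr (\<gamma> / 2) > 0" using F unfolding powr_gt_zero by linarith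
  qed
  finally have "c2 * mi_fact (\<lambda>i. n i + m i) powr \<gamma> < c2 * ((c1 / (c2 * N)) * ?F powr (\<gamma> / 2))"
    using pos by (intro mult_strict_left_mono)
  also have "\<dots> = 1 / N * (c1 * ?F powr (\<gamma> / 2))" using pos by simp
  also have "c1 * ?F powr (\<gamma> / 2) = sqrt ((c1 * mi_fact (mi_double n) powr \<gamma>) * (c1 * mi_fact (mi_double m) powr \<gamma>))"
  proof -
    have "(c1 * ?F powr (\<gamma> / 2))\<^sup>2 = c1\<^sup>2 * ?F powr \<gamma>"
      using F mi_fact_pos[of "mi_double n"] mi_fact_pos[of "mi_double m"] by (simp add: power_mult_distrib powr_power)
    also have "\<dots> = (c1 * mi_fact (mi_double n) powr \<gamma>) * (c1 * mi_fact (mi_double m) powr \<gamma>)"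
      by (simp add: powr_mult mi_fact_pos less_imp_le power2_eq_square mult_ac)
    finally show ?thesis using pos by (intro real_sqrt_unique[symmetric]) auto
  qed
  also have "1 / N * sqrt ((c1 * mi_fact (mi_double n) powr \<gamma>) * (c1 * mi_fact (mi_double m) powr \<gamma>)) \<le> 1 / N * sqrt (p * q)"
    using pos by (intro mult_left_mono real_sqrt_le_mono mult_mono dn dm order_trans[OF _ dn]) auto
  finally show ?thesis using up by simp
qed

theorem theorem2p6:
  fixes a V Vhat :: "real ^ 'n \<Rightarrow> complex"
    and x0 :: "real ^ 'n"
    and r \<gamma> c1 c2 a_min V_min \<mu>0 :: real
    and I :: "('n \<Rightarrow> nat) set"
  assumes "integrable lebesgue a" and "hermitian_ae a"
    and "integrable lebesgue Vhat" and "hermitian_ae Vhat" and "V = fourier Vhat"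
  defines "a_min \<equiv> (INF x. Re (fourier a x))"
    and "V_min \<equiv> (INF x. Re (V x))"
    and "\<mu>0 \<equiv> min a_min V_min"
  assumes "\<And>x. Re (V x0) \<le> Re (V x)"
    and "r > 0" and "C_infinity_on (open_cube r 0) a"
    and "\<And>\<alpha>::real. \<alpha> > 0 \<Longrightarrow>
           \<exists>C>0. \<forall>\<^sub>F x in nhds x0. Re (V x) - Re (V x0) \<le> C * norm (x - x0) powr \<alpha>"
    and "V_min \<le> a_min"
    and "\<gamma> > 0" and "c1 > 0" and "c2 > 0"
    and "infinite I"
    and "\<And>n. n \<in> I \<Longrightarrow> (-1) ^ mi_abs n * Re (multi_partial (mi_double n) a 0) < 0"
    and "\<And>n. n \<in> I \<Longrightarrow>
           cmod (multi_partial (mi_double n) a 0) \<ge> c1 * mi_fact (mi_double n) powr \<gamma>"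
    and "\<And>n. cmod (multi_partial n a 0) \<le> c2 * mi_fact n powr \<gamma>"
  shows "infinite {\<kappa>::real. \<kappa> < \<mu>0 \<and>
           L2_eigenvalue (conv_potential_op a V) (complex_of_real \<kappa>)}"
proof -
  note a = assms(1) and a_herm = assms(2) and Vh = assms(3) and Vh_herm = assms(4) and V_eq = assms(5)
    and x0_min = assms(9) and r = assms(10) and smooth = assms(11) and flat = assms(12)
    and V_le_a = assms(13) and pos = assms(14-16) and I = assms(17) and neg_n = assms(18)
    and low_n = assms(19) and up_n = assms(20)
  let ?S = "open_cube r (0 :: real ^ 'n)"
  have S: "open ?S"
  proof -
    have "?S = (\<Inter>i\<in>UNIV. {x. \<bar>x $ i\<bar> < r / 2})" by (auto simp: open_cube_def)
    also have "open \<dots>" by (intro open_INT ballI open_Collect_less continuous_intros) simp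
    finally show ?thesis .
  qed
  have S_sym: "- x \<in> ?S" if "x \<in> ?S" for x using that by (simp add: open_cube_def)
  have "continuous_on ?S (partials [] a)" using smooth by (simp only: C_infinity_on_def)
  then have a_cont: "continuous_on ?S a" by (simp add: partials_def)
  have "\<exists>g. integrable lborel g \<and> (\<forall>x. g (- x) = cnj (g x)) \<and> (AE x in lborel. a x = g x) \<and> (\<forall>x\<in>?S. g x = a x)"
    by (rule hermitian_borel_representative[OF a _ S a_cont S_sym])
       (use a_herm in \<open>simp_all add: hermitian_ae_def AE_completion_iff\<close>)
  then obtain g where g: "integrable lborel g" "\<And>x. g (- x) = cnj (g x)" "AE x in lborel. a x = g x" "\<And>x. x \<in> ?S \<Longrightarrow> g x = a x"
    by blast
  \<comment> \<open>\<open>Vhat\<close> enters only through its transform, so no pointwise agreement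
    is asked for: the set in the lemma is empty.\<close>
  have "\<exists>v. integrable lborel v \<and> (\<forall>x. v (- x) = cnj (v x)) \<and> (AE x in lborel. Vhat x = v x) \<and> (\<forall>x\<in>{}. v x = Vhat x)"
    by (rule hermitian_borel_representative[OF Vh])
       (use Vh_herm in \<open>simp_all add: hermitian_ae_def AE_completion_iff\<close>)
  then obtain v where v: "integrable lborel v" "\<And>x. v (- x) = cnj (v x)" "AE x in lborel. Vhat x = v x" by blast
  have V: "V = ft v" unfolding V_eq by (rule fourier_eq_ft[OF Vh v(1,3)])
  have [measurable]: "v \<in> borel_measurable borel" using borel_measurable_integrable[OF v(1)] by simp
  have Vm[measurable]: "V \<in> borel_measurable borel" unfolding V by measurable
  define C where "C = (\<integral>x. norm (v x) \<partial>lborel)"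
  have VC: "norm (V x) \<le> C" for x unfolding V C_def by (rule norm_ft_le)
  have Vreal: "Im (V x) = 0" for x unfolding V by (rule Im_ft_hermitian[OF v(1,2)])
  have V_min: "V_min = Re (V x0)"
    unfolding V_min_def by (rule cInf_eq_minimum) (use x0_min in auto)
  \<comment> \<open>Here \<open>V_min \<le> a_min\<close> is used: the bottom is the value of the
    potential at \<open>x0\<close>, so subtracting it leaves a potential that vanishes
    there.\<close>
  have \<mu>: "\<mu>0 = Re (V x0)" using V_le_a V_min by (simp add: \<mu>0_def)
  have a_low: "\<mu>0 \<le> Re (ft g \<xi>)" for \<xi>
  proof -
    have "bdd_below (range (\<lambda>x. Re (fourier a x)))"
    proof (rule bdd_belowI2)
      show "- (\<integral>x. norm (g x) \<partial>lborel) \<le> Re (fourier a x)" for x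
        unfolding fourier_eq_ft[OF a g(1,3)]
        using norm_ft_le[of g x] abs_Re_le_cmod[of "ft g x"] by linarith
    qed
    then have "a_min \<le> Re (fourier a \<xi>)" unfolding a_min_def by (rule cINF_lower) simp
    then show ?thesis by (simp add: \<mu>0_def fourier_eq_ft[OF a g(1,3)])
  qed
  let ?A = "kernel_op (\<lambda>x y. g (x - y))"
  define T where "T u = ?A u + mult_op V u - \<mu>0 *\<^sub>R u" for u
  note kg = schur_kernel_conv[OF g(1)]
  have blA: "bounded_linear ?A" by (rule bounded_linear_kernel_op[OF kg])
  have blV: "bounded_linear (mult_op V)" by (rule bounded_linear_mult_op[OF Vm VC])
  have T: "bounded_linear T"
    unfolding T_def[abs_def] by (intro bounded_linear_sub bounded_linear_add blA blV bounded_linear_scaleR_right)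
  have sym: "T u \<bullet> w = u \<bullet> T w" for u w
  proof -
    have "?A u \<bullet> w = u \<bullet> ?A w" by (rule kernel_op_self_adjoint[OF kg]) (metis g(2) minus_diff_eq)
    moreover have "mult_op V u \<bullet> w = u \<bullet> mult_op V w" by (rule mult_op_self_adjoint[OF Vm VC Vreal])
    ultimately show ?thesis by (simp add: T_def inner_simps)
  qed
  have ess: "\<exists>F. finite F \<and> pairwise orthogonal F \<and> (\<forall>u. (\<forall>f\<in>F. u \<bullet> f = 0) \<longrightarrow> T u \<bullet> u \<ge> - d * (u \<bullet> u))"
    if "d > 0" for d
    unfolding T_def
    by (rule conv_mult_form_bounded_below_mod_finite[OF g(1,2) Vm VC _ a_low _ that])
       (use Riemann_Lebesgue[OF v(1)] x0_min in \<open>auto simp: V \<mu>\<close>)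
  \<comment> \<open>The potential measured from its minimum: real, nonnegative and vanishing to
    infinite order at \<open>x0\<close>. With it the operator \<open>T\<close> is a convolution plus
    a flat multiplication.\<close>
  define W where "W x = V x - of_real \<mu>0" for x
  have Wm[measurable]: "W \<in> borel_measurable borel" unfolding W_def[abs_def] by measurable
  have Wre: "norm (W x) = Re (V x) - Re (V x0)" for x
  proof -
    have "W x = of_real (Re (V x) - Re (V x0))" using Vreal[of x] by (simp add: W_def \<mu> complex_eq_iff)
    then show ?thesis using x0_min[of x] by (simp add: norm_of_real del: of_real_diff)
  qed
  have WC: "norm (W x) \<le> C + \<bar>\<mu>0\<bar>" for x
    unfolding W_def using norm_triangle_ineq4[of "V x" "of_real \<mu>0"] VC[of x] by simp
  have TW: "T u = ?A u + mult_op W u" for u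
  proof -
    have "AE x in lborel. rep_l2 (mult_op W u) x = W x * rep_l2 u x" by (rule rep_mult_op[OF Wm WC])
    then have "AE x in lborel. rep_l2 (mult_op V u - \<mu>0 *\<^sub>R u) x = rep_l2 (mult_op W u) x"
      using rep_minus_l2[of "mult_op V u" "\<mu>0 *\<^sub>R u"] rep_mult_op[OF Vm VC, of u] rep_scaleR_l2[of \<mu>0 u]
      by eventually_elim (simp add: W_def[of x for x] scaleR_conv_of_real left_diff_distrib)
    then have "mult_op V u - \<mu>0 *\<^sub>R u = mult_op W u" by (rule l2_eqI)
    then show ?thesis by (simp add: T_def add_diff_eq[symmetric])
  qed
  have near: "\<exists>\<rho>>0. \<forall>k x. mset (map fst k) = mset js \<longrightarrow> (\<forall>p\<in>set k. snd p \<noteq> 0) \<longrightarrow>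
       norm x + (\<Sum>p\<leftarrow>k. \<bar>snd p\<bar>) < \<rho> \<longrightarrow> norm (finite_diff (axis_steps k) g x - partials js a 0) \<le> \<epsilon>"
    if \<epsilon>: "\<epsilon> > 0" for \<epsilon> js
  proof -
    obtain \<rho> where \<rho>: "\<rho> > 0" "\<And>k x. mset (map fst k) = mset js \<Longrightarrow> (\<forall>p\<in>set k. snd p \<noteq> 0) \<Longrightarrow>
       norm x + (\<Sum>p\<leftarrow>k. \<bar>snd p\<bar>) < \<rho> \<Longrightarrow> norm (finite_diff (axis_steps k) a x - partials js a 0) \<le> \<epsilon>"
      using finite_diff_near_partials[OF smooth r \<epsilon>, of js] by blast
    \<comment> \<open>Below \<open>r / 2\<close> all evaluation points lie in the cube, where
      \<open>g\<close> equals \<open>a\<close>. Thus differences of the Borel representative still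
      approximate derivatives of \<open>a\<close>.\<close>
    have "finite_diff (axis_steps k) g x = finite_diff (axis_steps k) a x" if "norm x + (\<Sum>p\<leftarrow>k. \<bar>snd p\<bar>) < r / 2" for k x
    proof (rule finite_diff_cong)
      fix y assume "norm (y - x) \<le> total_step (axis_steps k)"
      then have "norm y < r / 2" using that norm_triangle_ineq[of "y - x" x] by simp
      then have "\<bar>y $ i\<bar> < r / 2" for i using component_le_norm_cart[of y i] by linarith
      then show "g y = a y" by (intro g(4)) (simp add: open_cube_def)
    qed (auto simp: axis_steps_def norm_axis_1)
    then show ?thesis using \<rho> r by (intro exI[of _ "min \<rho> (r / 2)"]) auto
  qed
  have lim: "((\<lambda>h. T (test_vec x0 h ks) \<bullet> test_vec x0 h ks') \<longlongrightarrow> (- 1) ^ length ks' * Re (partials js a 0)) (at_right 0)"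
    if js: "mset js = mset ks + mset ks'" for js ks ks'
  proof -
    have "((\<lambda>h. mult_op W (test_vec x0 h ks) \<bullet> test_vec x0 h ks') \<longlongrightarrow> 0) (at_right 0)"
      by (rule mult_form_test_vec_tendsto[OF Wm WC]) (use flat in \<open>simp add: Wre\<close>)
    from tendsto_add[OF conv_form_test_vec_tendsto[OF g(1) js near] this]
    show ?thesis by (simp add: TW inner_add_left)
  qed
  have neg: "\<exists>u. (\<forall>e\<in>E. u \<bullet> e = 0) \<and> T u \<bullet> u < 0" if E: "finite E" for E
  proof -
    \<comment> \<open>One test vector more than there are constraints in \<open>E\<close>, so that
      some nontrivial combination is orthogonal to \<open>E\<close>.\<close>
    define N where "N = Suc (card E)"
    \<comment> \<open>The threshold for which the growth conditions push the off-diagonal entries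
      below \<open>1 / N\<close> times the geometric mean of the diagonal ones, as diagonal
      dominance of \<open>N\<close> vectors demands.\<close>
    define \<tau> where "\<tau> = (c1 / (c2 * real N)) powr (2 / \<gamma>)"
    have \<tau>: "\<tau> > 0" using pos by (simp add: \<tau>_def N_def)
    obtain J where J: "J \<subseteq> I" "finite J" "card J = N" "\<And>n m. n \<in> J \<Longrightarrow> m \<in> J \<Longrightarrow> n \<noteq> m \<Longrightarrow> mi_ratio n m < \<tau>"
      using sparse_subset[OF I \<tau>, of N] by blast
    define L where "L n m = (- 1) ^ mi_abs m * Re (multi_partial (\<lambda>i. n i + m i) a 0)" for n m
    define M where "M h n m = T (test_vec x0 h (multi_list n)) \<bullet> test_vec x0 h (multi_list m)" for h n m
    have Mlim: "((\<lambda>h. M h n m) \<longlongrightarrow> L n m) (at_right 0)" for n m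
      using lim[OF mset_multi_list_add[of n m]]
      by (simp add: M_def L_def multi_partial_conv_partials length_multi_list)
    have dbl: "mi_double n = (\<lambda>i. n i + n i)" for n by (auto simp: mi_double_def)
    have diag: "L n n < 0" "c1 * mi_fact (mi_double n) powr \<gamma> \<le> - L n n" if "n \<in> J" for n
    proof -
      have nI: "n \<in> I" using that J(1) by blast
      show neg: "L n n < 0" using neg_n[OF nI] by (simp add: L_def dbl)
      \<comment> \<open>The lower growth bound concerns the modulus of the derivative. Only because
        derivatives of even multi-index are real does it bound the real part, and with the sign
        condition \<open>- L n n\<close>.\<close>
      have "Im (partials (multi_list (\<lambda>i. n i + n i)) a 0) = 0"
        by (rule even_partial_real[OF g(2) mset_multi_list_add[of n n] near])
      then have "cmod (multi_partial (mi_double n) a 0) = \<bar>Re (multi_partial (mi_double n) a 0)\<bar>"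
        by (simp add: multi_partial_conv_partials dbl cmod_def)
      also have "\<dots> = \<bar>L n n\<bar>" by (simp add: L_def dbl abs_mult power_abs)
      finally show "c1 * mi_fact (mi_double n) powr \<gamma> \<le> - L n n" using low_n[OF nI] neg by simp
    qed
    have off: "\<bar>L n m\<bar> < 1 / real N * sqrt (L n n * L m m)" if nm: "n \<in> J" "m \<in> J" "n \<noteq> m" for n m
    proof -
      have "\<bar>L n m\<bar> = \<bar>Re (multi_partial (\<lambda>i. n i + m i) a 0)\<bar>" by (simp add: L_def abs_mult power_abs)
      also have "\<dots> \<le> cmod (multi_partial (\<lambda>i. n i + m i) a 0)" by (rule abs_Re_le_cmod)
      also have "\<dots> \<le> c2 * mi_fact (\<lambda>i. n i + m i) powr \<gamma>" by (rule up_n)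
      finally have "\<bar>L n m\<bar> < 1 / real N * sqrt (- L n n * - L m m)"
        using pos J(4)[OF nm] diag(2)[OF nm(1)] diag(2)[OF nm(2)]
        by (intro off_diagonal_bound) (auto simp: \<tau>_def N_def)
      then show ?thesis by simp
    qed
    \<comment> \<open>Negativity of the diagonal and dominance are finitely many strict inequalities
      for the limit matrix \<open>L\<close>, so a single small \<open>h\<close> satisfies all of
      them for \<open>M h\<close>.\<close>
    have "\<forall>\<^sub>F h in at_right 0. \<forall>n\<in>J. M h n n < 0"
      using J(2) by (intro eventually_ball_finite ballI order_tendstoD(2)[OF Mlim] diag)
    moreover have "\<forall>\<^sub>F h in at_right 0. \<forall>n\<in>J. \<forall>m\<in>J. n \<noteq> m \<longrightarrow> \<bar>M h n m\<bar> < 1 / real N * sqrt (M h n n * M h m m)"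
    proof (intro eventually_ball_finite J(2) ballI)
      fix n m assume nm: "n \<in> J" "m \<in> J"
      show "\<forall>\<^sub>F h in at_right 0. n \<noteq> m \<longrightarrow> \<bar>M h n m\<bar> < 1 / real N * sqrt (M h n n * M h m m)"
      proof (cases "n = m")
        case False
        have "((\<lambda>h. 1 / real N * sqrt (M h n n * M h m m) - \<bar>M h n m\<bar>) \<longlongrightarrow> 1 / real N * sqrt (L n n * L m m) - \<bar>L n m\<bar>) (at_right 0)"
          by (intro tendsto_diff tendsto_mult tendsto_const tendsto_real_sqrt tendsto_rabs Mlim)
        from order_tendstoD(1)[OF this, of 0] off[OF nm False] show ?thesis by simp
      qed simp
    qed
    ultimately have "\<forall>\<^sub>F h in at_right 0. (\<forall>n\<in>J. M h n n < 0) \<and>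
       (\<forall>n\<in>J. \<forall>m\<in>J. n \<noteq> m \<longrightarrow> \<bar>M h n m\<bar> < 1 / real N * sqrt (M h n n * M h m m))"
      by (rule eventually_conj)
    from eventually_happens'[OF trivial_limit_at_right_real this]
    obtain h where h0: "(\<forall>n\<in>J. M h n n < 0) \<and>
       (\<forall>n\<in>J. \<forall>m\<in>J. n \<noteq> m \<longrightarrow> \<bar>M h n m\<bar> < 1 / real N * sqrt (M h n n * M h m m))" ..
    then have h: "M h n n < 0" "m \<in> J \<Longrightarrow> n \<noteq> m \<Longrightarrow> \<bar>M h n m\<bar> < 1 / real (card J) * sqrt (M h n n * M h m m)"
      if "n \<in> J" for n m
      using that unfolding J(3) by simp_all
    let ?u = "\<lambda>n. test_vec x0 h (multi_list n)"
    obtain z where z: "\<exists>n\<in>J. z n \<noteq> 0" "\<And>e. e \<in> E \<Longrightarrow> (\<Sum>n\<in>J. z n * (?u n \<bullet> e)) = 0"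
      using homogeneous_system[OF E J(2), of "\<lambda>n e. ?u n \<bullet> e"] J(3) by (auto simp: N_def)
    define u where "u = (\<Sum>n\<in>J. z n *\<^sub>R ?u n)"
    interpret T: bounded_linear T by (rule T)
    have "T u \<bullet> u = (\<Sum>m\<in>J. \<Sum>n\<in>J. z n * z m * M h n m)"
      by (simp add: u_def T.sum T.scaleR inner_sum_left inner_sum_right M_def sum_distrib_left mult_ac)
    also have "\<dots> = (\<Sum>n\<in>J. \<Sum>m\<in>J. z n * z m * M h n m)" by (rule sum.swap)
    also have "\<dots> < 0"
      by (rule negative_definite_of_small_off_diagonal[OF J(2)]) (use h z(1) J(3) in \<open>auto simp: N_def simp del: of_nat_Suc\<close>)
    finally have "T u \<bullet> u < 0" .
    moreover have "\<forall>e\<in>E. u \<bullet> e = 0" using z(2) by (simp add: u_def inner_sum_left)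
    ultimately show ?thesis by blast
  qed
  have "infinite {k. k < 0 \<and> (\<exists>u. u \<noteq> 0 \<and> T u = k *\<^sub>R u)}" (is "infinite ?K")
    by (rule infinite_negative_eigenvalues[OF T sym ess neg])
  \<comment> \<open>Eigenvalues of \<open>T\<close> are measured from \<open>\<mu>0\<close>; the
    shift back is injective and keeps their number infinite.\<close>
  then have inf: "infinite ((\<lambda>k. k + \<mu>0) ` ?K)" by (subst finite_image_iff) (auto simp: inj_on_def)
  have sub: "(\<lambda>k. k + \<mu>0) ` ?K \<subseteq> {\<kappa>. \<kappa> < \<mu>0 \<and> L2_eigenvalue (conv_potential_op a V) (complex_of_real \<kappa>)}"
  proof
    fix \<kappa> assume "\<kappa> \<in> (\<lambda>k. k + \<mu>0) ` ?K"
    then obtain k u where k: "k < 0" "u \<noteq> 0" "T u = k *\<^sub>R u" "\<kappa> = k + \<mu>0" by blast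
    have "?A u + mult_op V u = \<kappa> *\<^sub>R u"
      using k(3) by (simp add: T_def k(4) scaleR_left_distrib diff_eq_eq)
    from L2_eigenvalue_of_l2[OF a g(1,3) Vm VC k(2) this] k(1,4)
    show "\<kappa> \<in> {\<kappa>. \<kappa> < \<mu>0 \<and> L2_eigenvalue (conv_potential_op a V) (complex_of_real \<kappa>)}" by simp
  qed
  show ?thesis by (rule infinite_super[OF sub inf])
qed

end
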